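(* Let $n\ge 3$. Let $K$ be a convex body on the unit sphere $\mathbb{S}^{n-1}\subset\mathbb{R}^n$ with (spherical) centroid at $\theta\in\mathbb{S}^{n-1}$. Then for every $u\in\mathbb{S}^{n-1}$ that is orthogonal to $\theta$, $$\sigma(K\cap u^+)\ \ge\ \left(1-\frac1n\right)^{n-1}\sigma(K).$$ Moreover, the constant in this inequality is optimal: for each $n\ge 3$, there is no constant $c>\left(1-\frac1n\right)^{n-1}$ such that $\sigma(K\cap u^+)\ge c\,\sigma(K)$ holds for all convex bodies $K$ on $\mathbb{S}^{n-1}$ and all $u\in\mathbb{S}^{n-1}$ orthogonal to the centroid of $K$.
   Context: $\mathbb{S}^{n-1}$ is the Euclidean unit sphere in $\mathbb{R}^n$ and $\sigma$ denotes the spherical measure (the surface area measure) on $\mathbb{S}^{n-1}$. For $u\in\mathbb{S}^{n-1}$, $u^+=\{x\in\mathbb{R}^n:\langle x,u\rangle\ge 0\}$. A convex body in $\mathbb{R}^n$ is a compact convex set with non-empty interior. A set $A\subset\mathbb{S}^{n-1}$ is called a convex body on $\mathbb{S}^{n-1}$ if it is contained in some open hemisphere of $\mathbb{S}^{n-1}$ and the set $\mathcal{C}=\{t\xi:\ 0\le t\le 1,\ \xi\in A\}$ is a convex body in $\mathbb{R}^n$. The centroid of a convex body $A$ on $\mathbb{S}^{n-1}$ is the radial projection onto $\mathbb{S}^{n-1}$ of the Euclidean centroid $c(\mathcal{C})=\frac{1}{\mathrm{vol}_n(\mathcal{C})}\int_{\mathcal{C}}x\,dx$, i.e. the point $c(\mathcal{C})/|c(\mathcal{C})|$;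 equivalently, it is $M(A)/|M(A)|$, where $M(A)=\int_A\xi\,d\sigma(\xi)\in\mathbb{R}^n$ and $|\cdot|$ is the Euclidean norm. *)

theory Defs
  imports "HOL-Analysis.Analysis"
begin

text \<open>
  The surface area measure on the Euclidean unit sphere, as given by polar coordinates: it is
  \<open>n\<close> times the image of Lebesgue measure on the punctured unit ball under the radial
  projection, i.e. \<open>\<sigma>(E) = n \<cdot> vol {t \<xi>. 0 < t \<le> 1, \<xi> \<in> E}\<close> (see below). The factor \<open>n\<close> makes
  the total mass equal to the surface area \<open>n \<cdot> vol(B)\<close>.
\<close>

definition sphere_measure :: "'a::euclidean_space measure" where
  "sphere_measure =
     scale_measure (of_nat DIM('a))
       (distr (restrict_space lborel (cball 0 1 - {0})) (restrict_space borel (sphere 0 1))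
          (\<lambda>x. x /\<^sub>R norm x))"

definition convex_body :: "'a::euclidean_space set \<Rightarrow> bool" where
  "convex_body C \<longleftrightarrow> compact C \<and> convex C \<and> interior C \<noteq> {}"

definition sector :: "'a::euclidean_space set \<Rightarrow> 'a set" where
  "sector A = {t *\<^sub>R \<xi> | t \<xi>. 0 \<le> t \<and> t \<le> 1 \<and> \<xi> \<in> A}"

definition spherical_convex_body :: "'a::euclidean_space set \<Rightarrow> bool" where
  "spherical_convex_body A \<longleftrightarrow>
     A \<subseteq> sphere 0 1 \<and> (\<exists>v\<in>sphere 0 1. A \<subseteq> {x. x \<bullet> v > 0}) \<and> convex_body (sector A)"

definition centroid :: "'a::euclidean_space set \<Rightarrow> 'a" where
  "centroid C = (1 / measure lborel C) *\<^sub>R (LINT x:C|lborel. x)"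

definition spherical_centroid :: "'a::euclidean_space set \<Rightarrow> 'a" where
  "spherical_centroid A = centroid (sector A) /\<^sub>R norm (centroid (sector A))"

definition halfspace :: "'a::euclidean_space \<Rightarrow> 'a set" where
  "halfspace u = {x. x \<bullet> u \<ge> 0}"

lemma space_sphere_measure: "space (sphere_measure :: 'a::euclidean_space measure) = sphere 0 1"
  by (simp add: sphere_measure_def space_scale_measure space_restrict_space)

lemma sets_sphere_measure:
  "sets (sphere_measure :: 'a::euclidean_space measure) = sets (restrict_space borel (sphere 0 1))"
  by (simp add: sphere_measure_def)

lemma emeasure_sphere_measure:
  fixes E :: "'a::euclidean_space set"
  assumes "E \<in> sets borel" "E \<subseteq> sphere 0 1"
  shows "emeasure sphere_measure E =
    of_nat DIM('a) * emeasure lborel {t *\<^sub>R \<xi> | t \<xi>. 0 < t \<and> t \<le> 1 \<and> \<xi> \<in> E}"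
proof -
  let ?P = "cball 0 1 - {0::'a}"
  let ?M = "restrict_space lborel ?P" and ?S = "restrict_space borel (sphere (0::'a) 1)"
  have E: "E \<in> sets ?S"
    using assms by (auto simp: sets_restrict_space_iff)
  have m: "(\<lambda>x. x /\<^sub>R norm x) \<in> measurable ?M ?S"
  proof (rule measurable_restrict_space2)
    show "(\<lambda>x. x /\<^sub>R norm x) \<in> space ?M \<rightarrow> sphere (0::'a) 1"
      by (auto simp: space_restrict_space)
    show "(\<lambda>x. x /\<^sub>R norm x) \<in> borel_measurable ?M"
      by (rule measurable_restrict_space1) measurable
  qed
  have eq: "(\<lambda>x. x /\<^sub>R norm x) -` E \<inter> space ?M = {t *\<^sub>R \<xi> | t \<xi>. 0 < t \<and> t \<le> 1 \<and> \<xi> \<in> E}"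
    (is "?L = ?R")
  proof
    show "?L \<subseteq> ?R"
    proof
      fix x assume "x \<in> ?L"
      then have "x = norm x *\<^sub>R (x /\<^sub>R norm x)" "0 < norm x" "norm x \<le> 1" "x /\<^sub>R norm x \<in> E"
        by (auto simp: space_restrict_space)
      then show "x \<in> ?R" by blast
    qed
    show "?R \<subseteq> ?L"
      using assms(2) by (auto simp: space_restrict_space)
  qed
  have "emeasure sphere_measure E = of_nat DIM('a) * emeasure ?M ?R"
    unfolding sphere_measure_def emeasure_scale_measure emeasure_distr[OF m E] eq ..
  also have "emeasure ?M ?R = emeasure lborel ?R"
    using assms(2) by (intro emeasure_restrict_space) auto
  finally show ?thesis .
qed

lemma emeasure_sphere_measure_sphere:
  "emeasure sphere_measure (sphere (0::'a::euclidean_space) 1) =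
     ennreal (DIM('a) * unit_ball_vol (real DIM('a)))"
proof -
  have eq: "{t *\<^sub>R \<xi> | t \<xi>. 0 < t \<and> t \<le> 1 \<and> \<xi> \<in> sphere (0::'a) 1} = cball 0 1 - {0}"
    (is "?L = ?R")
  proof
    show "?R \<subseteq> ?L"
    proof
      fix x assume "x \<in> ?R"
      then have "x = norm x *\<^sub>R (x /\<^sub>R norm x)" "0 < norm x" "norm x \<le> 1" "x /\<^sub>R norm x \<in> sphere 0 1"
        by auto
      then show "x \<in> ?L" by blast
    qed
  qed auto
  have "emeasure lborel (cball (0::'a) 1 - {0}) = emeasure lborel (cball (0::'a) 1)"
    by (subst emeasure_Diff) auto
  then have "emeasure lborel {t *\<^sub>R \<xi> | t \<xi>. 0 < t \<and> t \<le> 1 \<and> \<xi> \<in> sphere (0::'a) 1} =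
      ennreal (unit_ball_vol (real DIM('a)))"
    unfolding eq by (simp add: emeasure_cball)
  moreover have "sphere (0::'a) 1 \<in> sets borel"
    by simp
  ultimately show ?thesis
    using emeasure_sphere_measure[of "sphere (0::'a) 1"]
    by (simp only: order.refl ennreal_mult ennreal_of_nat_eq_real_of_nat
        of_nat_0_le_iff unit_ball_vol_nonneg)
qed

end

theory Submission
  imports Defs
begin

text \<open>
  Write \<open>n\<close> for the dimension and \<open>c = (1 - 1/n)^(n - 1)\<close>.

  From the sphere to cones. A convex body on the sphere spans a closed convex pointed cone \<open>P\<close>, and its
  sector is the part of \<open>P\<close> in the unit ball \<open>B\<close>. The measure of a conic set on the sphere is
  \<open>n + 1\<close> times the integral of \<open>norm x\<close> over its part in \<open>B\<close> (\<open>sphere_measure_conic\<close>), and the centroid is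
  orthogonal to \<open>u\<close> if and only if the integral of \<open>x \<bullet> u\<close> over the sector vanishes. Both integrands have
  degree one, so the inequality becomes a statement about cones, \<open>cone_mass_ratio\<close>: if \<open>x \<bullet> u\<close> has a
  nonnegative integral over \<open>P \<inter> B\<close>, then the half where \<open>x \<bullet> u \<ge> 0\<close> carries at least the fraction \<open>c\<close> of the
  integral of \<open>norm x\<close>.

  Localization. If this fails for some cone, then after a small tilt of \<open>u\<close> it fails with room to spare: two
  functions on \<open>P \<inter> B\<close> have a nonnegative and a positive integral. A hyperplane through the origin that
  halves the first integral leaves the second one positive on one of the two sides, and the normal may be
  taken in any prescribed plane of directions. Repeating this with a dense family of planes gives a decreasing sequence of
  cones that still violate the inequality and whose intersection lies in a two-dimensional plane
  (\<open>localization\<close>). On a late cone of the sequence, \<open>norm x\<close> is almost equal to the norm of the projection of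
  \<open>x\<close> to that plane, and exchanging the two costs a factor arbitrarily close to one
  (\<open>near_planar_cone_mass_ratio\<close>).

  The planar problem. For a cone weighted by the norm of its projection to a plane, everything is expressed by the
  \<open>(n-2)\<close>-dimensional volume of the fibres over the points of the plane. By the Prekopa-Leindler inequality its
  root of order \<open>m = n - 2\<close> is superadditive; it is also positively homogeneous. Among all such fibre functions with the
  same value on the axis and the same mass above the axis, a comparison with \<open>m\<close>-th powers of linear functions
  (\<open>planar_crossing_mass_ratio\<close>) shows that the worst case is a circular sector on which the fibre volume is
  such a power, because the two functions cross only once.

  The one-dimensional inequality. In such a sector the claim concerns
  \<open>I(x) = \<integral>\<^sub>0\<^sup>x sin(t)^m dt\<close>. In the flat case one would use the tangent of a concave function; here
  \<open>y = ((m + 1) I)^(1 / (m + 1))\<close> satisfies \<open>y(x) \<le> y(\<beta>) + y'(\<beta>) sin(x - \<beta>)\<close>, and integrating this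
  against \<open>sin(x)^m\<close> gives the constant (\<open>sin_wedge_mass_ratio\<close>).

  Optimality. A thin cone over an \<open>(n-1)\<close>-dimensional simplex is almost flat. In the flat case, a
  hyperplane through the centroid of a simplex and parallel to a facet leaves exactly the fraction \<open>c\<close> of the volume on
  the side of the opposite vertex (\<open>corner_cone_thin_ratio\<close>).
\<close>

section \<open>The Prekopa-Leindler inequality\<close>

text \<open>
  Cut \<open>A\<close> off above a point \<open>a\<close> near its supremum and \<open>B\<close> off below a point \<open>b\<close> near its infimum. The
  rescaled copies of the two remainders, translated by \<open>(1 - l) * b\<close> and by \<open>l * a\<close>, lie in \<open>H\<close> and on different sides
  of \<open>l * a + (1 - l) * b\<close>, so their lengths add up. Extrema need not be attained, hence the error \<open>e\<close>.
\<close>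

lemma brunn_minkowski_real:
  fixes A B H :: "real set" and l :: real
  assumes meas: "A \<in> sets lborel" "B \<in> sets lborel" "H \<in> sets lborel"
    and ne: "A \<noteq> {}" "B \<noteq> {}" and bdd: "A \<subseteq> {-R..R}" "B \<subseteq> {-R..R}"
    and l: "0 < l" "l < 1"
    and sub: "\<And>a b. a \<in> A \<Longrightarrow> b \<in> B \<Longrightarrow> l * a + (1 - l) * b \<in> H"
  shows "ennreal l * emeasure lborel A + ennreal (1 - l) * emeasure lborel B \<le> emeasure lborel H"
proof (rule ennreal_le_epsilon)
  fix e :: real assume e: "0 < e"
  have bA: "bdd_above A" and bB: "bdd_below B"
    using bdd by (auto intro!: bdd_aboveI[of _ R] bdd_belowI[of _ "-R"])
  have e2: "e / 2 > 0" using e by simp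
  obtain a where a: "a \<in> A" "Sup A - e / 2 < a"
    using less_cSup_iff[OF ne(1) bA, of "Sup A - e/2"] e2 by auto
  obtain b where b: "b \<in> B" "b < Inf B + e / 2"
    using cInf_less_iff[OF ne(2) bB, of "Inf B + e/2"] e2 by auto
  have affine: "emeasure lborel {x. (x - t) / c \<in> S} = ennreal c * emeasure lborel S"
    if "c > 0" "S \<in> sets lborel" for c t :: real and S
  proof -
    have [measurable]: "S \<in> sets borel" using that by simp
    have "emeasure lborel {x. (x - t) / c \<in> S} = (\<integral>\<^sup>+ x. indicator S ((x - t) / c) \<partial>lborel)"
    proof -
      have "{x. (x - t) / c \<in> S} \<in> sets lborel" by simp
      from nn_integral_indicator[OF this] show ?thesis
        by (simp add: indicator_def)
    qed
    also have "\<dots> = ennreal \<bar>c\<bar> * (\<integral>\<^sup>+ x. indicator S ((t + c * x - t) / c) \<partial>lborel)"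
      using that by (intro nn_integral_real_affine) auto
    also have "(\<integral>\<^sup>+ x. indicator S ((t + c * x - t) / c) \<partial>lborel) = (\<integral>\<^sup>+ x. indicator S x \<partial>lborel)"
      using that by (intro nn_integral_cong) auto
    finally show ?thesis using that by simp
  qed
  define A' where "A' = A \<inter> {..a}"
  define B' where "B' = B \<inter> {b<..}"
  have mA'[measurable]: "A' \<in> sets borel" and mB'[measurable]: "B' \<in> sets borel"
    using meas by (auto simp: A'_def B'_def)
  define HA where "HA = {x. (x - (1 - l) * b) / l \<in> A'}"
  define HB where "HB = {x. (x - l * a) / (1 - l) \<in> B'}"
  have [measurable]: "HA \<in> sets borel" "HB \<in> sets borel"
    unfolding HA_def HB_def by measurable
  have HA: "emeasure lborel HA = ennreal l * emeasure lborel A'"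
    unfolding HA_def by (rule affine) (use l in auto)
  have HB: "emeasure lborel HB = ennreal (1 - l) * emeasure lborel B'"
    unfolding HB_def by (rule affine) (use l in auto)
  have "HA \<inter> HB = {}"
  proof -
    { fix x assume "x \<in> HA" "x \<in> HB"
      then have "(x - (1 - l) * b) / l \<le> a" "(x - l * a) / (1 - l) > b"
        by (auto simp: HA_def HB_def A'_def B'_def)
      then have "x \<le> l * a + (1 - l) * b" "x > l * a + (1 - l) * b"
        using l by (auto simp: field_simps)
      then have False by simp }
    then show ?thesis by auto
  qed
  moreover have "HA \<union> HB \<subseteq> H"
  proof -
    { fix x assume "x \<in> HA"
      then have "(x - (1 - l) * b) / l \<in> A" by (auto simp: HA_def A'_def)
      from sub[OF this b(1)] have "x \<in> H" using l by auto }
    moreover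
    { fix x assume "x \<in> HB"
      then have "(x - l * a) / (1 - l) \<in> B" by (auto simp: HB_def B'_def)
      from sub[OF a(1) this] have "x \<in> H" using l by auto }
    ultimately show ?thesis by auto
  qed
  ultimately have le: "emeasure lborel HA + emeasure lborel HB \<le> emeasure lborel H"
    using meas by (subst plus_emeasure) (auto intro!: emeasure_mono)
  have "emeasure lborel A \<le> emeasure lborel (A' \<union> {Sup A - e / 2 .. Sup A})"
    using meas a cSup_upper[OF _ bA] by (intro emeasure_mono) (auto simp: A'_def)
  also have "\<dots> \<le> emeasure lborel A' + emeasure lborel {Sup A - e / 2 .. Sup A}"
    by (intro emeasure_subadditive) auto
  finally have lA: "emeasure lborel A \<le> emeasure lborel A' + ennreal (e / 2)"
    using e by simp
  have "emeasure lborel B \<le> emeasure lborel (B' \<union> {Inf B .. Inf B + e / 2})"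
    using meas b cInf_lower[OF _ bB] by (intro emeasure_mono) (auto simp: B'_def)
  also have "\<dots> \<le> emeasure lborel B' + emeasure lborel {Inf B .. Inf B + e / 2}"
    by (intro emeasure_subadditive) auto
  finally have lB: "emeasure lborel B \<le> emeasure lborel B' + ennreal (e / 2)"
    using e by simp
  have "ennreal l * emeasure lborel A + ennreal (1 - l) * emeasure lborel B
      \<le> ennreal l * (emeasure lborel A' + ennreal (e / 2)) + ennreal (1 - l) * (emeasure lborel B' + ennreal (e / 2))"
    by (intro add_mono mult_left_mono lA lB) auto
  also have "\<dots> = (emeasure lborel HA + emeasure lborel HB) + ennreal (l * (e/2) + (1 - l) * (e/2))"
    unfolding HA HB
    proof -
      have "ennreal (l * (e/2) + (1 - l) * (e/2)) = ennreal l * ennreal (e/2) + ennreal (1 - l) * ennreal (e/2)"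
        using l e by (subst ennreal_plus) (auto simp: ennreal_mult[symmetric])
      then show "ennreal l * (emeasure lborel A' + ennreal (e / 2)) + ennreal (1 - l) * (emeasure lborel B' + ennreal (e / 2))
        = (ennreal l * emeasure lborel A' + ennreal (1 - l) * emeasure lborel B') + ennreal (l * (e/2) + (1 - l) * (e/2))"
        by (simp only: distrib_left) (simp add: ac_simps)
    qed
  also have "l * (e/2) + (1 - l) * (e/2) = e / 2" by (simp only: distrib_right[symmetric]) simp
  also have "(emeasure lborel HA + emeasure lborel HB) + ennreal (e / 2) \<le> emeasure lborel H + ennreal e"
    using le e by (intro add_mono) (auto intro!: ennreal_leI)
  finally show "ennreal l * emeasure lborel A + ennreal (1 - l) * emeasure lborel B \<le> emeasure lborel H + ennreal e" .
qed

text \<open>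
  This is applied to functions with values at most one. When the supremum is equal to one, the level sets that occur
  here are all nonempty, as \<open>brunn_minkowski_real\<close> requires.
\<close>

lemma layer_cake_unit:
  fixes f :: "'a::euclidean_space \<Rightarrow> real"
  assumes [measurable]: "f \<in> borel_measurable borel" and "\<And>x. 0 \<le> f x"
  shows "(\<integral>\<^sup>+ s. indicator {0<..<1} s * emeasure lborel {x. s < f x} \<partial>lborel)
       = (\<integral>\<^sup>+ x. ennreal (min 1 (f x)) \<partial>lborel)"
proof -
  have "(\<integral>\<^sup>+ s. indicator {0<..<1} s * emeasure lborel {x. s < f x} \<partial>lborel)
     = (\<integral>\<^sup>+ s. (\<integral>\<^sup>+ x. indicator {0<..<1} s * indicator {x. s < f x} x \<partial>lborel) \<partial>lborel)"
    by (intro nn_integral_cong) (simp add: nn_integral_cmult)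
  also have "\<dots> = (\<integral>\<^sup>+ x. (\<integral>\<^sup>+ s. indicator {0<..<1} s * indicator {x. s < f x} x \<partial>lborel) \<partial>(lborel::'a measure))"
    by (rule lborel_pair.Fubini') (auto simp: indicator_def case_prod_beta)
  also have "\<dots> = (\<integral>\<^sup>+ x. ennreal (min 1 (f x)) \<partial>lborel)"
  proof (intro nn_integral_cong)
    fix x
    have "(\<integral>\<^sup>+ s. indicator {0<..<1} s * indicator {x. s < f x} x \<partial>lborel)
        = (\<integral>\<^sup>+ s. indicator {0<..<min 1 (f x)} s \<partial>lborel)"
      by (intro nn_integral_cong) (auto simp: indicator_def)
    also have "\<dots> = ennreal (min 1 (f x))" using assms(2)[of x] by simp
    finally show "(\<integral>\<^sup>+ s. indicator {0<..<1} s * indicator {x. s < f x} x \<partial>lborel) = ennreal (min 1 (f x))" .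
  qed
  finally show ?thesis .
qed

text \<open>
  After division of \<open>f\<close> and \<open>g\<close> by their suprema, \<open>brunn_minkowski_real\<close> applies to the level sets at each level
  in \<open>(0, 1)\<close>. Integration over the levels bounds the integral of \<open>h\<close> below by a weighted arithmetic mean of the
  normalized integrals, which exceeds the geometric mean.
\<close>

lemma prekopa_leindler_real_bounded:
  fixes f g :: "real \<Rightarrow> real" and h :: "real \<Rightarrow> ennreal" and l a b M R :: real
  assumes meas[measurable]: "f \<in> borel_measurable borel" "g \<in> borel_measurable borel" "h \<in> borel_measurable borel"
    and l: "0 < l" "l < 1"
    and f: "\<And>x. 0 \<le> f x" "\<And>x. f x \<le> M" "\<And>x. f x \<noteq> 0 \<Longrightarrow> \<bar>x\<bar> \<le> R"
    and g: "\<And>x. 0 \<le> g x" "\<And>x. g x \<le> M" "\<And>x. g x \<noteq> 0 \<Longrightarrow> \<bar>x\<bar> \<le> R"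
    and h: "\<And>x y. ennreal (f x powr l * g y powr (1 - l)) \<le> h (l * x + (1 - l) * y)"
    and ab: "0 \<le> a" "0 \<le> b"
    and fa: "ennreal a \<le> (\<integral>\<^sup>+ x. ennreal (f x) \<partial>lborel)" and gb: "ennreal b \<le> (\<integral>\<^sup>+ x. ennreal (g x) \<partial>lborel)"
  shows "ennreal (a powr l * b powr (1 - l)) \<le> (\<integral>\<^sup>+ x. h x \<partial>lborel)"
proof (cases "a = 0 \<or> b = 0")
  case False
  then have a: "a > 0" and b: "b > 0" using ab by auto
  have pos: "0 < (SUP x. F x) \<and> (\<forall>x. F x \<le> (SUP x. F x))"
    if F: "\<And>x. 0 \<le> F x" "\<And>x. F x \<le> M" and Fa: "ennreal c \<le> (\<integral>\<^sup>+ x. ennreal (F x) \<partial>lborel)" "c > 0" for F :: "real \<Rightarrow> real" and c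
  proof -
    have bd: "bdd_above (range F)" using F(2) by (auto intro!: bdd_aboveI[of _ M])
    have up: "F x \<le> (SUP x. F x)" for x using bd by (intro cSUP_upper) auto
    have "\<exists>x. F x \<noteq> 0"
    proof (rule ccontr)
      assume "\<not> ?thesis"
      then have "(\<integral>\<^sup>+ x. ennreal (F x) \<partial>lborel) = 0" by simp
      with Fa show False by simp
    qed
    then obtain x where "F x > 0" using F(1) by (metis order_le_less)
    then show ?thesis using up by (meson order_less_le_trans)
  qed
  define Sf where "Sf = (SUP x. f x)"
  define Sg where "Sg = (SUP x. g x)"
  have Sf: "Sf > 0" "\<And>x. f x \<le> Sf" using pos[OF f(1,2) fa a] unfolding Sf_def by auto
  have Sg: "Sg > 0" "\<And>x. g x \<le> Sg" using pos[OF g(1,2) gb b] unfolding Sg_def by auto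
  define S where "S = Sf powr l * Sg powr (1 - l)"
  have S: "S > 0" using Sf Sg by (simp add: S_def)
  \<comment> \<open>Cutting \<open>h\<close> off at \<open>S\<close>, the product of the suprema, makes it finite, and \<open>k\<close> at most one.\<close>
  define k where "k x = enn2real (min (h x) (ennreal S)) / S" for x
  have [measurable]: "k \<in> borel_measurable borel" unfolding k_def by measurable
  have k0: "0 \<le> k x" for x using S by (simp add: k_def)
  have kh: "ennreal (S * k x) = min (h x) (ennreal S)" for x
    using S by (auto simp: k_def ennreal_enn2real_if min_def top_unique)
  have k1: "k x \<le> 1" for x
  proof -
    have "ennreal (S * k x) \<le> ennreal S" by (simp add: kh)
    then have "S * k x \<le> S * 1" using S by simp
    then show ?thesis using S by simp
  qed
  have sk: "s < k x" if "ennreal (s * S) < h x" "s < 1" "0 < s" for s x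
  proof -
    have "ennreal (s * S) < ennreal (S * k x)" unfolding kh using that S by (auto simp: ennreal_less_iff)
    then have "s * S < S * k x" using that S k0 by (simp add: ennreal_less_iff)
    then show ?thesis using S by (simp add: mult.commute)
  qed
  have level: "ennreal l * emeasure lborel {x. s < f x / Sf} + ennreal (1 - l) * emeasure lborel {x. s < g x / Sg}
      \<le> emeasure lborel {x. s < k x}" if s: "0 < s" "s < 1" for s
  proof (rule brunn_minkowski_real[where R = R])
    have "\<exists>x. s * Sf < f x"
    proof (rule ccontr)
      assume "\<not> ?thesis"
      then have "Sf \<le> s * Sf" unfolding Sf_def by (intro cSUP_least) (auto simp: not_less)
      then show False using s Sf by simp
    qed
    then show "{x. s < f x / Sf} \<noteq> {}" using Sf by (auto simp: field_simps)
    have "\<exists>x. s * Sg < g x"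
    proof (rule ccontr)
      assume "\<not> ?thesis"
      then have "Sg \<le> s * Sg" unfolding Sg_def by (intro cSUP_least) (auto simp: not_less)
      then show False using s Sg by simp
    qed
    then show "{x. s < g x / Sg} \<noteq> {}" using Sg by (auto simp: field_simps)
    show "{x. s < f x / Sf} \<subseteq> {-R..R}"
    proof
      fix x assume "x \<in> {x. s < f x / Sf}"
      then have "f x \<noteq> 0" using s by auto
      from f(3)[OF this] show "x \<in> {-R..R}" by (simp add: abs_le_iff)
    qed
    show "{x. s < g x / Sg} \<subseteq> {-R..R}"
    proof
      fix x assume "x \<in> {x. s < g x / Sg}"
      then have "g x \<noteq> 0" using s by auto
      from g(3)[OF this] show "x \<in> {-R..R}" by (simp add: abs_le_iff)
    qed
    fix x y assume "x \<in> {x. s < f x / Sf}" "y \<in> {x. s < g x / Sg}"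
    then have "s * Sf < f x" "s * Sg < g y" using Sf Sg by (auto simp: field_simps)
    moreover from this have "0 < f x" "0 < g y"
      using s Sf(1) Sg(1) by (meson less_trans mult_pos_pos)+
    ultimately have "(s * Sf) powr l * (s * Sg) powr (1 - l) < f x powr l * g y powr (1 - l)"
      using s Sf Sg l by (intro mult_strict_mono powr_less_mono2) auto
    also have "(s * Sf) powr l * (s * Sg) powr (1 - l) = s powr (l + (1 - l)) * S"
      using s Sf Sg by (simp only: powr_mult powr_add S_def) (simp add: powr_mult)
    also have "\<dots> = s * S" using s by simp
    finally have "ennreal (s * S) < h (l * x + (1 - l) * y)"
      by (intro less_le_trans[OF _ h]) (use s S in \<open>auto simp: ennreal_less_iff\<close>)
    then show "l * x + (1 - l) * y \<in> {x. s < k x}" using s by (auto intro: sk)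
  qed (use l in auto)
  have lc: "(\<integral>\<^sup>+ s. indicator {0<..<1} s * emeasure lborel {x. s < F x / c} \<partial>lborel) = ennreal (1 / c) * (\<integral>\<^sup>+ x. ennreal (F x) \<partial>lborel)"
    if [measurable]: "F \<in> borel_measurable borel" and "\<And>x. 0 \<le> F x" "\<And>x. F x \<le> c" "c > 0" for F and c :: real
  proof -
    have "(\<integral>\<^sup>+ s. indicator {0<..<1} s * emeasure lborel {x. s < F x / c} \<partial>lborel) = (\<integral>\<^sup>+ x. ennreal (min 1 (F x / c)) \<partial>lborel)"
      using that by (intro layer_cake_unit) auto
    also have "\<dots> = (\<integral>\<^sup>+ x. ennreal (1 / c) * ennreal (F x) \<partial>lborel)"
      using that by (intro nn_integral_cong) (simp add: ennreal_mult[symmetric] min_def, metis divide_le_eq_1_pos order.antisym divide_self_if less_irrefl)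
    finally show ?thesis by (simp add: nn_integral_cmult)
  qed
  have "ennreal l * (ennreal (1 / Sf) * ennreal a) + ennreal (1 - l) * (ennreal (1 / Sg) * ennreal b)
    \<le> ennreal l * (ennreal (1 / Sf) * (\<integral>\<^sup>+ x. ennreal (f x) \<partial>lborel)) + ennreal (1 - l) * (ennreal (1 / Sg) * (\<integral>\<^sup>+ x. ennreal (g x) \<partial>lborel))"
    using fa gb by (intro add_mono mult_left_mono) auto
  also have "\<dots> = (\<integral>\<^sup>+ s. indicator {0<..<1} s * (ennreal l * emeasure lborel {x. s < f x / Sf} + ennreal (1 - l) * emeasure lborel {x. s < g x / Sg}) \<partial>lborel)"
    using Sf Sg f(1) g(1)
    by (subst (1 2) lc[symmetric]) (auto simp: nn_integral_cmult[symmetric] nn_integral_add[symmetric] distrib_left ac_simps)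
  also have "\<dots> \<le> (\<integral>\<^sup>+ s. indicator {0<..<1} s * emeasure lborel {x. s < k x} \<partial>lborel)"
    by (intro nn_integral_mono) (auto simp: indicator_def level)
  also have "\<dots> = (\<integral>\<^sup>+ x. ennreal (k x) \<partial>lborel)"
    by (subst layer_cake_unit) (auto simp: k0 k1 min_def intro!: nn_integral_cong antisym)
  finally have "ennreal (l * (a / Sf) + (1 - l) * (b / Sg)) \<le> (\<integral>\<^sup>+ x. ennreal (k x) \<partial>lborel)"
    using l Sf Sg a b by (simp add: ennreal_mult[symmetric] ennreal_plus[symmetric] del: ennreal_plus)
  then have "ennreal S * ennreal (l * (a / Sf) + (1 - l) * (b / Sg)) \<le> ennreal S * (\<integral>\<^sup>+ x. ennreal (k x) \<partial>lborel)"
    by (intro mult_left_mono) auto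
  also have "\<dots> = (\<integral>\<^sup>+ x. ennreal (S * k x) \<partial>lborel)"
    using S k0 by (simp add: nn_integral_cmult[symmetric] ennreal_mult)
  also have "\<dots> \<le> (\<integral>\<^sup>+ x. h x \<partial>lborel)" unfolding kh by (intro nn_integral_mono) auto
  finally have *: "ennreal (S * (l * (a / Sf) + (1 - l) * (b / Sg))) \<le> (\<integral>\<^sup>+ x. h x \<partial>lborel)"
    using S l a b Sf Sg by (simp add: ennreal_mult)
  have "a powr l * b powr (1 - l) = S * ((a / Sf) powr l * (b / Sg) powr (1 - l))"
    using a b Sf Sg by (simp add: S_def powr_divide)
  also have "\<dots> \<le> S * (l * (a / Sf) + (1 - l) * (b / Sg))"
    using S l a b Sf Sg by (intro mult_left_mono Youngs_inequality_0) auto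
  finally show ?thesis using * by (meson ennreal_leI order_trans)
qed auto

lemma nn_integral_truncation_exceeds:
  fixes f :: "real \<Rightarrow> ennreal"
  assumes [measurable]: "f \<in> borel_measurable borel" and "ennreal c < (\<integral>\<^sup>+ x. f x \<partial>lborel)"
  shows "\<exists>k::nat. ennreal c < (\<integral>\<^sup>+ x. min (f x) (of_nat k) * indicator {- real k..real k} x \<partial>lborel)"
proof -
  define F where "F k x = min (f x) (of_nat k) * indicator {- real k..real k} x" for k and x :: real
  have [measurable]: "F k \<in> borel_measurable lborel" for k unfolding F_def by measurable
  have inc: "incseq F"
    by (auto simp: incseq_def le_fun_def F_def indicator_def intro: min.coboundedI2)
  have "(SUP k. F k x) = f x" for x
  proof (rule antisym)
    show "(SUP k. F k x) \<le> f x" by (rule SUP_least) (auto simp: F_def indicator_def)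
    show "f x \<le> (SUP k. F k x)"
    proof (rule dense_le)
      fix y assume y: "y < f x"
      then obtain n where n: "y < of_nat n"
        using ennreal_Ex_less_of_nat[of y] by (metis top.not_eq_extremum order.strict_trans2 top_greatest)
      define k where "k = max n (nat \<lceil>\<bar>x\<bar>\<rceil>)"
      have "\<bar>x\<bar> \<le> real k" unfolding k_def by linarith
      moreover have "(of_nat n :: ennreal) \<le> of_nat k" by (simp add: k_def)
      ultimately have "y \<le> F k x"
        using n y by (auto simp: F_def indicator_def abs_le_iff intro: less_imp_le order.trans)
      then show "y \<le> (SUP k. F k x)" by (rule order_trans) (rule SUP_upper, simp)
    qed
  qed
  then have "(\<integral>\<^sup>+ x. f x \<partial>lborel) = (\<integral>\<^sup>+ x. (SUP k. F k x) \<partial>lborel)" by simp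
  also have "\<dots> = (SUP k. \<integral>\<^sup>+ x. F k x \<partial>lborel)"
    by (rule nn_integral_monotone_convergence_SUP[OF inc]) measurable
  finally show ?thesis using assms(2) by (auto simp: less_SUP_iff F_def)
qed

text \<open>
  Truncation in height and support keeps integrals above \<open>r * a\<close> and \<open>r * b\<close> for a given \<open>r < 1\<close>; then \<open>r\<close> tends to
  one. The values may be infinite while \<open>powr\<close> concerns real numbers, so hypothesis and conclusion speak of real numbers
  below the values and below the integrals.
\<close>

lemma prekopa_leindler_real:
  fixes f g h :: "real \<Rightarrow> ennreal" and l a b :: real
  assumes meas[measurable]: "f \<in> borel_measurable borel" "g \<in> borel_measurable borel" "h \<in> borel_measurable borel"
    and l: "0 < l" "l < 1"
    and h: "\<And>x y a b. 0 \<le> a \<Longrightarrow> 0 \<le> b \<Longrightarrow> ennreal a \<le> f x \<Longrightarrow> ennreal b \<le> g y \<Longrightarrow>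
              ennreal (a powr l * b powr (1 - l)) \<le> h (l * x + (1 - l) * y)"
    and ab: "0 \<le> a" "0 \<le> b"
    and fa: "ennreal a \<le> (\<integral>\<^sup>+ x. f x \<partial>lborel)" and gb: "ennreal b \<le> (\<integral>\<^sup>+ x. g x \<partial>lborel)"
  shows "ennreal (a powr l * b powr (1 - l)) \<le> (\<integral>\<^sup>+ x. h x \<partial>lborel)"
proof (cases "a = 0 \<or> b = 0")
  case False
  then have a: "a > 0" and b: "b > 0" using ab by auto
  define S where "S = a powr l * b powr (1 - l)"
  have S: "S > 0" using a b by (simp add: S_def)
  have *: "ennreal (r * S) \<le> (\<integral>\<^sup>+ x. h x \<partial>lborel)" if r: "0 < r" "r < 1" for r
  proof -
    have "ennreal (r * a) < (\<integral>\<^sup>+ x. f x \<partial>lborel)" "ennreal (r * b) < (\<integral>\<^sup>+ x. g x \<partial>lborel)"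
      using r a b by (auto intro!: less_le_trans[OF _ fa] less_le_trans[OF _ gb] simp: ennreal_less_iff)
    then obtain k1 k2 :: nat
      where k1: "ennreal (r * a) < (\<integral>\<^sup>+ x. min (f x) (of_nat k1) * indicator {- real k1..real k1} x \<partial>lborel)"
        and k2: "ennreal (r * b) < (\<integral>\<^sup>+ x. min (g x) (of_nat k2) * indicator {- real k2..real k2} x \<partial>lborel)"
      using nn_integral_truncation_exceeds meas by meson
    define k where "k = max k1 k2"
    define f' where "f' x = enn2real (min (f x) (of_nat k) * indicator {- real k..real k} x)" for x
    define g' where "g' x = enn2real (min (g x) (of_nat k) * indicator {- real k..real k} x)" for x
    have [measurable]: "f' \<in> borel_measurable borel" "g' \<in> borel_measurable borel"
      unfolding f'_def g'_def by measurable
    have fin: "min u (of_nat k) * indicator A x < top" for u :: ennreal and A and x :: real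
      by (auto simp: indicator_def min_less_iff_disj of_nat_less_top)
    have f': "ennreal (f' x) = min (f x) (of_nat k) * indicator {- real k..real k} x" for x
      unfolding f'_def using fin by (intro ennreal_enn2real) auto
    have g': "ennreal (g' x) = min (g x) (of_nat k) * indicator {- real k..real k} x" for x
      unfolding g'_def using fin by (intro ennreal_enn2real) auto
    have le_f: "ennreal (f' x) \<le> f x" and le_g: "ennreal (g' x) \<le> g x" for x
      unfolding f' g' by (auto simp: indicator_def)
    have bound: "enn2real (min u (of_nat k) * indicator A x) \<le> real k" for u and A and x :: real
    proof -
      have "enn2real (min u (of_nat k) * indicator A x) \<le> enn2real (of_nat k)"
        by (intro enn2real_mono) (auto simp: indicator_def of_nat_less_top)
      then show ?thesis by (simp add: ennreal_of_nat_eq_real_of_nat)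
    qed
    have "ennreal ((r * a) powr l * (r * b) powr (1 - l)) \<le> (\<integral>\<^sup>+ x. h x \<partial>lborel)"
    proof (rule prekopa_leindler_real_bounded[where f = f' and g = g' and M = "real k" and R = "real k"])
      show "ennreal (f' x powr l * g' y powr (1 - l)) \<le> h (l * x + (1 - l) * y)" for x y
        using le_f le_g by (intro h) (auto simp: f'_def g'_def)
      have "(\<integral>\<^sup>+ x. min (f x) (of_nat k1) * indicator {- real k1..real k1} x \<partial>lborel) \<le> (\<integral>\<^sup>+ x. ennreal (f' x) \<partial>lborel)"
        unfolding f' by (intro nn_integral_mono mult_mono min.mono) (auto simp: k_def indicator_def)
      then show "ennreal (r * a) \<le> (\<integral>\<^sup>+ x. ennreal (f' x) \<partial>lborel)" using k1 by simp
      have "(\<integral>\<^sup>+ x. min (g x) (of_nat k2) * indicator {- real k2..real k2} x \<partial>lborel) \<le> (\<integral>\<^sup>+ x. ennreal (g' x) \<partial>lborel)"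
        unfolding g' by (intro nn_integral_mono mult_mono min.mono) (auto simp: k_def indicator_def)
      then show "ennreal (r * b) \<le> (\<integral>\<^sup>+ x. ennreal (g' x) \<partial>lborel)" using k2 by simp
      show "f' x \<le> real k" "g' x \<le> real k" for x
        unfolding f'_def g'_def by (rule bound)+
      show "\<bar>x\<bar> \<le> real k" if "f' x \<noteq> 0" for x
        using that by (cases "x \<in> {- real k..real k}") (auto simp: f'_def abs_le_iff)
      show "\<bar>x\<bar> \<le> real k" if "g' x \<noteq> 0" for x
        using that by (cases "x \<in> {- real k..real k}") (auto simp: g'_def abs_le_iff)
    qed (use l r a b in \<open>auto simp: f'_def g'_def\<close>)
    also have "(r * a) powr l * (r * b) powr (1 - l) = r powr (l + (1 - l)) * S"
      using r a b by (simp only: powr_mult powr_add S_def) (simp add: powr_mult)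
    also have "\<dots> = r * S" using r by simp
    finally show ?thesis .
  qed
  show ?thesis
  proof (rule ccontr)
    assume "\<not> ?thesis"
    then have lt: "(\<integral>\<^sup>+ x. h x \<partial>lborel) < ennreal S" by (simp add: S_def not_le)
    then obtain H where H: "(\<integral>\<^sup>+ x. h x \<partial>lborel) = ennreal H" "0 \<le> H"
      by (metis ennreal_cases order_less_imp_not_eq2 top.not_eq_extremum order.strict_trans2 top_greatest)
    then have "H < S" using lt S by (simp add: ennreal_less_iff)
    then have "ennreal ((1 + H / S) / 2 * S) \<le> ennreal H"
      unfolding H(1)[symmetric] using S H(2) by (intro *) (auto simp: field_simps)
    then have "(1 + H / S) / 2 * S \<le> H" using H(2) by simp
    then show False using \<open>H < S\<close> S by (simp add: field_simps)
  qed
qed auto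

text \<open>
  By Fubini and the induction hypothesis, the integrals over the other coordinates satisfy, as functions of one
  coordinate, the hypothesis of \<open>prekopa_leindler_real\<close>. The formulation with real lower bounds gives hypothesis and conclusion the
  same shape, so that the induction closes.
\<close>

lemma prekopa_leindler_PiM:
  fixes f g h :: "('i \<Rightarrow> real) \<Rightarrow> ennreal" and l a b :: real
  assumes "finite I" and l: "0 < l" "l < 1"
    and "f \<in> borel_measurable (PiM I (\<lambda>_. lborel))" "g \<in> borel_measurable (PiM I (\<lambda>_. lborel))"
      "h \<in> borel_measurable (PiM I (\<lambda>_. lborel))"
    and "\<And>x y a b. x \<in> extensional I \<Longrightarrow> y \<in> extensional I \<Longrightarrow> 0 \<le> a \<Longrightarrow> 0 \<le> b \<Longrightarrow> ennreal a \<le> f x \<Longrightarrow> ennreal b \<le> g y \<Longrightarrow>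
              ennreal (a powr l * b powr (1 - l)) \<le> h (\<lambda>i\<in>I. l * x i + (1 - l) * y i)"
    and "0 \<le> a" "0 \<le> b"
    and "ennreal a \<le> integral\<^sup>N (PiM I (\<lambda>_. lborel)) f" "ennreal b \<le> integral\<^sup>N (PiM I (\<lambda>_. lborel)) g"
  shows "ennreal (a powr l * b powr (1 - l)) \<le> integral\<^sup>N (PiM I (\<lambda>_. lborel)) h"
  using assms(1,4-)
proof (induction I arbitrary: f g h a b rule: finite_induct)
  case empty
  interpret product_sigma_finite "\<lambda>_::'i. lborel :: real measure" ..
  have sp: "integral\<^sup>N (PiM {} (\<lambda>_. lborel)) F = F (\<lambda>_. undefined)" for F :: "('i \<Rightarrow> real) \<Rightarrow> ennreal"
    by (subst PiM_empty) (simp add: nn_integral_count_space_finite)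
  have "(\<lambda>i\<in>{}. l * (undefined::real) + (1 - l) * undefined) = ((\<lambda>_. undefined) :: 'i \<Rightarrow> real)" by auto
  with empty(4)[of "\<lambda>_. undefined" "\<lambda>_. undefined" a b] empty(5-)
  show ?case unfolding sp by (simp add: restrict_def)
next
  case (insert i I)
  interpret product_sigma_finite "\<lambda>_::'i. lborel :: real measure" ..
  note [measurable] = insert.prems(1-3)
  have fub: "integral\<^sup>N (PiM (insert i I) (\<lambda>_. lborel)) F = (\<integral>\<^sup>+ y. (\<integral>\<^sup>+ x. F (x(i := y)) \<partial>(PiM I (\<lambda>_. lborel))) \<partial>lborel)"
    if "F \<in> borel_measurable (PiM (insert i I) (\<lambda>_. lborel))" for F :: "('i \<Rightarrow> real) \<Rightarrow> ennreal"
    by (rule product_nn_integral_insert_rev) (use insert.hyps that in auto)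
  have meas: "(\<lambda>y. \<integral>\<^sup>+ x. F (x(i := y)) \<partial>(PiM I (\<lambda>_. lborel))) \<in> borel_measurable borel"
    if [measurable]: "F \<in> borel_measurable (PiM (insert i I) (\<lambda>_. lborel))" for F :: "('i \<Rightarrow> real) \<Rightarrow> ennreal"
  proof -
    interpret I: sigma_finite_measure "PiM I (\<lambda>_. lborel :: real measure)"
      by (rule sigma_finite) (rule insert.hyps)
    show ?thesis by measurable
  qed
  have meas': "(\<lambda>x. F (x(i := y))) \<in> borel_measurable (PiM I (\<lambda>_. lborel))"
    if [measurable]: "F \<in> borel_measurable (PiM (insert i I) (\<lambda>_. lborel))" for F :: "('i \<Rightarrow> real) \<Rightarrow> ennreal" and y by measurable
  show ?case unfolding fub[OF insert.prems(3)]
  proof (rule prekopa_leindler_real[where f = "\<lambda>y. \<integral>\<^sup>+ x. f (x(i := y)) \<partial>(PiM I (\<lambda>_. lborel))" and g = "\<lambda>y. \<integral>\<^sup>+ x. g (x(i := y)) \<partial>(PiM I (\<lambda>_. lborel))"])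
    fix s t a b :: real
    assume ab: "0 \<le> a" "0 \<le> b" "ennreal a \<le> (\<integral>\<^sup>+ x. f (x(i := s)) \<partial>(PiM I (\<lambda>_. lborel)))"
      "ennreal b \<le> (\<integral>\<^sup>+ x. g (x(i := t)) \<partial>(PiM I (\<lambda>_. lborel)))"
    show "ennreal (a powr l * b powr (1 - l)) \<le> (\<integral>\<^sup>+ x. h (x(i := l * s + (1 - l) * t)) \<partial>(PiM I (\<lambda>_. lborel)))"
    proof (rule insert.IH[OF _ _ _ _ ab])
      fix x y :: "'i \<Rightarrow> real" and a b :: real
      assume xy: "x \<in> extensional I" "y \<in> extensional I" "0 \<le> a" "0 \<le> b" "ennreal a \<le> f (x(i := s))" "ennreal b \<le> g (y(i := t))"
      have eq: "(\<lambda>j\<in>insert i I. l * (x(i := s)) j + (1 - l) * (y(i := t)) j) = (\<lambda>j\<in>I. l * x j + (1 - l) * y j)(i := l * s + (1 - l) * t)"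
        by (auto simp: fun_eq_iff restrict_def)
      have "ennreal (a powr l * b powr (1 - l)) \<le> h (\<lambda>j\<in>insert i I. l * (x(i := s)) j + (1 - l) * (y(i := t)) j)"
        using xy by (intro insert.prems(4)) (auto simp: extensional_def fun_upd_def)
      then show "ennreal (a powr l * b powr (1 - l)) \<le> h ((\<lambda>j\<in>I. l * x j + (1 - l) * y j)(i := l * s + (1 - l) * t))"
        unfolding eq .
    qed (rule meas'[OF insert.prems(1)] meas'[OF insert.prems(2)] meas'[OF insert.prems(3)])+
  qed (use l insert.prems fub in \<open>auto intro: meas\<close>)
qed

section \<open>An inequality for powers of the sine\<close>

definition sin_pow_int :: "nat \<Rightarrow> real \<Rightarrow> real" where
  "sin_pow_int m x = integral {0..x} (\<lambda>t. sin t ^ m)"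

lemma sin_pow_int_0 [simp]: "sin_pow_int m 0 = 0"
  by (simp add: sin_pow_int_def)

lemma sin_pow_int_diff:
  assumes "0 \<le> a" "a \<le> b"
  shows "((\<lambda>t. sin t ^ m) has_integral (sin_pow_int m b - sin_pow_int m a)) {a..b}"
proof -
  have i: "(\<lambda>t::real. sin t ^ m) integrable_on {c..d}" for c d
    by (intro integrable_continuous_real continuous_intros)
  have "sin_pow_int m a + integral {a..b} (\<lambda>t. sin t ^ m) = sin_pow_int m b"
    unfolding sin_pow_int_def by (rule Henstock_Kurzweil_Integration.integral_combine) (use assms i in auto)
  then have "integral {a..b} (\<lambda>t. sin t ^ m) = sin_pow_int m b - sin_pow_int m a" by simp
  then show ?thesis using integrable_integral[OF i[of a b]] by simp
qed

lemma DERIV_sin_pow_int: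
  assumes "0 < x"
  shows "(sin_pow_int m has_real_derivative sin x ^ m) (at x)"
proof -
  have "(sin_pow_int m has_real_derivative sin x ^ m) (at x within {0..x+1})"
    unfolding sin_pow_int_def using assms
    by (intro integral_has_real_derivative continuous_intros) auto
  then show ?thesis
    using assms by (subst (asm) at_within_interior[of x "{0..x+1}"]) auto
qed

lemma continuous_on_sin_pow_int: "continuous_on {0..b} (sin_pow_int m)"
  unfolding sin_pow_int_def
  by (intro indefinite_integral_continuous_1 integrable_continuous_real continuous_intros)

lemma sin_pow_int_strict_mono:
  assumes "0 \<le> a" "a < b" "b \<le> pi"
  shows "sin_pow_int m a < sin_pow_int m b"
proof (rule DERIV_pos_imp_increasing_open[OF assms(2)])
  fix x assume "a < x" "x < b"
  then show "\<exists>y. (sin_pow_int m has_real_derivative y) (at x) \<and> 0 < y"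
    using assms DERIV_sin_pow_int[of x m] by (auto intro!: exI sin_gt_zero zero_less_power)
next
  show "continuous_on {a..b} (sin_pow_int m)"
    using continuous_on_sin_pow_int by (rule continuous_on_subset) (use assms in auto)
qed

lemma sin_pow_int_pos: "0 < x \<Longrightarrow> x \<le> pi \<Longrightarrow> 0 < sin_pow_int m x"
  using sin_pow_int_strict_mono[of 0 x m] by simp

text \<open>
  Divide by \<open>N(z) = 1 + (2 * m - 1) * cos z\<close>. Both sides vanish at zero, and the derivative of their difference is
  nonnegative because, after \<open>sin\<^sup>2 = 1 - cos\<^sup>2\<close>, its numerator factors. With
  \<open>y = ((m + 1) * sin_pow_int m)^(1 / (m + 1))\<close>, the inequality says that \<open>y' / cos(x / 2)\<close> has a nonpositive
  logarithmic derivative, which is how it is used below.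
\<close>

lemma sin_pow_int_upper:
  assumes m: "1 \<le> m" and z: "0 < z" "z < pi"
  shows "(real m + 1) * sin_pow_int m z * (1 + (2 * real m - 1) * cos z) \<le> 2 * real m * sin z ^ (m + 1)"
proof (cases "0 < 1 + (2 * real m - 1) * cos z")
  case False
  have "(real m + 1) * sin_pow_int m z * (1 + (2 * real m - 1) * cos z) \<le> 0"
    using False sin_pow_int_pos[of z m] z by (intro mult_nonneg_nonpos) auto
  also have "0 \<le> 2 * real m * sin z ^ (m + 1)"
    using z sin_gt_zero[of z] by (intro mult_nonneg_nonneg zero_le_power) auto
  finally show ?thesis .
next
  case True
  define N where "N x = 1 + (2 * real m - 1) * cos x" for x
  define D where "D x = 2 * real m * sin x ^ (m + 1) / N x - (real m + 1) * sin_pow_int m x" for x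
  have N: "0 < N x" if "0 \<le> x" "x \<le> z" for x
  proof -
    have "cos z \<le> cos x" using that z by (intro cos_monotone_0_pi_le) auto
    then have "(2 * real m - 1) * cos z \<le> (2 * real m - 1) * cos x" using m by (intro mult_left_mono) auto
    then show ?thesis using True by (simp add: N_def)
  qed
  have "D 0 \<le> D z"
  proof (rule DERIV_nonneg_imp_increasing_open[where f = D])
    fix x assume x: "0 < x" "x < z"
    have s: "0 < sin x" using x z by (intro sin_gt_zero) auto
    have Nx: "0 < N x" using N x by simp
    have dN: "(N has_real_derivative - (2 * real m - 1) * sin x) (at x)"
      unfolding N_def by (auto intro!: derivative_eq_intros simp: algebra_simps)
    have "(D has_real_derivative
       (2 * real m * ((real m + 1) * sin x ^ m * cos x * N x + sin x ^ (m+1) * ((2 * real m - 1) * sin x)) / (N x * N x) - (real m + 1) * sin x ^ m)) (at x)"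
      unfolding D_def
    proof (rule DERIV_cong[OF DERIV_diff[OF DERIV_divide[OF DERIV_cmult dN] DERIV_cmult[OF DERIV_sin_pow_int]]])
      show "((\<lambda>x. sin x ^ (m + 1)) has_real_derivative (1 + real m) * (cos x * sin x ^ m)) (at x)"
        using DERIV_power_Suc[OF DERIV_sin, where n = m] by simp
    qed (use Nx x in \<open>auto simp: algebra_simps\<close>)
    moreover have "(real m + 1) * sin x ^ m \<le>
        2 * real m * ((real m + 1) * sin x ^ m * cos x * N x + sin x ^ (m+1) * ((2 * real m - 1) * sin x)) / (N x * N x)"
    proof -
      let ?C = "cos x" and ?a = "2 * real m - 1"
      have s2: "sin x * sin x = 1 - ?C * ?C"
        using sin_cos_squared_add[of x] by (simp add: power2_eq_square)
      have "0 \<le> (?a - 1) / 2 * ((1 - ?C) * (2 * ?a + 3 + ?a * ?C))"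
      proof -
        have "- ?a \<le> ?a * ?C" using mult_left_mono[of "-1" ?C ?a] m by simp
        then show ?thesis using m by (intro mult_nonneg_nonneg) auto
      qed
      also have "\<dots> = 2 * real m * ((real m + 1) * ?C * N x + ?a * (1 - ?C * ?C)) - (real m + 1) * (N x * N x)"
        unfolding N_def by (simp add: field_simps)
      finally have "(real m + 1) * (N x * N x) \<le> 2 * real m * ((real m + 1) * ?C * N x + ?a * (sin x * sin x))"
        unfolding s2 by simp
      then have "sin x ^ m * ((real m + 1) * (N x * N x)) \<le> sin x ^ m * (2 * real m * ((real m + 1) * ?C * N x + ?a * (sin x * sin x)))"
        using s by (intro mult_left_mono) auto
      then show ?thesis using Nx by (simp add: pos_le_divide_eq algebra_simps)
    qed
    ultimately show "\<exists>y. (D has_real_derivative y) (at x) \<and> 0 \<le> y" by (auto intro!: exI)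
  next
    have "continuous_on {0..z} N" unfolding N_def by (intro continuous_intros)
    moreover have "\<forall>x\<in>{0..z}. N x \<noteq> 0" using N by (metis atLeastAtMost_iff less_irrefl)
    ultimately show "continuous_on {0..z} D"
      unfolding D_def by (intro continuous_intros continuous_on_sin_pow_int)
  qed (use z in auto)
  then have "(real m + 1) * sin_pow_int m z \<le> 2 * real m * sin z ^ (m + 1) / N z"
    by (simp add: D_def)
  then show ?thesis using N[of z] z by (simp add: pos_le_divide_eq N_def)
qed

text \<open>
  With \<open>q = (x - \<beta>) / 4\<close> and \<open>b = \<beta> / 2\<close> the difference of the two sides is
  \<open>4 * sin\<^sup>2 q * (sin b - sin (2 * q) * cos b)\<close>, and \<open>2 * q \<le> b\<close>.
\<close>

lemma chord_le_sin:
  fixes x \<beta> :: real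
  assumes "0 \<le> x" "x \<le> 2 * \<beta>" "0 < \<beta>" "\<beta> < pi / 2"
  shows "2 * (sin (x / 2) - sin (\<beta> / 2)) \<le> sin (x - \<beta>) * cos (\<beta> / 2)"
proof -
  define q where "q = (x - \<beta>) / 4"
  define b where "b = \<beta> / 2"
  have x: "x / 2 = b + 2 * q" "x - \<beta> = 4 * q" by (simp_all add: q_def b_def field_simps)
  have "sin (4 * q) = 2 * sin (2 * q) * cos (2 * q)" using sin_double[of "2 * q"] by simp
  then have "sin (4 * q) * cos b - 2 * (sin (b + 2 * q) - sin b)
      = 4 * sin q ^ 2 * (sin b - sin (2 * q) * cos b)"
    unfolding sin_add sin_double cos_double
    using sin_cos_squared_add[of q] by algebra
  moreover have "sin (2 * q) * cos b \<le> sin b"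
  proof (cases "q \<le> 0")
    case True
    have "0 \<le> sin (- (2 * q))" using True assms pi_gt_zero unfolding q_def by (intro sin_ge_zero; argo)
    then have "sin (2 * q) \<le> 0" by simp
    moreover have "0 \<le> cos b" "0 \<le> sin b" using assms by (auto simp: b_def intro!: cos_ge_zero sin_ge_zero)
    ultimately show ?thesis by (meson mult_nonpos_nonneg order_trans)
  next
    case False
    have "sin (2 * q) \<le> sin b" using False assms by (intro sin_monotone_2pi_le) (auto simp: q_def b_def)
    moreover have "0 \<le> cos b" "cos b \<le> 1" "0 \<le> sin b" using assms by (auto simp: b_def intro!: cos_ge_zero sin_ge_zero)
    ultimately show ?thesis by (meson mult_left_le mult_right_mono order_trans)
  qed
  moreover from this have "0 \<le> 4 * sin q ^ 2 * (sin b - sin (2 * q) * cos b)"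
    by (intro mult_nonneg_nonneg) auto
  ultimately show ?thesis unfolding x b_def[symmetric] by linarith
qed

text \<open>
  The function \<open>y = ((m + 1) * sin_pow_int m)^(1 / (m + 1))\<close> lies below the curve
  \<open>y(\<beta>) + y'(\<beta>) sin(x - \<beta>)\<close>, which takes the place of a tangent line. Since \<open>y^(m + 1)\<close> has derivative
  \<open>(m + 1) sin(x)^m\<close>, the integral of \<open>y(x) sin(x)^m\<close> up to \<open>\<gamma>\<close> is \<open>y(\<gamma>)^(m + 2) / (m + 2)\<close>. Integrating the
  bound against \<open>sin(x)^m\<close>, where the sine term has the favourable sign by hypothesis, gives
  \<open>(m + 1) / (m + 2) * y(\<gamma>) \<le> y(\<beta>)\<close>, and the claim is the power \<open>m + 1\<close> of this.
\<close>

lemma sin_wedge_mass_ratio: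
  fixes \<beta> \<gamma> :: real
  assumes m: "1 \<le> m" and \<beta>: "0 < \<beta>" "\<beta> < pi / 2" and \<gamma>: "\<beta> \<le> \<gamma>" "\<gamma> \<le> 2 * \<beta>"
    and mom: "0 \<le> integral {0..\<gamma>} (\<lambda>x. sin (\<beta> - x) * sin x ^ m)"
  shows "((real m + 1) / (real m + 2)) ^ (m + 1) * sin_pow_int m \<gamma> \<le> sin_pow_int m \<beta>"
proof -
  have \<gamma>pi: "0 < \<gamma>" "\<gamma> < pi" using \<beta> \<gamma> by auto
  define J where "J x = (real m + 1) * sin_pow_int m x" for x
  have J: "0 < J x" if "0 < x" "x < pi" for x
    using sin_pow_int_pos[of x m] that by (simp add: J_def)
  have dJ: "(J has_real_derivative (real m + 1) * sin x ^ m) (at x)" if "0 < x" for x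
    unfolding J_def using that by (auto intro!: derivative_eq_intros DERIV_sin_pow_int)
  define y where "y x = J x powr (1 / (real m + 1))" for x
  have ypow: "y x ^ (m + 1) = J x" if "0 \<le> J x" for x
  proof -
    have "y x ^ (m + 1) = y x powr real (m + 1)" if "J x > 0"
      using that by (subst powr_realpow) (auto simp: y_def)
    also have "y x powr real (m + 1) = J x powr ((1 / (real m + 1)) * real (m + 1))"
      unfolding y_def powr_powr ..
    also have "(1 / (real m + 1)) * real (m + 1) = 1" by simp
    finally show ?thesis using that by (cases "J x = 0") (auto simp: y_def)
  qed
  have ypos: "0 < y x" if "0 < x" "x < pi" for x using J[OF that] by (simp add: y_def)
  define w where "w x = sin x ^ m / y x ^ m" for x
  have wpos: "0 < w x" if "0 < x" "x < pi" for x
    using that ypos sin_gt_zero by (simp add: w_def)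
  have dy: "(y has_real_derivative w x) (at x)" if "0 < x" "x < pi" for x
  proof -
    have "(y has_real_derivative (1 / (real m + 1)) * J x powr (1 / (real m + 1) - 1) * ((real m + 1) * sin x ^ m)) (at x)"
      unfolding y_def using J[OF that] dJ[OF that(1)] by (auto intro!: derivative_eq_intros)
    moreover have "J x powr (1 / (real m + 1) - 1) = inverse (y x ^ m)"
    proof -
      have "J x powr (1 / (real m + 1) - 1) = J x powr (- (real m * (1 / (real m + 1))))"
        by (simp add: field_simps)
      also have "\<dots> = inverse (y x powr real m)" by (simp add: y_def powr_powr powr_minus mult.commute)
      also have "y x powr real m = y x ^ m" using ypos[OF that] by (simp add: powr_realpow)
      finally show ?thesis .
    qed
    moreover have "(1 / (real m + 1)) * inverse (y x ^ m) * ((real m + 1) * sin x ^ m) = w x"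
      by (simp add: w_def divide_inverse)
    ultimately show ?thesis by simp
  qed
  \<comment> \<open>\<open>L\<close> is the logarithm of \<open>w x / cos (x / 2)\<close>; that it decreases replaces the concavity of \<open>y\<close>.\<close>
  define L where "L x = real m * ln (sin x) - (real m / (real m + 1)) * ln (J x) - ln (cos (x / 2))" for x
  have expL: "exp (L x) = w x / cos (x / 2)" if "0 < x" "x < pi" for x
  proof -
    have "exp (real m * ln (sin x)) = sin x ^ m"
      using that sin_gt_zero[of x] by (simp add: exp_of_nat_mult)
    moreover have "exp ((real m / (real m + 1)) * ln (J x)) = y x ^ m"
      using J[OF that] by (simp add: y_def powr_def exp_of_nat_mult[symmetric])
    moreover have "exp (ln (cos (x / 2))) = cos (x / 2)" using that by (simp add: cos_gt_zero_pi)
    ultimately show ?thesis by (simp add: L_def exp_diff w_def)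
  qed
  have Ldec: "L v \<le> L u" if uv: "0 < u" "u \<le> v" "v < pi" for u v
  proof (rule DERIV_nonpos_imp_nonincreasing[OF uv(2)])
    fix x assume "u \<le> x" "x \<le> v"
    then have x: "0 < x" "x < pi" using uv by auto
    have s: "0 < sin x" "0 < cos (x / 2)" using x by (auto intro!: sin_gt_zero cos_gt_zero_pi)
    have t: "sin (x / 2) / cos (x / 2) = (1 - cos x) / sin x"
    proof -
      have "sin (x/2) * sin x = (1 - cos x) * cos (x/2)"
        using sin_double[of "x/2"] cos_double_sin[of "x/2"] by (simp add: power2_eq_square)
      then show ?thesis using s by (simp add: field_simps)
    qed
    have "(L has_real_derivative real m * (cos x / sin x) - (real m / (real m + 1)) * (((real m + 1) * sin x ^ m) / J x) + (sin (x/2) / cos (x/2)) / 2) (at x)"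
    proof -
      have d1: "((\<lambda>x. ln (sin x)) has_real_derivative cos x / sin x) (at x)"
        using s by (auto intro!: derivative_eq_intros)
      have d2: "((\<lambda>x. ln (J x)) has_real_derivative ((real m + 1) * sin x ^ m) / J x) (at x)"
        using J[OF x] by (auto intro!: derivative_eq_intros dJ x)
      have d3: "((\<lambda>x. ln (cos (x / 2))) has_real_derivative - ((sin (x/2) / cos (x/2)) / 2)) (at x)"
        using s by (auto intro!: derivative_eq_intros)
      show ?thesis
        unfolding L_def
        by (rule DERIV_cong[OF DERIV_diff[OF DERIV_diff[OF DERIV_cmult[OF d1] DERIV_cmult[OF d2]] d3]]) simp
    qed
    moreover have "real m * (cos x / sin x) - (real m / (real m + 1)) * (((real m + 1) * sin x ^ m) / J x) + (sin (x/2) / cos (x/2)) / 2 \<le> 0"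
    proof -
      have "J x * (1 + (2 * real m - 1) * cos x) \<le> 2 * real m * sin x ^ (m + 1)"
        using sin_pow_int_upper[OF m x] by (simp add: J_def)
      then have "real m * (cos x / sin x) + ((1 - cos x) / sin x) / 2 \<le> real m * sin x ^ m / J x"
        using s J[OF x] by (simp add: field_simps)
      moreover have "(real m / (real m + 1)) * (((real m + 1) * sin x ^ m) / J x) = real m * sin x ^ m / J x"
        by simp
      ultimately show ?thesis unfolding t by linarith
    qed
    ultimately show "\<exists>d. (L has_real_derivative d) (at x) \<and> d \<le> 0" by blast
  qed
  have wcomp: "w v * cos (u / 2) \<le> w u * cos (v / 2)" if uv: "0 < u" "u \<le> v" "v < pi" for u v
  proof -
    have "w v / cos (v / 2) \<le> w u / cos (u / 2)"
      using Ldec[OF uv] expL[of u] expL[of v] uv by (metis exp_le_cancel_iff order_le_less_trans order_less_le_trans)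
    moreover have "0 < cos (u / 2)" "0 < cos (v / 2)" using uv by (auto intro!: cos_gt_zero_pi)
    ultimately show ?thesis by (simp add: field_simps)
  qed
  have conty: "continuous_on {0..\<gamma>} y"
  proof -
    have "0 \<le> J x" if "x \<in> {0..\<gamma>}" for x
      using J[of x] that \<gamma>pi by (cases "x = 0") (auto simp: J_def)
    moreover have "continuous_on {0..\<gamma>} J"
      unfolding J_def by (intro continuous_intros continuous_on_sin_pow_int)
    ultimately show ?thesis
      unfolding y_def by (intro continuous_on_powr' continuous_intros) auto
  qed
  \<comment> \<open>The derivative of \<open>Q\<close> is \<open>w x - c * cos (x / 2)\<close>, which changes sign from plus to minus at \<open>\<beta>\<close>.\<close>
  define c where "c = w \<beta> / cos (\<beta> / 2)"
  define Q where "Q x = y x - c * (2 * sin (x / 2))" for x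
  have cb: "0 < cos (\<beta> / 2)" using \<beta> by (intro cos_gt_zero_pi) auto
  have dQ: "(Q has_real_derivative w x - c * cos (x / 2)) (at x)" if "0 < x" "x < pi" for x
    unfolding Q_def using that by (auto intro!: derivative_eq_intros dy)
  have contQ: "continuous_on {0..\<gamma>} Q"
    unfolding Q_def by (intro continuous_intros conty) auto
  have wb: "0 < w \<beta>" using \<beta> wpos by simp
  have Qle: "Q x \<le> Q \<beta>" if x: "0 \<le> x" "x \<le> \<gamma>" for x
  proof (cases "x \<le> \<beta>")
    case True
    show ?thesis
    proof (rule DERIV_nonneg_imp_increasing_open[OF True])
      fix z assume z: "x < z" "z < \<beta>"
      have "w \<beta> * cos (z / 2) \<le> w z * cos (\<beta> / 2)" using z x \<beta> by (intro wcomp) auto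
      then have "0 \<le> w z - c * cos (z / 2)" using cb by (simp add: c_def field_simps)
      then show "\<exists>d. (Q has_real_derivative d) (at z) \<and> 0 \<le> d" using dQ[of z] z x \<beta> by auto
    qed (rule continuous_on_subset[OF contQ], use x \<gamma> in auto)
  next
    case False
    then have le: "\<beta> \<le> x" by simp
    show ?thesis
    proof (rule DERIV_nonpos_imp_decreasing_open[OF le])
      fix z assume z: "\<beta> < z" "z < x"
      have "w z * cos (\<beta> / 2) \<le> w \<beta> * cos (z / 2)" using z x \<beta> \<gamma>pi by (intro wcomp) auto
      then have "w z - c * cos (z / 2) \<le> 0" using cb by (simp add: c_def field_simps)
      then show "\<exists>d. (Q has_real_derivative d) (at z) \<and> d \<le> 0" using dQ[of z] z x \<beta> \<gamma>pi by auto
    qed (rule continuous_on_subset[OF contQ], use x \<beta> in auto)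
  qed
  have tangent: "w \<beta> * sin (\<beta> - x) \<le> y \<beta> - y x" if x: "0 \<le> x" "x \<le> \<gamma>" for x
  proof -
    have "y x - y \<beta> \<le> c * (2 * (sin (x / 2) - sin (\<beta> / 2)))"
      using Qle[OF x] by (simp add: Q_def algebra_simps)
    also have "\<dots> \<le> c * (sin (x - \<beta>) * cos (\<beta> / 2))"
      using x \<beta> \<gamma> wb cb by (intro mult_left_mono chord_le_sin) (auto simp: c_def)
    also have "\<dots> = w \<beta> * sin (x - \<beta>)" using cb by (simp add: c_def)
    also have "sin (x - \<beta>) = - sin (\<beta> - x)" using sin_minus[of "\<beta> - x"] by simp
    finally show ?thesis by simp
  qed
  have FTC: "((\<lambda>x. y x * sin x ^ m) has_integral (y \<gamma> ^ (m + 2) / (real m + 2) - y 0 ^ (m + 2) / (real m + 2))) {0..\<gamma>}"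
  proof (rule fundamental_theorem_of_calculus_interior)
    show "continuous_on {0..\<gamma>} (\<lambda>x. y x ^ (m + 2) / (real m + 2))"
      by (intro continuous_intros conty) auto
    fix x assume "x \<in> {0<..<\<gamma>}"
    then have x: "0 < x" "x < pi" using \<gamma>pi by auto
    have "((\<lambda>x. y x ^ (m + 2) / (real m + 2)) has_real_derivative y x ^ (m + 1) * w x) (at x)"
    proof -
      have "((\<lambda>x. y x ^ Suc (m + 1)) has_real_derivative (1 + real (m + 1)) * (w x * y x ^ (m + 1))) (at x)"
        by (rule DERIV_power_Suc[OF dy[OF x]])
      from DERIV_cdivide[OF this, of "real m + 2"] show ?thesis
        by (simp add: add.commute mult.commute)
    qed
    also have "y x ^ (m + 1) * w x = y x * sin x ^ m" using ypos[OF x] by (simp add: w_def)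
    finally show "((\<lambda>x. y x ^ (m + 2) / (real m + 2)) has_vector_derivative y x * sin x ^ m) (at x)"
      by (simp add: has_real_derivative_iff_has_vector_derivative)
  qed (use \<gamma>pi in auto)
  have y0: "y 0 = 0" by (simp add: y_def J_def)
  have i1: "(\<lambda>x. w \<beta> * (sin (\<beta> - x) * sin x ^ m)) integrable_on {0..\<gamma>}"
    by (intro integrable_continuous_real continuous_intros)
  have hi: "((\<lambda>x. y \<beta> * sin x ^ m - y x * sin x ^ m) has_integral (y \<beta> * sin_pow_int m \<gamma> - y \<gamma> ^ (m + 2) / (real m + 2))) {0..\<gamma>}"
    using has_integral_diff[OF has_integral_mult_right[OF sin_pow_int_diff[of 0 \<gamma> m], of "y \<beta>"] FTC] \<gamma>pi y0 by simp
  have "w \<beta> * integral {0..\<gamma>} (\<lambda>x. sin (\<beta> - x) * sin x ^ m) = integral {0..\<gamma>} (\<lambda>x. w \<beta> * (sin (\<beta> - x) * sin x ^ m))"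
    by simp
  also have "\<dots> \<le> integral {0..\<gamma>} (\<lambda>x. y \<beta> * sin x ^ m - y x * sin x ^ m)"
  proof (rule integral_le[OF i1])
    show "(\<lambda>x. y \<beta> * sin x ^ m - y x * sin x ^ m) integrable_on {0..\<gamma>}" using hi by blast
    fix x assume x: "x \<in> {0..\<gamma>}"
    have "0 \<le> sin x ^ m" using x \<gamma>pi by (intro zero_le_power sin_ge_zero) auto
    then have "w \<beta> * sin (\<beta> - x) * sin x ^ m \<le> (y \<beta> - y x) * sin x ^ m"
      using x by (intro mult_right_mono tangent) auto
    then show "w \<beta> * (sin (\<beta> - x) * sin x ^ m) \<le> y \<beta> * sin x ^ m - y x * sin x ^ m"
      by (simp add: algebra_simps)
  qed
  also have "\<dots> = y \<beta> * sin_pow_int m \<gamma> - y \<gamma> ^ (m + 2) / (real m + 2)" using hi by blast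
  finally have "0 \<le> y \<beta> * sin_pow_int m \<gamma> - y \<gamma> ^ (m + 2) / (real m + 2)"
    using mom wb by (meson mult_nonneg_nonneg less_imp_le order_trans)
  moreover have Jg: "y \<gamma> ^ (m + 1) = J \<gamma>" "y \<beta> ^ (m + 1) = J \<beta>"
    by (rule ypow; use J[of \<gamma>] J[of \<beta>] \<gamma>pi \<beta> in simp)+
  ultimately have "y \<gamma> * J \<gamma> / (real m + 2) \<le> y \<beta> * (J \<gamma> / (real m + 1))"
    by (simp add: J_def)
  then have "(real m + 1) / (real m + 2) * y \<gamma> \<le> y \<beta>"
  proof -
    assume "y \<gamma> * J \<gamma> / (real m + 2) \<le> y \<beta> * (J \<gamma> / (real m + 1))"
    then have "J \<gamma> * (y \<gamma> / (real m + 2)) \<le> J \<gamma> * (y \<beta> / (real m + 1))"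
      by (simp add: mult.commute)
    then have "y \<gamma> / (real m + 2) \<le> y \<beta> / (real m + 1)"
      using J[of \<gamma>] \<gamma>pi by (simp only: mult_le_cancel_left_pos)
    then show ?thesis by (simp add: field_simps)
  qed
  then have "((real m + 1) / (real m + 2) * y \<gamma>) ^ (m + 1) \<le> y \<beta> ^ (m + 1)"
    using ypos[of \<gamma>] \<gamma>pi by (intro power_mono) auto
  then have "((real m + 1) / (real m + 2)) ^ (m + 1) * J \<gamma> \<le> J \<beta>"
    unfolding power_mult_distrib Jg .
  then have "(real m + 1) * (((real m + 1) / (real m + 2)) ^ (m + 1) * sin_pow_int m \<gamma>) \<le> (real m + 1) * sin_pow_int m \<beta>"
    by (simp only: J_def mult.left_commute)
  then show ?thesis by (subst (asm) mult_le_cancel_left_pos) auto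
qed

section \<open>Integrals over circular sectors\<close>

lemma borel_measurable_fst_snd [measurable]:
  "fst \<in> borel_measurable (borel :: ('a::euclidean_space \<times> 'b::euclidean_space) measure)"
  "snd \<in> borel_measurable (borel :: ('a::euclidean_space \<times> 'b::euclidean_space) measure)"
  by (auto intro!: borel_measurable_continuous_onI continuous_intros)

lemma nn_integral_lborel_pair:
  assumes [measurable]: "F \<in> borel_measurable borel"
  shows "(\<integral>\<^sup>+ p. F p \<partial>(lborel :: (real \<times> real) measure)) = (\<integral>\<^sup>+ s. \<integral>\<^sup>+ t. F (s, t) \<partial>lborel \<partial>lborel)"
  unfolding lborel_prod[symmetric] by (subst lborel.nn_integral_fst) (auto simp: lborel_prod)

lemma nn_integral_power_Icc:
  assumes "0 \<le> R"
  shows "(\<integral>\<^sup>+ s. ennreal (s ^ Suc k) * indicator {0<..R} s \<partial>lborel) = ennreal (R ^ (k + 2) / (real k + 2))"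
proof -
  have "(\<integral>\<^sup>+ s. ennreal (s ^ Suc k) * indicator {0<..R} s \<partial>lborel) = (\<integral>\<^sup>+ s. ennreal (s ^ Suc k) * indicator {0..R} s \<partial>lborel)"
    by (intro nn_integral_cong) (auto simp: indicator_def)
  also have "\<dots> = ennreal (R ^ (k + 2) / (real k + 2))"
  proof (rule nn_integral_has_integral_lebesgue')
    have "((\<lambda>s. s ^ Suc k) has_integral R ^ (k + 2) / (real k + 2) - 0 ^ (k + 2) / (real k + 2)) {0..R}"
    proof (rule fundamental_theorem_of_calculus)
      fix x assume "x \<in> {0..R}"
      have "((\<lambda>x. x ^ Suc (k + 1)) has_real_derivative (1 + real (k + 1)) * (1 * x ^ (k + 1))) (at x within {0..R})"
        by (rule DERIV_power_Suc) (auto intro!: derivative_eq_intros)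
      from DERIV_cdivide[OF this, of "real k + 2"]
      show "((\<lambda>x. x ^ (k + 2) / (real k + 2)) has_vector_derivative x ^ Suc k) (at x within {0..R})"
        by (simp add: has_real_derivative_iff_has_vector_derivative add.commute)
    qed (use assms in auto)
    then show "((\<lambda>s. s ^ Suc k) has_integral R ^ (k + 2) / (real k + 2)) {0..R}" by simp
  qed auto
  finally show ?thesis .
qed

text \<open>
  On each vertical line the slope \<open>\<tau> = t / s\<close> is the new variable. By homogeneity the integral over \<open>s\<close> is then
  elementary, and \<open>\<tau> = tan \<phi>\<close> turns the remaining integral into one over the angle.
\<close>

lemma nn_integral_wedge_polar:
  fixes f :: "real \<times> real \<Rightarrow> real"
  assumes [measurable]: "f \<in> borel_measurable borel" and nn: "\<And>p. 0 \<le> f p"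
    and hom: "\<And>c p. 0 < c \<Longrightarrow> f (c *\<^sub>R p) = c ^ k * f p"
    and ab: "a \<le> b" "- pi / 2 < a" "b < pi / 2"
    and cont: "continuous_on {a..b} (\<lambda>\<phi>. f (cos \<phi>, sin \<phi>))"
  shows "(\<integral>\<^sup>+ p. ennreal (f p) * indicator {p. norm p \<le> 1 \<and> 0 < fst p \<and> tan a * fst p \<le> snd p \<and> snd p \<le> tan b * fst p} p \<partial>lborel)
       = ennreal (integral {a..b} (\<lambda>\<phi>. f (cos \<phi>, sin \<phi>)) / (real k + 2))"
proof -
  let ?W = "{p :: real \<times> real. norm p \<le> 1 \<and> 0 < fst p \<and> tan a * fst p \<le> snd p \<and> snd p \<le> tan b * fst p}"
  define R where "R \<tau> = 1 / sqrt (1 + \<tau>\<^sup>2)" for \<tau> :: real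
  have R: "0 < R \<tau>" for \<tau> unfolding R_def by (simp add: add_pos_nonneg)
  have [measurable]: "R \<in> borel_measurable borel" unfolding R_def by measurable
  have [measurable]: "?W \<in> sets borel"
    by measurable
  have "(\<integral>\<^sup>+ p. ennreal (f p) * indicator ?W p \<partial>lborel) = (\<integral>\<^sup>+ s. \<integral>\<^sup>+ t. ennreal (f (s, t)) * indicator ?W (s, t) \<partial>lborel \<partial>lborel)"
    by (rule nn_integral_lborel_pair) measurable
  also have "\<dots> = (\<integral>\<^sup>+ s. \<integral>\<^sup>+ \<tau>. ennreal (f (1, \<tau>)) * indicator {tan a..tan b} \<tau> * (ennreal (s ^ Suc k) * indicator {0<..R \<tau>} s) \<partial>lborel \<partial>lborel)"
  proof (rule nn_integral_cong)
    fix s :: real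
    show "(\<integral>\<^sup>+ t. ennreal (f (s, t)) * indicator ?W (s, t) \<partial>lborel) = (\<integral>\<^sup>+ \<tau>. ennreal (f (1, \<tau>)) * indicator {tan a..tan b} \<tau> * (ennreal (s ^ Suc k) * indicator {0<..R \<tau>} s) \<partial>lborel)"
    proof (cases "0 < s")
      case False
      then show ?thesis by (auto simp: indicator_def intro!: nn_integral_cong)
    next
      case True
      have "(\<integral>\<^sup>+ t. ennreal (f (s, t)) * indicator ?W (s, t) \<partial>lborel)
          = ennreal \<bar>s\<bar> * (\<integral>\<^sup>+ \<tau>. ennreal (f (s, 0 + s * \<tau>)) * indicator ?W (s, 0 + s * \<tau>) \<partial>lborel)"
        using True by (intro nn_integral_real_affine) measurable
      also have "\<dots> = (\<integral>\<^sup>+ \<tau>. ennreal \<bar>s\<bar> * (ennreal (f (s, 0 + s * \<tau>)) * indicator ?W (s, 0 + s * \<tau>)) \<partial>lborel)"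
        by (rule nn_integral_cmult[symmetric]) measurable
      also have "\<dots> = (\<integral>\<^sup>+ \<tau>. ennreal (f (1, \<tau>)) * indicator {tan a..tan b} \<tau> * (ennreal (s ^ Suc k) * indicator {0<..R \<tau>} s) \<partial>lborel)"
      proof (rule nn_integral_cong)
        fix \<tau> :: real
        have "f (s, s * \<tau>) = s ^ k * f (1, \<tau>)" using hom[OF True, of "(1, \<tau>)"] by simp
        moreover have "norm (s, s * \<tau>) \<le> 1 \<longleftrightarrow> s \<le> R \<tau>"
        proof -
          have "norm (s, s * \<tau>) = s * sqrt (1 + \<tau>\<^sup>2)"
            using True by (simp add: norm_Pair power_mult_distrib real_sqrt_mult distrib_left[symmetric, of "s\<^sup>2" 1, simplified])
          then show ?thesis using True by (simp add: R_def add_pos_nonneg field_simps)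
        qed
        ultimately show "ennreal \<bar>s\<bar> * (ennreal (f (s, 0 + s * \<tau>)) * indicator ?W (s, 0 + s * \<tau>)) =
           ennreal (f (1, \<tau>)) * indicator {tan a..tan b} \<tau> * (ennreal (s ^ Suc k) * indicator {0<..R \<tau>} s)"
          using True nn[of "(1, \<tau>)"] by (auto simp: indicator_def ennreal_mult[symmetric] mult_ac)
      qed
      finally show ?thesis .
    qed
  qed
  also have "\<dots> = (\<integral>\<^sup>+ \<tau>. \<integral>\<^sup>+ s. ennreal (f (1, \<tau>)) * indicator {tan a..tan b} \<tau> * (ennreal (s ^ Suc k) * indicator {0<..R \<tau>} s) \<partial>lborel \<partial>lborel)"
    by (rule lborel_pair.Fubini') (simp add: case_prod_beta indicator_def, measurable)
  also have "\<dots> = (\<integral>\<^sup>+ \<tau>. ennreal ((f (1, \<tau>) * R \<tau> ^ (k + 2) / (real k + 2)) * indicator {tan a..tan b} \<tau>) \<partial>lborel)"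
  proof (rule nn_integral_cong)
    fix \<tau> :: real
    have "(\<integral>\<^sup>+ s. ennreal (f (1, \<tau>)) * indicator {tan a..tan b} \<tau> * (ennreal (s ^ Suc k) * indicator {0<..R \<tau>} s) \<partial>lborel)
        = ennreal (f (1, \<tau>)) * indicator {tan a..tan b} \<tau> * (\<integral>\<^sup>+ s. (ennreal (s ^ Suc k) * indicator {0<..R \<tau>} s) \<partial>lborel)"
      by (rule nn_integral_cmult) measurable
    also have "\<dots> = ennreal ((f (1, \<tau>) * R \<tau> ^ (k + 2) / (real k + 2)) * indicator {tan a..tan b} \<tau>)"
      using R[of \<tau>] nn[of "(1, \<tau>)"] by (subst nn_integral_power_Icc) (auto simp: indicator_def ennreal_mult[symmetric])
    finally show "(\<integral>\<^sup>+ s. ennreal (f (1, \<tau>)) * indicator {tan a..tan b} \<tau> * (ennreal (s ^ Suc k) * indicator {0<..R \<tau>} s) \<partial>lborel) = \<dots>" .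
  qed
  also have "\<dots> = (\<integral>\<^sup>+ \<phi>. ennreal ((f (1, tan \<phi>) * R (tan \<phi>) ^ (k + 2) / (real k + 2)) * inverse ((cos \<phi>)\<^sup>2) * indicator {a..b} \<phi>) \<partial>lborel)"
  proof (rule nn_integral_substitution)
    have c: "cos \<phi> \<noteq> 0" if "\<phi> \<in> {a..b}" for \<phi>
      using that ab cos_gt_zero_pi[of \<phi>] by auto
    show "(tan has_real_derivative inverse ((cos \<phi>)\<^sup>2)) (at \<phi>)" if "\<phi> \<in> {a..b}" for \<phi>
      using c[OF that] by (rule DERIV_tan)
    show "continuous_on {a..b} (\<lambda>\<phi>. inverse ((cos \<phi>)\<^sup>2))"
      using c by (intro continuous_intros) auto
    show "set_borel_measurable borel {tan a..tan b} (\<lambda>\<tau>. f (1, \<tau>) * R \<tau> ^ (k + 2) / (real k + 2))"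
      unfolding set_borel_measurable_def by measurable
  qed (use ab in auto)
  also have "\<dots> = (\<integral>\<^sup>+ \<phi>. ennreal (f (cos \<phi>, sin \<phi>) / (real k + 2)) * indicator {a..b} \<phi> \<partial>lborel)"
  proof (rule nn_integral_cong)
    fix \<phi> :: real
    show "ennreal ((f (1, tan \<phi>) * R (tan \<phi>) ^ (k + 2) / (real k + 2)) * inverse ((cos \<phi>)\<^sup>2) * indicator {a..b} \<phi>)
      = ennreal (f (cos \<phi>, sin \<phi>) / (real k + 2)) * indicator {a..b} \<phi>"
    proof (cases "\<phi> \<in> {a..b}")
      case True
      then have c: "0 < cos \<phi>" using ab cos_gt_zero_pi[of \<phi>] by auto
      have "f (1, tan \<phi>) = f ((1 / cos \<phi>) *\<^sub>R (cos \<phi>, sin \<phi>))" using c by (simp add: tan_def)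
      also have "\<dots> = (1 / cos \<phi>) ^ k * f (cos \<phi>, sin \<phi>)" using c by (intro hom) simp
      finally have f1: "f (1, tan \<phi>) = (1 / cos \<phi>) ^ k * f (cos \<phi>, sin \<phi>)" .
      have "1 + (tan \<phi>)\<^sup>2 = inverse ((cos \<phi>)\<^sup>2)" using c tan_sec[of \<phi>] by (simp add: power_inverse)
      then have R1: "R (tan \<phi>) = cos \<phi>"
        using c by (simp add: R_def real_sqrt_divide inverse_eq_divide)
      show ?thesis using True c by (simp add: f1 R1 field_simps power2_eq_square)
    qed simp
  qed
  also have "\<dots> = ennreal (integral {a..b} (\<lambda>\<phi>. f (cos \<phi>, sin \<phi>)) / (real k + 2))"
  proof (rule nn_integral_has_integral_lebesgue')
    show "((\<lambda>\<phi>. f (cos \<phi>, sin \<phi>) / (real k + 2)) has_integral integral {a..b} (\<lambda>\<phi>. f (cos \<phi>, sin \<phi>)) / (real k + 2)) {a..b}"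
      by (intro has_integral_divide integrable_integral integrable_continuous_real cont)
  qed (use nn in auto)
  finally show ?thesis .
qed

definition upper_disk :: "(real \<times> real) set" where
  "upper_disk = {p. norm p \<le> 1 \<and> 0 \<le> snd p}"

definition lower_disk :: "(real \<times> real) set" where
  "lower_disk = {p. norm p \<le> 1 \<and> snd p \<le> 0}"

lemma half_disks_measurable [measurable]: "upper_disk \<in> sets borel" "lower_disk \<in> sets borel"
  unfolding upper_disk_def lower_disk_def by measurable

lemma nn_integral_swap_lower_upper_disk:
  fixes f :: "real \<times> real \<Rightarrow> ennreal"
  assumes [measurable]: "f \<in> borel_measurable borel" and sym: "\<And>s t. f (s, - t) = f (s, t)"
  shows "(\<integral>\<^sup>+ p. f p * indicator lower_disk p \<partial>lborel) = (\<integral>\<^sup>+ p. f p * indicator upper_disk p \<partial>lborel)"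
proof -
  have "(\<integral>\<^sup>+ p. f p * indicator lower_disk p \<partial>lborel) = (\<integral>\<^sup>+ s. \<integral>\<^sup>+ t. f (s, t) * indicator lower_disk (s, t) \<partial>lborel \<partial>lborel)"
    by (rule nn_integral_lborel_pair) measurable
  also have "\<dots> = (\<integral>\<^sup>+ s. \<integral>\<^sup>+ t. f (s, t) * indicator upper_disk (s, t) \<partial>lborel \<partial>lborel)"
  proof (rule nn_integral_cong)
    fix s :: real
    have "(\<integral>\<^sup>+ t. f (s, t) * indicator lower_disk (s, t) \<partial>lborel) = ennreal \<bar>- 1\<bar> * (\<integral>\<^sup>+ t. f (s, 0 + - 1 * t) * indicator lower_disk (s, 0 + - 1 * t) \<partial>lborel)"
      by (intro nn_integral_real_affine) measurable
    also have "\<dots> = (\<integral>\<^sup>+ t. f (s, t) * indicator upper_disk (s, t) \<partial>lborel)"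
      by (auto intro!: nn_integral_cong simp: sym indicator_def upper_disk_def lower_disk_def norm_Pair)
    finally show "(\<integral>\<^sup>+ t. f (s, t) * indicator lower_disk (s, t) \<partial>lborel) = \<dots>" .
  qed
  also have "\<dots> = (\<integral>\<^sup>+ p. f p * indicator upper_disk p \<partial>lborel)"
    by (rule nn_integral_lborel_pair[symmetric]) measurable
  finally show ?thesis .
qed

text \<open>
  Since \<open>\<tau> / sqrt (1 + \<tau>\<^sup>2)\<close> is the sine of the angle with tangent \<open>\<tau>\<close>, this compares two angles by their sines.
  The sine form is what relates the moment weight \<open>t\<close> to the mass weight \<open>norm (s, t)\<close>.
\<close>

lemma ratio_le_iff_sine:
  fixes s t \<tau> :: real
  assumes "0 < s" "0 \<le> t" "0 \<le> \<tau>"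
  shows "t \<le> \<tau> * s \<longleftrightarrow> t \<le> \<tau> / sqrt (1 + \<tau>\<^sup>2) * sqrt (s\<^sup>2 + t\<^sup>2)"
proof -
  have "t \<le> \<tau> / sqrt (1 + \<tau>\<^sup>2) * sqrt (s\<^sup>2 + t\<^sup>2) \<longleftrightarrow> t * sqrt (1 + \<tau>\<^sup>2) \<le> \<tau> * sqrt (s\<^sup>2 + t\<^sup>2)"
    by (simp add: field_simps add_pos_nonneg)
  also have "\<dots> \<longleftrightarrow> (t * sqrt (1 + \<tau>\<^sup>2))\<^sup>2 \<le> (\<tau> * sqrt (s\<^sup>2 + t\<^sup>2))\<^sup>2"
    using assms by (intro power_mono_iff[symmetric]) auto
  also have "\<dots> \<longleftrightarrow> t\<^sup>2 \<le> (\<tau> * s)\<^sup>2"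
    by (simp add: power_mult_distrib algebra_simps)
  also have "\<dots> \<longleftrightarrow> t \<le> \<tau> * s"
    using assms by (simp add: power2_le_iff_abs_le)
  finally show ?thesis by simp
qed

lemma strict_nn_integral_on_open:
  fixes f g :: "real \<times> real \<Rightarrow> real"
  assumes [measurable]: "f \<in> borel_measurable borel" "g \<in> borel_measurable borel" "A \<in> sets borel"
    and le: "\<And>p. p \<in> A \<Longrightarrow> f p \<le> g p" and nn: "\<And>p. p \<in> A \<Longrightarrow> 0 \<le> f p"
    and fin: "(\<integral>\<^sup>+ p. ennreal (f p) * indicator A p \<partial>lborel) < \<infinity>"
    and U: "open U" "U \<noteq> {}" "U \<subseteq> A" "\<And>p. p \<in> U \<Longrightarrow> f p < g p"
  shows "(\<integral>\<^sup>+ p. ennreal (f p) * indicator A p \<partial>lborel) < (\<integral>\<^sup>+ p. ennreal (g p) * indicator A p \<partial>lborel)"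
proof (rule nn_integral_less)
  show "AE p in lborel. ennreal (f p) * indicator A p \<le> ennreal (g p) * indicator A p"
    using le by (auto simp: indicator_def intro!: AE_I2 ennreal_leI)
  show "\<not> (AE p in lborel. ennreal (g p) * indicator A p \<le> ennreal (f p) * indicator A p)"
  proof
    assume "AE p in lborel. ennreal (g p) * indicator A p \<le> ennreal (f p) * indicator A p"
    moreover have "p \<notin> U" if "ennreal (g p) * indicator A p \<le> ennreal (f p) * indicator A p" for p
    proof
      assume p: "p \<in> U"
      then have "p \<in> A" using U by auto
      then show False using that U(4)[OF p] nn[of p] by (simp add: indicator_def)
    qed
    ultimately have "AE p in lborel. p \<notin> U" by (rule eventually_mono)
    then have "U \<in> null_sets lborel"
      using U(1) by (subst (asm) AE_iff_null_sets[symmetric]) auto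
    then have "negligible U" by (simp add: negligible_iff_null_sets null_sets_completionI)
    then show False using U(1,2) open_not_negligible by blast
  qed
qed (use fin in auto)

text \<open>
  Angles are measured from the ray on which the density \<open>sin t ^ m\<close> vanishes, so \<open>\<beta>\<close> is the angle of the axis about
  which the moment is taken.
\<close>

definition wedge_moment :: "nat \<Rightarrow> real \<Rightarrow> real \<Rightarrow> real" where
  "wedge_moment m \<beta> x = integral {0..x} (\<lambda>t. sin (\<beta> - t) * sin t ^ m)"

lemma wedge_moment_combine:
  assumes "0 \<le> a" "a \<le> b"
  shows "integral {a..b} (\<lambda>t. sin (\<beta> - t) * sin t ^ m) = wedge_moment m \<beta> b - wedge_moment m \<beta> a"
proof -
  have "wedge_moment m \<beta> a + integral {a..b} (\<lambda>t. sin (\<beta> - t) * sin t ^ m) = wedge_moment m \<beta> b"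
    unfolding wedge_moment_def
    by (rule Henstock_Kurzweil_Integration.integral_combine)
      (use assms in \<open>auto intro!: integrable_continuous_real continuous_intros\<close>)
  then show ?thesis by simp
qed

lemma DERIV_wedge_moment:
  assumes "0 < x"
  shows "(wedge_moment m \<beta> has_real_derivative sin (\<beta> - x) * sin x ^ m) (at x)"
proof -
  have "(wedge_moment m \<beta> has_real_derivative sin (\<beta> - x) * sin x ^ m) (at x within {0..x+1})"
    unfolding wedge_moment_def using assms
    by (intro integral_has_real_derivative continuous_intros) auto
  then show ?thesis
    using assms by (subst (asm) at_within_interior[of x "{0..x+1}"]) auto
qed

lemma continuous_on_wedge_moment: "continuous_on {0..b} (wedge_moment m \<beta>)"
  unfolding wedge_moment_def
  by (intro indefinite_integral_continuous_1 integrable_continuous_real continuous_intros)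

lemma wedge_moment_pos:
  assumes "0 < \<beta>" "\<beta> < pi"
  shows "0 < wedge_moment m \<beta> \<beta>"
proof -
  have "wedge_moment m \<beta> 0 < wedge_moment m \<beta> \<beta>"
  proof (rule DERIV_pos_imp_increasing_open[OF assms(1)])
    fix x assume x: "0 < x" "x < \<beta>"
    then have "0 < sin (\<beta> - x) * sin x ^ m" using assms by (intro mult_pos_pos zero_less_power sin_gt_zero) auto
    then show "\<exists>y. (wedge_moment m \<beta> has_real_derivative y) (at x) \<and> 0 < y"
      using DERIV_wedge_moment[OF x(1)] by blast
  qed (rule continuous_on_wedge_moment)
  then show ?thesis by (simp add: wedge_moment_def)
qed

text \<open>
  The points \<open>\<beta> + x\<close> and \<open>\<beta> - x\<close> have opposite lever arms, and the density is larger at the first one because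
  \<open>\<beta> \<le> pi / 2\<close>.
\<close>

lemma wedge_moment_double_nonpos:
  assumes "0 < \<beta>" "\<beta> \<le> pi / 2"
  shows "wedge_moment m \<beta> (2 * \<beta>) \<le> 0"
proof -
  define G where "G x = wedge_moment m \<beta> (\<beta> + x) - wedge_moment m \<beta> (\<beta> - x)" for x
  have "G \<beta> \<le> G 0"
  proof (rule DERIV_nonpos_imp_decreasing_open[where f = G])
    fix x assume x: "0 < x" "x < \<beta>"
    have d1: "((\<lambda>x. wedge_moment m \<beta> (\<beta> + x)) has_real_derivative (sin (\<beta> - (\<beta> + x)) * sin (\<beta> + x) ^ m) * 1) (at x)"
      by (rule DERIV_chain2[OF DERIV_wedge_moment]) (use x assms in \<open>auto intro!: derivative_eq_intros\<close>)
    have d2: "((\<lambda>x. wedge_moment m \<beta> (\<beta> - x)) has_real_derivative (sin (\<beta> - (\<beta> - x)) * sin (\<beta> - x) ^ m) * (- 1)) (at x)"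
      by (rule DERIV_chain2[OF DERIV_wedge_moment]) (use x assms in \<open>auto intro!: derivative_eq_intros\<close>)
    have "sin (\<beta> - x) ^ m \<le> sin (\<beta> + x) ^ m"
    proof (rule power_mono)
      have "0 \<le> sin x * cos \<beta>" using x assms by (intro mult_nonneg_nonneg sin_ge_zero cos_ge_zero) auto
      then show "sin (\<beta> - x) \<le> sin (\<beta> + x)" by (simp add: sin_add sin_diff mult.commute)
      show "0 \<le> sin (\<beta> - x)" using x assms by (intro sin_ge_zero) auto
    qed
    moreover have "0 \<le> sin x" using x assms by (intro sin_ge_zero) auto
    ultimately have "sin x * (sin (\<beta> - x) ^ m - sin (\<beta> + x) ^ m) \<le> 0"
      by (intro mult_nonneg_nonpos) auto
    then have "(sin (\<beta> - (\<beta> + x)) * sin (\<beta> + x) ^ m) * 1 - (sin (\<beta> - (\<beta> - x)) * sin (\<beta> - x) ^ m) * (- 1) \<le> 0"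
      by (simp add: algebra_simps)
    moreover have "(G has_real_derivative (sin (\<beta> - (\<beta> + x)) * sin (\<beta> + x) ^ m) * 1 - (sin (\<beta> - (\<beta> - x)) * sin (\<beta> - x) ^ m) * (- 1)) (at x)"
      unfolding G_def by (rule DERIV_diff[OF d1 d2])
    ultimately show "\<exists>y. (G has_real_derivative y) (at x) \<and> y \<le> 0" by blast
  next
    show "continuous_on {0..\<beta>} G"
      unfolding G_def
      by (intro continuous_on_diff continuous_on_compose2[OF continuous_on_wedge_moment[of "2 * \<beta>"]] continuous_intros) auto
  qed (use assms in auto)
  then show ?thesis by (simp add: G_def wedge_moment_def)
qed

lemma integral_reverse_angle:
  fixes f :: "real \<Rightarrow> real"
  assumes "a \<le> b" "continuous_on {\<beta> - b..\<beta> - a} f"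
  shows "integral {a..b} (\<lambda>\<phi>. f (\<beta> - \<phi>)) = integral {\<beta> - b..\<beta> - a} f"
proof -
  have "(f has_integral integral {\<beta> - b..\<beta> - a} f) (cbox (\<beta> - b) (\<beta> - a))"
    using assms by (auto intro!: integrable_integral integrable_continuous_real)
  from has_integral_affinity[OF this, of "-1" \<beta>] assms(1)
  have "((\<lambda>x. f (\<beta> - x)) has_integral integral {\<beta> - b..\<beta> - a} f) ((\<lambda>x. \<beta> - x) ` {\<beta> - b..\<beta> - a})"
    by (simp add: algebra_simps)
  moreover have "(\<lambda>x. \<beta> - x) ` {\<beta> - b..\<beta> - a} = {a..b}" using assms(1) by simp
  ultimately show ?thesis by (simp add: integral_unique)
qed

text \<open>
  The circular sector between the angles \<open>a\<close> and \<open>b\<close> in \<open>(-pi/2, pi/2)\<close>, described by slopes so that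
  \<open>nn_integral_wedge_polar\<close> applies.
\<close>

definition plane_wedge :: "real \<Rightarrow> real \<Rightarrow> (real \<times> real) set" where
  "plane_wedge a b = {p. norm p \<le> 1 \<and> 0 < fst p \<and> tan a * fst p \<le> snd p \<and> snd p \<le> tan b * fst p}"

lemma plane_wedge_measurable [measurable]: "plane_wedge a b \<in> sets borel"
  unfolding plane_wedge_def by measurable

text \<open>
  The power of a linear function that vanishes on the ray of angle \<open>\<beta>\<close>, cut off beyond that ray. At angle \<open>\<phi> \<le> \<beta>\<close>
  on the unit circle its value is \<open>(K * sin (\<beta> - \<phi>)) ^ m\<close>.
\<close>

definition wedge_density :: "nat \<Rightarrow> real \<Rightarrow> real \<Rightarrow> real \<times> real \<Rightarrow> real" where
  "wedge_density m K \<beta> p = (K * max 0 (fst p * sin \<beta> - snd p * cos \<beta>)) ^ m"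

lemma wedge_density_measurable [measurable]: "wedge_density m K \<beta> \<in> borel_measurable borel"
  unfolding wedge_density_def by measurable

lemma wedge_density_nonneg: "0 \<le> K \<Longrightarrow> 0 \<le> wedge_density m K \<beta> p"
  unfolding wedge_density_def by (intro zero_le_power mult_nonneg_nonneg) auto

lemma wedge_density_scale:
  assumes "0 < c" shows "wedge_density m K \<beta> (c *\<^sub>R p) = c ^ m * wedge_density m K \<beta> p"
proof -
  have "max 0 (c * x) = c * max 0 x" for x using assms by (simp add: max_def zero_le_mult_iff mult_le_0_iff)
  then have "max 0 (fst (c *\<^sub>R p) * sin \<beta> - snd (c *\<^sub>R p) * cos \<beta>) = c * max 0 (fst p * sin \<beta> - snd p * cos \<beta>)"
  proof -
    have "fst (c *\<^sub>R p) * sin \<beta> - snd (c *\<^sub>R p) * cos \<beta> = c * (fst p * sin \<beta> - snd p * cos \<beta>)"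
      by (simp add: algebra_simps)
    then show ?thesis by (simp only: \<open>\<And>x. max 0 (c * x) = c * max 0 x\<close>)
  qed
  then show ?thesis by (simp add: wedge_density_def power_mult_distrib mult.left_commute)
qed

lemma wedge_density_circle:
  assumes "- pi / 2 \<le> \<phi>" "\<phi> \<le> \<beta>" "\<beta> \<le> pi / 2"
  shows "wedge_density m K \<beta> (cos \<phi>, sin \<phi>) = K ^ m * sin (\<beta> - \<phi>) ^ m"
proof -
  have "cos \<phi> * sin \<beta> - sin \<phi> * cos \<beta> = sin (\<beta> - \<phi>)" by (simp add: sin_diff mult.commute)
  moreover have "0 \<le> sin (\<beta> - \<phi>)" using assms by (intro sin_ge_zero) auto
  ultimately show ?thesis by (simp add: wedge_density_def power_mult_distrib)
qed

lemma continuous_on_wedge_density_circle: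
  "continuous_on S (\<lambda>\<phi>. wedge_density m K \<beta> (cos \<phi>, sin \<phi>))"
  unfolding wedge_density_def by (intro continuous_intros)

lemma wedge_density_mass:
  assumes "0 \<le> K" "0 < \<beta>" "\<beta> \<le> pi / 2" "- pi / 2 < a" "a \<le> b" "b \<le> \<beta>" "b < pi / 2"
  shows "(\<integral>\<^sup>+ p. ennreal (norm p * wedge_density m K \<beta> p) * indicator (plane_wedge a b) p \<partial>lborel)
      = ennreal (K ^ m * (sin_pow_int m (\<beta> - a) - sin_pow_int m (\<beta> - b)) / (real m + 3))"
proof -
  have "(\<integral>\<^sup>+ p. ennreal (norm p * wedge_density m K \<beta> p) * indicator (plane_wedge a b) p \<partial>lborel)
     = ennreal (integral {a..b} (\<lambda>\<phi>. norm (cos \<phi>, sin \<phi>) * wedge_density m K \<beta> (cos \<phi>, sin \<phi>)) / (real (m + 1) + 2))"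
    unfolding plane_wedge_def
  proof (rule nn_integral_wedge_polar)
    show "continuous_on {a..b} (\<lambda>\<phi>. norm (cos \<phi>, sin \<phi>) * wedge_density m K \<beta> (cos \<phi>, sin \<phi>))"
      by (intro continuous_intros continuous_on_wedge_density_circle)
  qed (use assms in \<open>auto simp: wedge_density_nonneg wedge_density_scale\<close>)
  also have "integral {a..b} (\<lambda>\<phi>. norm (cos \<phi>, sin \<phi>) * wedge_density m K \<beta> (cos \<phi>, sin \<phi>)) = integral {a..b} (\<lambda>\<phi>. K ^ m * sin (\<beta> - \<phi>) ^ m)"
    using assms by (intro integral_cong) (auto simp: norm_Pair wedge_density_circle)
  also have "\<dots> = K ^ m * integral {a..b} (\<lambda>\<phi>. sin (\<beta> - \<phi>) ^ m)"
    by simp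
  also have "integral {a..b} (\<lambda>\<phi>. sin (\<beta> - \<phi>) ^ m) = integral {\<beta> - b..\<beta> - a} (\<lambda>x. sin x ^ m)"
    using assms by (intro integral_reverse_angle continuous_intros)
  also have "\<dots> = sin_pow_int m (\<beta> - a) - sin_pow_int m (\<beta> - b)"
    using assms by (intro integral_unique sin_pow_int_diff) auto
  also have "real (m + 1) + 2 = real m + 3" by simp
  finally show ?thesis .
qed

text \<open>
  The factor \<open>e\<close> is the sign of the second coordinate on the sector, one above the axis and minus one below it.
\<close>

lemma wedge_density_moment:
  assumes "0 \<le> K" "0 < \<beta>" "\<beta> \<le> pi / 2" "- pi / 2 < a" "a \<le> b" "b \<le> \<beta>" "b < pi / 2"
    and sg: "\<And>\<phi>. a \<le> \<phi> \<Longrightarrow> \<phi> \<le> b \<Longrightarrow> \<bar>sin \<phi>\<bar> = e * sin \<phi>"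
  shows "(\<integral>\<^sup>+ p. ennreal (\<bar>snd p\<bar> * wedge_density m K \<beta> p) * indicator (plane_wedge a b) p \<partial>lborel)
      = ennreal (K ^ m * (e * (wedge_moment m \<beta> (\<beta> - a) - wedge_moment m \<beta> (\<beta> - b))) / (real m + 3))"
proof -
  have "(\<integral>\<^sup>+ p. ennreal (\<bar>snd p\<bar> * wedge_density m K \<beta> p) * indicator (plane_wedge a b) p \<partial>lborel)
     = ennreal (integral {a..b} (\<lambda>\<phi>. \<bar>snd (cos \<phi>, sin \<phi>)\<bar> * wedge_density m K \<beta> (cos \<phi>, sin \<phi>)) / (real (m + 1) + 2))"
    unfolding plane_wedge_def
  proof (rule nn_integral_wedge_polar)
    show "continuous_on {a..b} (\<lambda>\<phi>. \<bar>snd (cos \<phi>, sin \<phi>)\<bar> * wedge_density m K \<beta> (cos \<phi>, sin \<phi>))"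
      by (intro continuous_intros continuous_on_wedge_density_circle)
  qed (use assms in \<open>auto simp: wedge_density_nonneg wedge_density_scale abs_mult\<close>)
  also have "integral {a..b} (\<lambda>\<phi>. \<bar>snd (cos \<phi>, sin \<phi>)\<bar> * wedge_density m K \<beta> (cos \<phi>, sin \<phi>)) = integral {a..b} (\<lambda>\<phi>. K ^ m * e * ((\<lambda>x. sin (\<beta> - x) * sin x ^ m) (\<beta> - \<phi>)))"
    using assms by (intro integral_cong) (auto simp: wedge_density_circle sg)
  also have "\<dots> = K ^ m * e * integral {a..b} (\<lambda>\<phi>. (\<lambda>x. sin (\<beta> - x) * sin x ^ m) (\<beta> - \<phi>))"
    by (rule integral_mult_right)
  also have "integral {a..b} (\<lambda>\<phi>. (\<lambda>x. sin (\<beta> - x) * sin x ^ m) (\<beta> - \<phi>)) = integral {\<beta> - b..\<beta> - a} (\<lambda>x. sin (\<beta> - x) * sin x ^ m)"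
    using assms by (intro integral_reverse_angle continuous_intros)
  also have "\<dots> = wedge_moment m \<beta> (\<beta> - a) - wedge_moment m \<beta> (\<beta> - b)"
    using assms by (intro wedge_moment_combine) auto
  also have "real (m + 1) + 2 = real m + 3" by simp
  finally show ?thesis by (simp add: mult.assoc)
qed

lemma wedge_density_upper_disk:
  assumes m: "1 \<le> m" and \<beta>: "0 < \<beta>" "\<beta> < pi / 2" and p: "0 \<le> snd p"
    and nz: "w p * wedge_density m K \<beta> p \<noteq> 0"
  shows "p \<in> upper_disk \<longleftrightarrow> p \<in> plane_wedge 0 \<beta>"
proof -
  have sc: "0 < sin \<beta>" "0 < cos \<beta>" using \<beta> by (auto intro!: sin_gt_zero cos_gt_zero_pi)
  have "0 < fst p * sin \<beta> - snd p * cos \<beta>"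
  proof (rule ccontr)
    assume "\<not> ?thesis"
    then have "wedge_density m K \<beta> p = 0" using m by (simp add: wedge_density_def)
    then show False using nz by simp
  qed
  moreover from this have "0 < fst p * sin \<beta>" using p sc by (smt (verit) mult_nonneg_nonneg)
  then have "0 < fst p" using sc by (simp add: zero_less_mult_iff)
  ultimately show ?thesis
    using p sc by (auto simp: upper_disk_def plane_wedge_def tan_def field_simps)
qed

lemma wedge_density_upper_integral:
  assumes m: "1 \<le> m" and \<beta>: "0 < \<beta>" "\<beta> < pi / 2"
  shows "(\<integral>\<^sup>+ p. ennreal (w p * wedge_density m K \<beta> p) * indicator upper_disk p \<partial>lborel)
       = (\<integral>\<^sup>+ p. ennreal (w p * wedge_density m K \<beta> p) * indicator (plane_wedge 0 \<beta>) p \<partial>lborel)"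
proof (rule nn_integral_cong)
  fix p :: "real \<times> real"
  show "ennreal (w p * wedge_density m K \<beta> p) * indicator upper_disk p = ennreal (w p * wedge_density m K \<beta> p) * indicator (plane_wedge 0 \<beta>) p"
  proof (cases "0 \<le> snd p \<and> w p * wedge_density m K \<beta> p \<noteq> 0")
    case True
    then show ?thesis using wedge_density_upper_disk[OF m \<beta>, of p w K] by (auto simp: indicator_def)
  next
    case False
    moreover have "0 \<le> snd p" if "p \<in> plane_wedge 0 \<beta>" using that by (simp add: plane_wedge_def)
    ultimately show ?thesis by (auto simp: indicator_def upper_disk_def)
  qed
qed

text \<open>
  A quarter disk reaches the angle \<open>pi / 2\<close>, which a \<open>plane_wedge\<close> cannot, so it is exhausted by the sectors up to
  \<open>arctan n\<close>.
\<close>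

lemma wedge_density_right_angle_mass:
  assumes m: "1 \<le> m" and K: "0 \<le> K"
  shows "(\<integral>\<^sup>+ p. ennreal (norm p * wedge_density m K (pi/2) p) * indicator upper_disk p \<partial>lborel)
       \<le> ennreal (K ^ m * sin_pow_int m (pi / 2) / (real m + 3))"
proof -
  let ?g = "\<lambda>p. ennreal (norm p * wedge_density m K (pi/2) p)"
  define F where "F n p = ?g p * indicator (plane_wedge 0 (arctan (real n))) p" for n :: nat and p
  have sup: "?g p * indicator upper_disk p = (SUP n. F n p)" for p
  proof (cases "0 < fst p \<and> p \<in> upper_disk")
    case True
    obtain n :: nat where n: "snd p / fst p \<le> real n" using real_arch_simple by blast
    have "?g p * indicator upper_disk p = F n p"
      using True n by (simp add: F_def indicator_def upper_disk_def plane_wedge_def tan_arctan field_simps)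
    also have "\<dots> \<le> (SUP n. F n p)" by (rule SUP_upper) simp
    finally have "?g p * indicator upper_disk p \<le> (SUP n. F n p)" .
    moreover have "(SUP n. F n p) \<le> ?g p * indicator upper_disk p"
      using True by (intro SUP_least) (auto simp: F_def indicator_def)
    ultimately show ?thesis by (rule antisym)
  next
    case False
    have "F n p = 0" for n using False by (auto simp: F_def indicator_def plane_wedge_def upper_disk_def)
    moreover have "?g p * indicator upper_disk p = 0"
      using False m by (auto simp: indicator_def wedge_density_def)
    ultimately show ?thesis by simp
  qed
  have "incseq F"
  proof (rule incseq_SucI, rule le_funI)
    fix n p
    have "plane_wedge 0 (arctan (real n)) \<subseteq> plane_wedge 0 (arctan (real (Suc n)))"
      by (auto simp: plane_wedge_def tan_arctan intro: order_trans mult_right_mono)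
    then show "F n p \<le> F (Suc n) p" by (auto simp: F_def indicator_def)
  qed
  then have "(\<integral>\<^sup>+ p. ?g p * indicator upper_disk p \<partial>lborel) = (SUP n. \<integral>\<^sup>+ p. F n p \<partial>lborel)"
    unfolding sup by (rule nn_integral_monotone_convergence_SUP) (unfold F_def, measurable)
  also have "\<dots> \<le> ennreal (K ^ m * sin_pow_int m (pi / 2) / (real m + 3))"
  proof (rule SUP_least)
    fix n :: nat
    have a: "0 \<le> arctan (real n)" "arctan (real n) < pi / 2" using arctan_ubound by auto
    have "0 < sin_pow_int m (pi / 2 - arctan (real n))"
      by (rule sin_pow_int_pos) (use a pi_gt_zero in linarith)+
    have "(\<integral>\<^sup>+ p. F n p \<partial>lborel) = ennreal (K ^ m * (sin_pow_int m (pi/2 - 0) - sin_pow_int m (pi/2 - arctan (real n))) / (real m + 3))"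
      unfolding F_def using a K by (intro wedge_density_mass) auto
    also have "\<dots> \<le> ennreal (K ^ m * sin_pow_int m (pi / 2) / (real m + 3))"
      using K \<open>0 < sin_pow_int m (pi / 2 - arctan (real n))\<close>
      by (intro ennreal_leI divide_right_mono mult_left_mono) auto
    finally show "(\<integral>\<^sup>+ p. F n p \<partial>lborel) \<le> ennreal (K ^ m * sin_pow_int m (pi / 2) / (real m + 3))" .
  qed
  finally show ?thesis .
qed

text \<open>
  Dividing by \<open>sin \<beta> ^ m\<close>, one sees that the mass of the comparison density tends to zero with \<open>\<beta>\<close>; this is one end of
  the intermediate value argument that fixes its angle.
\<close>

lemma sin_pow_int_le:
  assumes "0 \<le> \<beta>" "\<beta> \<le> pi / 2"
  shows "sin_pow_int m \<beta> \<le> \<beta> * sin \<beta> ^ m"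
proof -
  have "sin_pow_int m \<beta> \<le> integral {0..\<beta>} (\<lambda>_. sin \<beta> ^ m)"
    unfolding sin_pow_int_def
  proof (rule integral_le)
    fix x assume "x \<in> {0..\<beta>}"
    then show "sin x ^ m \<le> sin \<beta> ^ m"
      using assms by (intro power_mono sin_monotone_2pi_le sin_ge_zero) auto
  qed (auto intro!: integrable_continuous_real continuous_intros)
  then show ?thesis using assms by simp
qed

section \<open>Comparison of planar densities\<close>

text \<open>
  Compare \<open>\<rho> = \<psi> ^ m\<close> with the wedge density \<open>D \<beta>\<close> that agrees with it on the axis and has the same mass in the
  upper half disk. A superadditive function that equals a linear one on the axis and reaches it above the axis stays above it between that point and
  the axis, and stays below it on the other side of the axis. So \<open>\<rho>\<close> exceeds \<open>D \<beta>\<close> at small positive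
  angles only, whence its upper moment is smaller, and \<open>\<rho> \<le> D \<beta>\<close> in the lower half disk. There, among
  densities below \<open>D \<beta>\<close> with at most a given moment, the mass is largest if all of it is as close to the axis as
  possible, that is for \<open>D \<beta>\<close> restricted to a sector. If the moments balance, this sector and the upper one
  together are the situation of \<open>sin_wedge_mass_ratio\<close>.
\<close>

lemma planar_crossing_mass_ratio:
  fixes \<psi> :: "real \<times> real \<Rightarrow> real" and m :: nat
  assumes m: "1 \<le> m"
    and meas[measurable]: "\<psi> \<in> borel_measurable borel" and nn: "\<And>p. 0 \<le> \<psi> p"
    and hom: "\<And>c p. 0 < c \<Longrightarrow> \<psi> (c *\<^sub>R p) = c * \<psi> p"
    and superadd: "\<And>p q. 0 < \<psi> p \<Longrightarrow> 0 < \<psi> q \<Longrightarrow> \<psi> p + \<psi> q \<le> \<psi> (p + q)"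
    and axis: "0 < \<psi> (1, 0)" "\<And>s. s \<le> 0 \<Longrightarrow> \<psi> (s, 0) = 0"
    and finU: "(\<integral>\<^sup>+ p. ennreal (norm p * \<psi> p ^ m) * indicator upper_disk p \<partial>lborel) < \<infinity>"
    and finL: "(\<integral>\<^sup>+ p. ennreal (norm p * \<psi> p ^ m) * indicator lower_disk p \<partial>lborel) < \<infinity>"
    and pos: "0 < (\<integral>\<^sup>+ p. ennreal (norm p * \<psi> p ^ m) * indicator upper_disk p \<partial>lborel)"
    and mom: "(\<integral>\<^sup>+ p. ennreal (\<bar>snd p\<bar> * \<psi> p ^ m) * indicator lower_disk p \<partial>lborel)
           \<le> (\<integral>\<^sup>+ p. ennreal (\<bar>snd p\<bar> * \<psi> p ^ m) * indicator upper_disk p \<partial>lborel)"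
  shows "ennreal (((real m + 1) / (real m + 2)) ^ (m + 1)) *
      ((\<integral>\<^sup>+ p. ennreal (norm p * \<psi> p ^ m) * indicator upper_disk p \<partial>lborel)
        + (\<integral>\<^sup>+ p. ennreal (norm p * \<psi> p ^ m) * indicator lower_disk p \<partial>lborel))
     \<le> (\<integral>\<^sup>+ p. ennreal (norm p * \<psi> p ^ m) * indicator upper_disk p \<partial>lborel)"
proof -
  define U where "U w g = (\<integral>\<^sup>+ p. ennreal (w p * g p) * indicator upper_disk p \<partial>lborel)" for w g :: "real \<times> real \<Rightarrow> real"
  define L where "L w g = (\<integral>\<^sup>+ p. ennreal (w p * g p) * indicator lower_disk p \<partial>lborel)" for w g :: "real \<times> real \<Rightarrow> real"
  let ?n = "norm :: real \<times> real \<Rightarrow> real"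
  let ?t = "\<lambda>p :: real \<times> real. \<bar>snd p\<bar>"
  define \<rho> where "\<rho> p = \<psi> p ^ m" for p
  have [measurable]: "\<rho> \<in> borel_measurable borel" unfolding \<rho>_def by measurable
  have rho0: "0 \<le> \<rho> p" for p by (simp add: \<rho>_def nn)
  define k where "k = \<psi> (1, 0)"
  have k: "0 < k" using axis by (simp add: k_def)
  define c where "c = ((real m + 1) / (real m + 2)) ^ (m + 1)"
  have c0: "0 \<le> c" by (simp add: c_def)
  have c2: "c \<le> 1 / 2"
  proof -
    have "1 + real (m + 1) * (1 / (real m + 1)) \<le> (1 + 1 / (real m + 1)) ^ (m + 1)"
      by (rule Bernoulli_inequality) (simp add: field_simps)
    moreover have "real (m + 1) * (1 / (real m + 1)) = 1" by simp
    ultimately have "2 \<le> (1 + 1 / (real m + 1)) ^ (m + 1)" by linarith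
    moreover have "c = 1 / (1 + 1 / (real m + 1)) ^ (m + 1)"
      by (simp add: c_def power_one_over[symmetric] field_simps)
    ultimately show ?thesis using frac_le[of 1 1 2 "(1 + 1 / (real m + 1)) ^ (m + 1)"] by simp
  qed
  have psi_axis: "\<psi> (s, 0) = k * s" if "0 < s" for s
    using hom[of s "(1, 0)"] that by (simp add: k_def)
  obtain v where v: "U ?n \<rho> = ennreal v" "0 < v"
    using finU pos unfolding U_def \<rho>_def by (cases "U ?n \<rho>") (auto simp: U_def \<rho>_def)
  obtain v' where v': "L ?n \<rho> = ennreal v'" "0 \<le> v'"
    using finL unfolding L_def \<rho>_def by (cases "L ?n \<rho>") (auto simp: L_def \<rho>_def)
  have mom': "L ?t \<rho> \<le> U ?t \<rho>" using mom by (simp add: L_def U_def \<rho>_def)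
  have goal: ?thesis if "c * (v + v') \<le> v"
    using that v v' c0 unfolding c_def[symmetric]
    by (simp add: U_def[symmetric] L_def[symmetric] \<rho>_def[symmetric] ennreal_plus[symmetric] ennreal_mult[symmetric] del: ennreal_plus)

  \<comment> \<open>For each angle \<open>\<beta>\<close>, \<open>l \<beta>\<close> is the linear function that equals \<open>\<psi>\<close> on the positive axis and vanishes
    on the ray of angle \<open>\<beta>\<close>.\<close>
  define l where "l \<beta> p = k / sin \<beta> * (fst p * sin \<beta> - snd p * cos \<beta>)" for \<beta> and p :: "real \<times> real"
  define D where "D \<beta> = wedge_density m (k / sin \<beta>) \<beta>" for \<beta>
  have [measurable]: "D \<beta> \<in> borel_measurable borel" for \<beta> by (simp add: D_def)
  have Dl: "D \<beta> p = (max 0 (l \<beta> p)) ^ m" if "0 < \<beta>" "\<beta> \<le> pi / 2" for \<beta> p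
  proof -
    have "0 < k / sin \<beta>" using that k by (auto intro!: divide_pos_pos sin_gt_zero)
    moreover have "a * max 0 x = max 0 (a * x)" if "0 < a" for a x :: real
      using that by (auto simp: max_def zero_le_mult_iff mult_le_0_iff)
    ultimately show ?thesis unfolding D_def wedge_density_def l_def by presburger
  qed
  have l_axis: "l \<beta> (s, 0) = k * s" if "0 < \<beta>" "\<beta> \<le> pi / 2" for \<beta> s
  proof -
    have "0 < sin \<beta>" using that by (intro sin_gt_zero) auto
    then show ?thesis by (simp add: l_def)
  qed
  have l_lin: "l \<beta> (a *\<^sub>R p + b *\<^sub>R q) = a * l \<beta> p + b * l \<beta> q" for \<beta> a b p q
    by (simp add: l_def algebra_simps)
  define good where "good \<beta> q \<longleftrightarrow> 0 < snd q \<and> 0 < \<psi> q \<and> l \<beta> q \<le> \<psi> q" for \<beta> q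
  have below: "\<rho> p \<le> D \<beta> p" if "\<psi> p \<le> max 0 (l \<beta> p)" "0 < \<beta>" "\<beta> \<le> pi / 2" for \<beta> p
    unfolding Dl[OF that(2,3)] \<rho>_def using that nn by (intro power_mono)
  have above: "D \<beta> p \<le> \<rho> p" if "l \<beta> p \<le> \<psi> p" "0 < \<beta>" "\<beta> \<le> pi / 2" for \<beta> p
    unfolding Dl[OF that(2,3)] \<rho>_def using that nn by (intro power_mono) auto
  have lower: "\<psi> p \<le> max 0 (l \<beta> p)" if q: "good \<beta> q" and \<beta>: "0 < \<beta>" "\<beta> \<le> pi / 2" and p: "snd p \<le> 0" for \<beta> q p
  proof (rule ccontr)
    assume "\<not> ?thesis"
    then have a: "0 < \<psi> p" "l \<beta> p < \<psi> p" by auto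
    \<comment> \<open>If \<open>\<psi>\<close> were too large at \<open>p\<close> as well, superadditivity on the segment from \<open>q\<close> to \<open>p\<close> would make it
      too large where this segment meets the axis.\<close>
    define r where "r = (- snd p) *\<^sub>R q + snd q *\<^sub>R p"
    have r: "r = (fst r, 0)" by (simp add: r_def prod_eq_iff)
    have "l \<beta> r < \<psi> r \<and> 0 < \<psi> r"
    proof (cases "snd p = 0")
      case True
      have "\<psi> r = snd q * \<psi> p" "l \<beta> r = snd q * l \<beta> p"
        using True q hom[of "snd q" p] l_lin[of \<beta> 0 q "snd q" p] by (auto simp: r_def good_def)
      then show ?thesis using a q by (simp add: good_def)
    next
      case False
      then have sp: "0 < - snd p" "0 < snd q" using p q by (auto simp: good_def)
      have "(- snd p) * \<psi> q + snd q * \<psi> p \<le> \<psi> r"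
        unfolding r_def using sp q a superadd[of "(- snd p) *\<^sub>R q" "snd q *\<^sub>R p"]
        by (simp only: hom[OF sp(1)] hom[OF sp(2)]) (simp add: good_def mult_neg_pos)
      moreover have "(- snd p) * l \<beta> q \<le> (- snd p) * \<psi> q" using sp q by (intro mult_left_mono) (auto simp: good_def)
      moreover have "snd q * l \<beta> p < snd q * \<psi> p" using sp a by simp
      moreover have "0 < (- snd p) * \<psi> q" "0 < snd q * \<psi> p" using sp a q by (auto simp: good_def mult_neg_pos)
      ultimately show ?thesis unfolding r_def l_lin by linarith
    qed
    moreover have "\<not> (l \<beta> r < \<psi> r \<and> 0 < \<psi> r)"
      using axis(2)[of "fst r"] psi_axis[of "fst r"] l_axis[OF \<beta>, of "fst r"] r by (cases "fst r \<le> 0") auto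
    ultimately show False by simp
  qed
  have between: "0 < \<psi> p \<and> l \<beta> p \<le> \<psi> p \<and> (l \<beta> q < \<psi> q \<longrightarrow> 0 < snd p \<longrightarrow> l \<beta> p < \<psi> p)"
    if q: "good \<beta> q" and \<beta>: "0 < \<beta>" "\<beta> \<le> pi / 2" and p: "0 \<le> snd p" "p \<noteq> 0" "snd p * fst q \<le> fst p * snd q" for \<beta> q p
  proof -
    \<comment> \<open>A point between the axis and \<open>q\<close> is a nonnegative combination of \<open>q\<close> and a point of the axis.\<close>
    define b where "b = snd p / snd q"
    define a where "a = fst p - b * fst q"
    have sq: "0 < snd q" using q by (simp add: good_def)
    have ab: "0 \<le> a" "0 \<le> b" using p sq by (auto simp: a_def b_def field_simps)
    have peq: "p = a *\<^sub>R (1, 0) + b *\<^sub>R q" using sq by (simp add: a_def b_def prod_eq_iff)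
    have "\<not> (a = 0 \<and> b = 0)" using p(2) peq by (auto simp: zero_prod_def)
    then have "0 < \<psi> p \<and> a * k + b * \<psi> q \<le> \<psi> p"
    proof (cases "a = 0")
      case True
      then have "0 < b" using ab \<open>\<not> (a = 0 \<and> b = 0)\<close> by auto
      then show ?thesis using True peq hom[of b q] q by (auto simp: good_def zero_prod_def[symmetric])
    next
      case False
      then have a: "0 < a" using ab by simp
      have psa: "\<psi> (a *\<^sub>R (1, 0)) = a * k" using hom[OF a, of "(1, 0)"] by (simp add: k_def)
      show ?thesis
      proof (cases "b = 0")
        case True then show ?thesis using peq psa a k by (metis add.right_neutral mult_pos_pos mult_zero_left order_refl scale_eq_0_iff)
      next
        case False
        then have b: "0 < b" using ab by simp
        have "\<psi> (a *\<^sub>R (1, 0)) + \<psi> (b *\<^sub>R q) \<le> \<psi> (a *\<^sub>R (1, 0) + b *\<^sub>R q)"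
          using psa a k b q hom[OF b] by (intro superadd) (auto simp: good_def)
        moreover have "0 < a * k" "0 < b * \<psi> q" using a b k q by (auto simp: good_def)
        ultimately show ?thesis using peq psa hom[OF b, of q] by simp
      qed
    qed
    moreover have "l \<beta> p = a * k + b * l \<beta> q"
      using l_lin[of \<beta> a "(1,0)" b q] peq l_axis[OF \<beta>, of 1] by simp
    moreover have "b * l \<beta> q \<le> b * \<psi> q" using q ab by (intro mult_left_mono) (auto simp: good_def)
    moreover have "b * l \<beta> q < b * \<psi> q" if "l \<beta> q < \<psi> q" "0 < snd p"
    proof (rule mult_strict_left_mono[OF that(1)])
      show "0 < b" using that(2) sq by (simp add: b_def)
    qed
    ultimately show ?thesis by fastforce
  qed
  have notgood: "\<rho> p \<le> D \<beta> p \<and> (0 < l \<beta> p \<longrightarrow> \<rho> p < D \<beta> p)"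
    if "\<not> good \<beta> p" "0 < snd p" and \<beta>: "0 < \<beta>" "\<beta> \<le> pi / 2" for \<beta> p
  proof -
    have "\<psi> p = 0 \<or> \<psi> p < l \<beta> p" using that nn[of p] by (auto simp: good_def)
    then have "\<psi> p \<le> max 0 (l \<beta> p)" "0 < l \<beta> p \<longrightarrow> \<psi> p < max 0 (l \<beta> p)" by auto
    then show ?thesis using below[OF _ \<beta>] nn[of p] m unfolding Dl[OF \<beta>] \<rho>_def
      by (auto intro: power_strict_mono)
  qed
  have axis_eq: "\<rho> p = D \<beta> p" if "snd p = 0" and \<beta>: "0 < \<beta>" "\<beta> \<le> pi / 2" for \<beta> p
  proof -
    have "p = (fst p, 0)" using that by (simp add: prod_eq_iff)
    then have "\<psi> p = max 0 (l \<beta> p)"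
      using axis(2)[of "fst p"] psi_axis[of "fst p"] l_axis[OF \<beta>, of "fst p"] k mult_nonneg_nonpos[of k "fst p"]
      by (cases "fst p \<le> 0") auto
    then show ?thesis by (simp add: Dl[OF \<beta>] \<rho>_def)
  qed
  have wedge_open: "open {p :: real \<times> real. norm p < 1 \<and> 0 < snd p \<and> 0 < l \<beta> p}" for \<beta>
    unfolding l_def by (intro open_Collect_conj open_Collect_less continuous_intros)
  have wedge_ne: "{p :: real \<times> real. norm p < 1 \<and> 0 < snd p \<and> 0 < l \<beta> p} \<noteq> {}" if \<beta>: "0 < \<beta>" "\<beta> \<le> pi / 2" for \<beta>
  proof -
    have sc: "0 < sin \<beta>" using \<beta> by (intro sin_gt_zero) auto
    define e where "e = sin \<beta> / 4"
    have e: "0 < e" "e \<le> 1/4" using sc by (auto simp: e_def)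
    have "norm (1/2 :: real, e) \<le> norm (1/2 :: real) + norm e" by (rule norm_Pair_le)
    then have "norm (1/2 :: real, e) < 1" using e by simp
    moreover have "0 < l \<beta> (1/2, e)"
    proof -
      have "e * cos \<beta> \<le> e * 1" using e by (intro mult_left_mono) auto
      then have "0 < (1/2) * sin \<beta> - e * cos \<beta>" using sc unfolding e_def by linarith
      then show ?thesis using sc k by (simp add: l_def)
    qed
    ultimately show ?thesis using e by (intro ex_in_conv[THEN iffD1] exI[of _ "(1/2, e)"]) auto
  qed
  have ex_good: "\<exists>q. good \<beta> q" if \<beta>: "0 < \<beta>" "\<beta> \<le> pi / 2" and le: "U ?n (D \<beta>) \<le> U ?n \<rho>" for \<beta>
  proof (rule ccontr)
    assume "\<not> ?thesis"
    then have ng: "\<not> good \<beta> p" for p by blast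
    have "U ?n \<rho> < U ?n (D \<beta>)"
      unfolding U_def
    proof (rule strict_nn_integral_on_open[OF _ _ _ _ _ _ wedge_open wedge_ne[OF \<beta>]])
      show "norm p * \<rho> p \<le> norm p * D \<beta> p" if "p \<in> upper_disk" for p
        using that notgood[OF ng _ \<beta>, of p] axis_eq[OF _ \<beta>, of p]
        by (intro mult_left_mono) (cases "snd p = 0", auto simp: upper_disk_def)
      show "norm p * \<rho> p < norm p * D \<beta> p" if "p \<in> {p. norm p < 1 \<and> 0 < snd p \<and> 0 < l \<beta> p}" for p
      proof -
        have "0 < norm p" using that by (auto simp: zero_less_norm_iff)
        then show ?thesis using that notgood[OF ng _ \<beta>, of p] by simp
      qed
      show "(\<integral>\<^sup>+ p. ennreal (norm p * \<rho> p) * indicator upper_disk p \<partial>lborel) < \<infinity>"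
        using v(1) unfolding U_def by simp
    qed (auto simp: upper_disk_def rho0)
    then show False using le by simp
  qed
  \<comment> \<open>If even the wedge density with \<open>\<beta> = pi / 2\<close>, which is symmetric in the axis, has at most the mass of \<open>\<rho>\<close>, then
    the upper half has at least half of the mass, and \<open>c \<le> 1 / 2\<close>. Otherwise some \<open>\<beta> < pi / 2\<close> gives equal
    masses.\<close>
  show ?thesis
  proof (cases "k ^ m * sin_pow_int m (pi / 2) / (real m + 3) \<le> v")
    case True
    have h: "0 < pi / 2" "pi / 2 \<le> pi / 2" by auto
    have D2: "U ?n (D (pi/2)) \<le> ennreal (k ^ m * sin_pow_int m (pi / 2) / (real m + 3))"
      unfolding U_def D_def using wedge_density_right_angle_mass[OF m, of k] k by simp
    then have D3: "U ?n (D (pi/2)) \<le> U ?n \<rho>" using True v by (metis ennreal_leI order_trans)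
    then obtain q where q: "good (pi/2) q" using ex_good[OF h] by auto
    have "L ?n \<rho> \<le> L ?n (D (pi/2))"
      unfolding L_def using below[OF lower[OF q h] h]
      by (intro nn_integral_mono) (auto simp: indicator_def lower_disk_def intro!: ennreal_leI mult_left_mono)
    also have "\<dots> = U ?n (D (pi/2))"
      unfolding L_def U_def by (rule nn_integral_swap_lower_upper_disk) (auto simp: D_def wedge_density_def norm_Pair)
    also have "\<dots> \<le> U ?n \<rho>" by (rule D3)
    finally have "v' \<le> v" using v v' by simp
    then have "c * (v + v') \<le> 1 / 2 * (2 * v)" using c0 c2 v v' by (intro mult_mono) auto
    then show ?thesis by (intro goal) simp
  next
    case False
    define G where "G \<beta> = (k / sin \<beta>) ^ m * sin_pow_int m \<beta> / (real m + 3)" for \<beta>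
    \<comment> \<open>The mass \<open>G \<beta>\<close> is at most \<open>k ^ m * \<beta>\<close>, so it is at most \<open>v\<close> for \<open>\<beta> = b0\<close>.\<close>
    define b0 where "b0 = min (pi / 2) (v / k ^ m)"
    have b0: "0 < b0" "b0 \<le> pi / 2" using v k unfolding b0_def by (simp, intro min.cobounded1)
    have s_pos: "0 < sin \<beta>" if "b0 \<le> \<beta>" "\<beta> \<le> pi / 2" for \<beta>
      using that b0 by (intro sin_gt_zero) auto
    have "G b0 \<le> v"
    proof -
      have "(k / sin b0) ^ m * sin_pow_int m b0 \<le> (k / sin b0) ^ m * (b0 * sin b0 ^ m)"
        using b0 k s_pos[of b0] by (intro mult_left_mono sin_pow_int_le zero_le_power) auto
      also have "\<dots> = k ^ m * b0" using s_pos[of b0] b0 by (simp add: power_divide)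
      also have "\<dots> \<le> v"
      proof -
        have "b0 \<le> v / k ^ m" by (simp add: b0_def)
        then show ?thesis using k by (simp add: field_simps)
      qed
      finally have "G b0 \<le> v / (real m + 3)" unfolding G_def by (rule divide_right_mono) simp
      also have "\<dots> \<le> v / 1" using v by (intro divide_left_mono) auto
      finally show ?thesis by simp
    qed
    moreover have "v \<le> G (pi / 2)" using False by (simp add: G_def)
    moreover have "continuous_on {b0..pi/2} G"
    proof -
      have "continuous_on {b0..pi/2} (sin_pow_int m)"
        using continuous_on_sin_pow_int[of "pi / 2"] by (rule continuous_on_subset) (use b0 in auto)
      moreover have "\<forall>\<beta>\<in>{b0..pi/2}. sin \<beta> \<noteq> 0" using s_pos by (metis atLeastAtMost_iff less_irrefl)
      ultimately show ?thesis unfolding G_def by (intro continuous_intros) auto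
    qed
    ultimately obtain \<beta> where \<beta>: "b0 \<le> \<beta>" "\<beta> \<le> pi / 2" "G \<beta> = v"
      using IVT'[of G b0 v "pi/2"] b0(2) by blast
    have "\<beta> \<noteq> pi / 2"
    proof
      assume "\<beta> = pi / 2"
      then have "v = G (pi / 2)" using \<beta>(3) by (simp only:)
      then have "v = k ^ m * sin_pow_int m (pi / 2) / (real m + 3)" unfolding G_def by simp
      then show False using False by simp
    qed
    then have \<beta>': "0 < \<beta>" "\<beta> < pi / 2" "\<beta> \<le> pi / 2" using \<beta> b0 by auto
    have sc: "0 < sin \<beta>" "0 < cos \<beta>" using \<beta>' by (auto intro!: sin_gt_zero cos_gt_zero_pi)
    define K where "K = k / sin \<beta>"
    have K: "0 < K" using k sc by (simp add: K_def)
    have UD: "U ?n (D \<beta>) = ennreal v"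
    proof -
      have "U ?n (D \<beta>) = ennreal (K ^ m * (sin_pow_int m (\<beta> - 0) - sin_pow_int m (\<beta> - \<beta>)) / (real m + 3))"
        unfolding U_def D_def wedge_density_upper_integral[OF m \<beta>'(1,2)] K_def[symmetric]
        using \<beta>' K by (intro wedge_density_mass) auto
      then show ?thesis using \<beta>(3) by (simp add: G_def K_def)
    qed
    have "\<exists>q. good \<beta> q" using ex_good[OF \<beta>'(1,3)] UD v by simp
    then obtain q0 where q0: "good \<beta> q0" by auto
    \<comment> \<open>A good point beyond the ray of angle \<open>\<beta>\<close> would make \<open>\<rho>\<close> larger than \<open>D \<beta>\<close> on the whole sector,
      against the equality of the masses.\<close>
    have good_l: "0 \<le> l \<beta> q" if q: "good \<beta> q" for q
    proof (rule ccontr)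
      assume neg: "\<not> ?thesis"
      then have neg1: "fst q * sin \<beta> < snd q * cos \<beta>"
        using k sc by (simp add: l_def zero_le_mult_iff zero_le_divide_iff not_le)
      have str: "l \<beta> q < \<psi> q" using neg q by (simp add: good_def)
      have btw: "snd p * fst q \<le> fst p * snd q" if p: "0 \<le> snd p" "0 \<le> l \<beta> p" for p
      proof -
        have p1: "snd p * cos \<beta> \<le> fst p * sin \<beta>" using p k sc by (simp add: l_def zero_le_mult_iff zero_le_divide_iff)
        have "0 \<le> snd p * cos \<beta>" using p sc by simp
        then have fp: "0 \<le> fst p" using p1 sc by (meson order_trans zero_le_mult_iff not_le order_less_imp_le)
        have sq: "0 < snd q" using q by (simp add: good_def)
        show ?thesis
        proof (cases "fst q \<le> 0")
          case True
          have "snd p * fst q \<le> 0" using True p by (simp add: mult_nonneg_nonpos)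
          also have "0 \<le> fst p * snd q" using fp sq by simp
          finally show ?thesis .
        next
          case False
          have "(snd p * fst q) * cos \<beta> = (snd p * cos \<beta>) * fst q" by simp
          also have "\<dots> \<le> (fst p * sin \<beta>) * fst q" using p1 False by (intro mult_right_mono) auto
          also have "\<dots> = fst p * (fst q * sin \<beta>)" by simp
          also have "\<dots> \<le> fst p * (snd q * cos \<beta>)" using neg1 fp by (intro mult_left_mono) auto
          finally have "(snd p * fst q) * cos \<beta> \<le> (fst p * snd q) * cos \<beta>" by (simp add: mult.assoc)
          then show ?thesis using sc by simp
        qed
      qed
      have "U ?n (D \<beta>) < U ?n \<rho>"
        unfolding U_def
      proof (rule strict_nn_integral_on_open[OF _ _ _ _ _ _ wedge_open wedge_ne[OF \<beta>'(1,3)]])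
        show "norm p * D \<beta> p \<le> norm p * \<rho> p" if "p \<in> upper_disk" for p
        proof (cases "p = 0 \<or> l \<beta> p < 0")
          case True
          then show ?thesis using m rho0[of p] by (auto simp: Dl[OF \<beta>'(1,3)] power_0_left)
        next
          case False
          then have "l \<beta> p \<le> \<psi> p" using that between[OF q \<beta>'(1,3), of p] btw[of p] by (auto simp: upper_disk_def)
          then show ?thesis by (intro mult_left_mono above \<beta>') auto
        qed
        show "norm p * D \<beta> p < norm p * \<rho> p" if p: "p \<in> {p. norm p < 1 \<and> 0 < snd p \<and> 0 < l \<beta> p}" for p
        proof -
          have p0: "0 < norm p" using p by (auto simp: zero_less_norm_iff)
          then have "l \<beta> p < \<psi> p" using p between[OF q \<beta>'(1,3), of p] btw[of p] str by auto
          then have "D \<beta> p < \<rho> p" using p m unfolding Dl[OF \<beta>'(1,3)] \<rho>_def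
            by (intro power_strict_mono) auto
          then show ?thesis using p0 by simp
        qed
        show "(\<integral>\<^sup>+ p. ennreal (norm p * D \<beta> p) * indicator upper_disk p \<partial>lborel) < \<infinity>"
          using UD unfolding U_def by simp
      qed (auto simp: upper_disk_def D_def K_def[symmetric] intro!: mult_nonneg_nonneg wedge_density_nonneg less_imp_le[OF K])
      then show False using UD v by simp
    qed
    have good_ratio: "0 < fst q \<and> snd q / fst q \<le> tan \<beta>" if q: "good \<beta> q" for q
    proof -
      have a: "snd q * cos \<beta> \<le> fst q * sin \<beta>" using good_l[OF q] k sc by (simp add: l_def zero_le_mult_iff zero_le_divide_iff)
      have "0 < snd q * cos \<beta>" using q sc by (simp add: good_def)
      then have "0 < fst q * sin \<beta>" using a by simp
      then have "0 < fst q" using sc by (simp add: zero_less_mult_iff)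
      then show ?thesis using a sc by (simp add: tan_def field_simps)
    qed
    \<comment> \<open>\<open>T\<close> is the slope, and \<open>S0\<close> the sine of the angle, at which \<open>\<rho>\<close> crosses \<open>D \<beta>\<close>.\<close>
    define ratios where "ratios = (\<lambda>q. snd q / fst q) ` Collect (good \<beta>)"
    define T where "T = Sup ratios"
    have bdd: "bdd_above ratios" using good_ratio by (auto simp: ratios_def intro!: bdd_aboveI[of _ "tan \<beta>"])
    have T_up: "snd q / fst q \<le> T" if "good \<beta> q" for q
      unfolding T_def using that bdd by (intro cSup_upper) (auto simp: ratios_def)
    have T0: "0 \<le> T"
    proof -
      have "0 \<le> snd q0 / fst q0" using q0 good_ratio[OF q0] by (auto simp: good_def)
      then show ?thesis using T_up[OF q0] by simp
    qed
    define S0 where "S0 = T / sqrt (1 + T\<^sup>2)"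
    have S0: "0 \<le> S0" using T0 by (simp add: S0_def)
    have nsq: "norm p = sqrt ((fst p)\<^sup>2 + (snd p)\<^sup>2)" for p :: "real \<times> real" by (cases p) (simp add: norm_Pair)
    \<comment> \<open>Both factors of \<open>(snd p - S0 * norm p) * (\<rho> p - D \<beta> p)\<close> change sign at the crossing, in opposite directions. The
      integrated inequality compares moments, since the masses cancel.\<close>
    have upper_pt: "snd p * \<rho> p + S0 * (norm p * D \<beta> p) \<le> snd p * D \<beta> p + S0 * (norm p * \<rho> p)" if p: "p \<in> upper_disk" for p
    proof -
      have "(snd p - S0 * norm p) * (\<rho> p - D \<beta> p) \<le> 0"
      proof (cases "snd p = 0")
        case True then show ?thesis using axis_eq[OF _ \<beta>'(1,3), of p] by simp
      next
        case False
        then have sp: "0 < snd p" using p by (simp add: upper_disk_def)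
        show ?thesis
        proof (cases "good \<beta> p")
          case True
          have f: "0 < fst p" using good_ratio[OF True] by simp
          then have "snd p \<le> T * fst p" using T_up[OF True] by (simp add: field_simps)
          then have "snd p \<le> S0 * norm p" unfolding S0_def nsq using ratio_le_iff_sine[OF f _ T0, of "snd p"] sp by simp
          moreover have "D \<beta> p \<le> \<rho> p" using True by (intro above \<beta>') (simp add: good_def)
          ultimately show ?thesis by (intro mult_nonpos_nonneg) auto
        next
          case ng: False
          have le: "\<rho> p \<le> D \<beta> p" using notgood[OF ng sp \<beta>'(1,3)] by simp
          show ?thesis
          proof (cases "0 < fst p")
            case True
            have "\<not> snd p / fst p < T"
            proof
              assume "snd p / fst p < T"
              moreover have "ratios \<noteq> {}" using q0 unfolding ratios_def by blast
              ultimately obtain r where "r \<in> ratios" "snd p / fst p < r"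
                using less_cSup_iff[OF _ bdd] unfolding T_def by blast
              then obtain q where q: "good \<beta> q" "snd p / fst p < snd q / fst q"
                unfolding ratios_def by blast
              have "snd p * fst q \<le> fst p * snd q" using q True good_ratio[OF q(1)] by (simp add: field_simps)
              moreover have "p \<noteq> 0" using sp by auto
              ultimately have "good \<beta> p" using between[OF q(1) \<beta>'(1,3), of p] sp by (simp add: good_def)
              then show False using ng by simp
            qed
            then have "T * fst p \<le> snd p" using True by (simp add: field_simps)
            then have "S0 * norm p \<le> snd p"
            proof (cases "snd p = T * fst p")
              case eq: True
              have "norm p = fst p * sqrt (1 + T\<^sup>2)"
                unfolding nsq eq using True by (simp add: power_mult_distrib real_sqrt_mult[symmetric] distrib_left distrib_right mult.commute real_sqrt_unique flip: real_sqrt_abs)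
              then show ?thesis unfolding S0_def eq by (simp add: add_pos_nonneg less_imp_neq[symmetric])
            next
              case False
              then have "\<not> snd p \<le> T * fst p" using \<open>T * fst p \<le> snd p\<close> by simp
              then show ?thesis unfolding S0_def nsq using ratio_le_iff_sine[OF True _ T0, of "snd p"] sp by simp
            qed
            then show ?thesis using le by (intro mult_nonneg_nonpos) auto
          next
            case False
            then have "fst p * sin \<beta> \<le> 0" "0 < snd p * cos \<beta>" using sc sp by (auto simp: mult_nonpos_nonneg)
            then have "fst p * sin \<beta> - snd p * cos \<beta> \<le> 0" by linarith
            then have "l \<beta> p \<le> 0" unfolding l_def using k sc by (intro mult_nonneg_nonpos) auto
            then have "D \<beta> p = 0" using m by (simp add: Dl[OF \<beta>'(1,3)])
            then have "\<rho> p = D \<beta> p" using le rho0[of p] by simp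
            then show ?thesis by simp
          qed
        qed
      qed
      then show ?thesis by (simp add: algebra_simps)
    qed
    have exch: "(\<integral>\<^sup>+ p. ennreal (a p) * indicator A p \<partial>lborel) + ennreal s * (\<integral>\<^sup>+ p. ennreal (b p) * indicator A p \<partial>lborel)
        \<le> (\<integral>\<^sup>+ p. ennreal (a' p) * indicator A p \<partial>lborel) + ennreal s * (\<integral>\<^sup>+ p. ennreal (b' p) * indicator A p \<partial>lborel)"
      if [measurable]: "a \<in> borel_measurable borel" "b \<in> borel_measurable borel" "a' \<in> borel_measurable borel" "b' \<in> borel_measurable borel" "A \<in> sets borel"
        and s: "0 \<le> s" and ab: "\<And>p. p \<in> A \<Longrightarrow> 0 \<le> a p \<and> 0 \<le> b p \<and> 0 \<le> a' p \<and> 0 \<le> b' p \<and> a p + s * b p \<le> a' p + s * b' p"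
      for a b a' b' :: "real \<times> real \<Rightarrow> real" and A s
    proof -
      have e: "(\<integral>\<^sup>+ p. ennreal (f p) * indicator A p \<partial>lborel) + ennreal s * (\<integral>\<^sup>+ p. ennreal (g p) * indicator A p \<partial>lborel)
          = (\<integral>\<^sup>+ p. ennreal (f p + s * g p) * indicator A p \<partial>lborel)"
        if [measurable]: "f \<in> borel_measurable borel" "g \<in> borel_measurable borel" and "\<And>p. p \<in> A \<Longrightarrow> 0 \<le> f p \<and> 0 \<le> g p" for f g :: "real \<times> real \<Rightarrow> real"
        using that s by (auto simp: nn_integral_cmult[symmetric] nn_integral_add[symmetric] indicator_def ennreal_plus ennreal_mult intro!: nn_integral_cong)
      show ?thesis
        using ab by (simp add: e) (intro nn_integral_mono, auto simp: indicator_def intro!: ennreal_leI)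
    qed
    have D0: "0 \<le> D \<beta> p" for p unfolding D_def K_def[symmetric] using K by (intro wedge_density_nonneg) simp
    have "U ?t \<rho> + ennreal S0 * U ?n (D \<beta>) \<le> U ?t (D \<beta>) + ennreal S0 * U ?n \<rho>"
      unfolding U_def
      by (rule exch) (use S0 upper_pt D0 rho0 in \<open>auto simp: upper_disk_def\<close>)
    then have UtU: "U ?t \<rho> \<le> U ?t (D \<beta>)"
      unfolding UD v(1) by (metis ennreal_add_left_cancel_le add.commute ennreal_mult_eq_top_iff ennreal_neq_top infinity_ennreal_def)

    \<comment> \<open>The comparison density in the lower half disk is \<open>D \<beta>\<close> restricted to angles at least \<open>- \<alpha>\<close>, with \<open>\<alpha> = \<gamma> - \<beta>\<close>
      chosen so that its moment equals that of \<open>D \<beta>\<close> in the upper half disk.\<close>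
    have "\<exists>\<gamma>. \<beta> \<le> \<gamma> \<and> \<gamma> \<le> 2 * \<beta> \<and> wedge_moment m \<beta> \<gamma> = 0"
    proof (rule IVT2')
      show "continuous_on {\<beta>..2 * \<beta>} (wedge_moment m \<beta>)"
        using continuous_on_wedge_moment[of "2 * \<beta>"] by (rule continuous_on_subset) (use \<beta>' in auto)
    qed (use \<beta>' wedge_moment_double_nonpos[of \<beta> m] wedge_moment_pos[of \<beta> m] in auto)
    then obtain \<gamma> where \<gamma>: "\<beta> \<le> \<gamma>" "\<gamma> \<le> 2 * \<beta>" "wedge_moment m \<beta> \<gamma> = 0" by auto
    have "\<gamma> \<noteq> \<beta>" using \<gamma>(3) wedge_moment_pos[of \<beta> m] \<beta>' by auto
    define \<alpha> where "\<alpha> = \<gamma> - \<beta>"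
    have \<alpha>: "0 < \<alpha>" "\<alpha> \<le> \<beta>" using \<gamma> \<open>\<gamma> \<noteq> \<beta>\<close> by (auto simp: \<alpha>_def)
    define E where "E p = D \<beta> p * indicator {p. 0 < fst p \<and> - (tan \<alpha> * fst p) \<le> snd p} p" for p
    have [measurable]: "E \<in> borel_measurable borel" unfolding E_def by measurable
    have E0: "0 \<le> E p" for p using D0 by (simp add: E_def)
    have LE: "L w E = (\<integral>\<^sup>+ p. ennreal (w p * wedge_density m K \<beta> p) * indicator (plane_wedge (- \<alpha>) 0) p \<partial>lborel)" for w
      unfolding L_def E_def D_def K_def
      by (intro nn_integral_cong) (auto simp: indicator_def plane_wedge_def lower_disk_def)
    have LnE: "L ?n E = ennreal (K ^ m * (sin_pow_int m \<gamma> - sin_pow_int m \<beta>) / (real m + 3))"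
      unfolding LE using wedge_density_mass[of K \<beta> "- \<alpha>" 0 m] \<alpha> \<beta>' K by (simp add: \<alpha>_def)
    have LtE: "L ?t E = ennreal (K ^ m * wedge_moment m \<beta> \<beta> / (real m + 3))"
    proof -
      have "\<bar>sin \<phi>\<bar> = - 1 * sin \<phi>" if "- \<alpha> \<le> \<phi>" "\<phi> \<le> 0" for \<phi>
        using sin_ge_zero[of "- \<phi>"] that \<alpha> \<beta>' by simp
      then show ?thesis
        unfolding LE using wedge_density_moment[of K \<beta> "- \<alpha>" 0 "- 1" m] \<alpha> \<beta>' K \<gamma>(3) by (simp add: \<alpha>_def)
    qed
    have UtD: "U ?t (D \<beta>) = ennreal (K ^ m * wedge_moment m \<beta> \<beta> / (real m + 3))"
    proof -
      have "\<bar>sin \<phi>\<bar> = 1 * sin \<phi>" if "0 \<le> \<phi>" "\<phi> \<le> \<beta>" for \<phi>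
        using sin_ge_zero[of "\<phi>"] that \<beta>' by simp
      then show ?thesis
        unfolding U_def D_def K_def[symmetric] wedge_density_upper_integral[OF m \<beta>'(1,2)]
        using wedge_density_moment[of K \<beta> 0 \<beta> 1 m] \<beta>' K by (simp add: wedge_moment_def)
    qed
    define S1 where "S1 = sin \<alpha>"
    have S1: "0 < S1" unfolding S1_def using \<alpha> \<beta>' by (intro sin_gt_zero) auto
    have ca: "0 < cos \<alpha>" using \<alpha> \<beta>' by (intro cos_gt_zero_pi) auto
    have ta0: "0 \<le> tan \<alpha>" using S1 ca by (simp add: tan_def S1_def)
    have ta: "0 \<le> tan \<alpha>" "tan \<alpha> \<le> tan \<beta>"
      using ta0 \<alpha> \<beta>' tan_monotone[of \<alpha> \<beta>] by (auto simp: order_le_less)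
    have S1_tan: "S1 = tan \<alpha> / sqrt (1 + (tan \<alpha>)\<^sup>2)"
    proof -
      have "1 + (tan \<alpha>)\<^sup>2 = 1 / (cos \<alpha>)\<^sup>2" using ca tan_sec[of \<alpha>] by (simp add: power_divide power_inverse inverse_eq_divide)
      then have "sqrt (1 + (tan \<alpha>)\<^sup>2) = 1 / cos \<alpha>" using ca by (simp add: real_sqrt_divide)
      then show ?thesis using ca by (simp add: S1_def tan_def)
    qed
    \<comment> \<open>Inside the sector \<open>\<rho>\<close> is at most \<open>E\<close>, outside it \<open>E\<close> vanishes, and \<open>- snd p - S1 * norm p\<close> changes sign
      on its boundary.\<close>
    have lower_pt: "- snd p * E p + S1 * (norm p * \<rho> p) \<le> - snd p * \<rho> p + S1 * (norm p * E p)" if p: "p \<in> lower_disk" for p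
    proof -
      have sp: "0 \<le> - snd p" using p by (simp add: lower_disk_def)
      have leD: "\<rho> p \<le> D \<beta> p" using p by (intro below lower[OF q0] \<beta>') (auto simp: lower_disk_def)
      have "0 \<le> (- snd p - S1 * norm p) * (\<rho> p - E p)"
      proof (cases "0 < fst p \<and> - (tan \<alpha> * fst p) \<le> snd p")
        case True
        then have "- snd p \<le> S1 * norm p"
          unfolding S1_tan nsq using ratio_le_iff_sine[of "fst p" "- snd p" "tan \<alpha>"] sp ta by simp
        moreover have "\<rho> p \<le> E p" using leD True by (simp add: E_def)
        ultimately show ?thesis by (intro mult_nonpos_nonpos) auto
      next
        case out: False
        then have Ep: "E p = 0" by (simp add: E_def)
        show ?thesis
        proof (cases "\<rho> p = 0")
          case False
          have "S1 * norm p \<le> - snd p"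
          proof (cases "0 < fst p")
            case True
            then have "\<not> - snd p \<le> tan \<alpha> * fst p" using out by auto
            then show ?thesis
              unfolding S1_tan nsq using ratio_le_iff_sine[of "fst p" "- snd p" "tan \<alpha>"] sp ta True by simp
          next
            case fp: False
            have "0 < l \<beta> p"
            proof (rule ccontr)
              assume "\<not> ?thesis"
              then have "D \<beta> p = 0" using m by (simp add: Dl[OF \<beta>'(1,3)])
              then show False using leD rho0[of p] \<open>\<rho> p \<noteq> 0\<close> by simp
            qed
            then have "- fst p * sin \<beta> < - snd p * cos \<beta>" using k sc by (simp add: l_def zero_less_mult_iff zero_less_divide_iff)
            then have b1: "- fst p * tan \<beta> < - snd p" using sc by (simp add: tan_def field_simps)
            have "tan \<alpha> * (- fst p) \<le> tan \<beta> * (- fst p)" using ta fp by (intro mult_right_mono) auto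
            then have b2: "tan \<alpha> * (- fst p) < - snd p" using b1 by (simp add: mult.commute)
            show ?thesis
            proof (cases "fst p = 0")
              case True
              then have "norm p = - snd p" using sp by (simp add: nsq)
              moreover have "S1 \<le> 1" by (simp add: S1_def)
              ultimately show ?thesis using sp mult_right_mono[of S1 1 "- snd p"] by simp
            next
              case False
              then have "0 < - fst p" using fp by simp
              then show ?thesis
                unfolding S1_tan nsq using ratio_le_iff_sine[of "- fst p" "- snd p" "tan \<alpha>"] sp ta b2 by simp
            qed
          qed
          then show ?thesis using Ep rho0[of p] by simp
        qed (simp add: Ep)
      qed
      then show ?thesis by (simp add: algebra_simps)
    qed
    have "L ?t E + ennreal S1 * L ?n \<rho> \<le> L ?t \<rho> + ennreal S1 * L ?n E"
      unfolding L_def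
      by (rule exch) (use S1 lower_pt E0 rho0 in \<open>auto simp: lower_disk_def mult_nonpos_nonneg\<close>)
    also have "\<dots> \<le> L ?t E + ennreal S1 * L ?n E"
      using mom' UtU unfolding LtE UtD[symmetric] by (intro add_right_mono) simp
    finally have "ennreal S1 * L ?n \<rho> \<le> ennreal S1 * L ?n E"
      unfolding LtE by (metis ennreal_add_left_cancel_le ennreal_neq_top infinity_ennreal_def)
    moreover have Idiff: "0 \<le> sin_pow_int m \<gamma> - sin_pow_int m \<beta>"
      using sin_pow_int_strict_mono[of \<beta> \<gamma> m] \<gamma> \<beta>' by (cases "\<beta> = \<gamma>") auto
    ultimately have "S1 * v' \<le> S1 * (K ^ m * (sin_pow_int m \<gamma> - sin_pow_int m \<beta>) / (real m + 3))"
      unfolding v'(1) LnE using S1 v'(2) K by (simp add: ennreal_mult[symmetric] del: ennreal_mult)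
    then have v'_le: "v' \<le> K ^ m * (sin_pow_int m \<gamma> - sin_pow_int m \<beta>) / (real m + 3)" using S1 by (simp only: mult_le_cancel_left_pos)
    have v_eq: "v = K ^ m * sin_pow_int m \<beta> / (real m + 3)" using \<beta>(3) by (simp add: G_def K_def)
    have "v + v' \<le> K ^ m * sin_pow_int m \<gamma> / (real m + 3)"
      using add_left_mono[OF v'_le, of v]
      by (simp add: v_eq add_divide_distrib[symmetric] right_diff_distrib)
    then have "c * (v + v') \<le> c * (K ^ m * sin_pow_int m \<gamma> / (real m + 3))" using c0 by (rule mult_left_mono)
    also have "\<dots> = K ^ m / (real m + 3) * (c * sin_pow_int m \<gamma>)" by simp
    also have "\<dots> \<le> K ^ m / (real m + 3) * sin_pow_int m \<beta>"
      using sin_wedge_mass_ratio[OF m \<beta>'(1,2) \<gamma>(1,2)] \<gamma>(3) K unfolding c_def wedge_moment_def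
      by (intro mult_left_mono) auto
    also have "\<dots> = v" unfolding v_eq by simp
    finally show ?thesis by (rule goal)
  qed
qed

section \<open>Coordinates adapted to two linear functionals\<close>

lemma nn_integral_PiM_scale:
  fixes f :: "('i \<Rightarrow> real) \<Rightarrow> ennreal"
  assumes "finite I" and c: "0 < c" and "f \<in> borel_measurable (PiM I (\<lambda>_. lborel))"
  shows "ennreal (c ^ card I) * integral\<^sup>N (PiM I (\<lambda>_. lborel)) (\<lambda>x. f (\<lambda>i\<in>I. c * x i)) = integral\<^sup>N (PiM I (\<lambda>_. lborel)) f"
  using assms(1,3)
proof (induction I arbitrary: f rule: finite_induct)
  case empty
  show ?case by (simp add: restrict_def PiM_empty nn_integral_count_space_finite)
next
  case (insert i I)
  interpret product_sigma_finite "\<lambda>_::'i. lborel :: real measure" ..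
  interpret I: sigma_finite_measure "PiM I (\<lambda>_. lborel :: real measure)"
    by (rule sigma_finite) (rule insert.hyps)
  note [measurable] = insert.prems
  have m1: "(\<lambda>x. f (x(i := y))) \<in> borel_measurable (PiM I (\<lambda>_. lborel))" for y by measurable
  have m2: "(\<lambda>y. \<integral>\<^sup>+ x. f (x(i := y)) \<partial>(PiM I (\<lambda>_. lborel))) \<in> borel_measurable borel" by measurable
  have m4: "(\<lambda>x. \<lambda>i\<in>I. c * x i) \<in> measurable (PiM I (\<lambda>_. lborel)) (PiM I (\<lambda>_. lborel))" by measurable
  have m5: "(\<lambda>x. f (\<lambda>j\<in>insert i I. c * x j)) \<in> borel_measurable (PiM (insert i I) (\<lambda>_. lborel))" by measurable
  have "integral\<^sup>N (PiM (insert i I) (\<lambda>_. lborel)) (\<lambda>x. f (\<lambda>j\<in>insert i I. c * x j))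
      = (\<integral>\<^sup>+ y. (\<integral>\<^sup>+ x. f (\<lambda>j\<in>insert i I. c * (x(i := y)) j) \<partial>(PiM I (\<lambda>_. lborel))) \<partial>lborel)"
    by (rule product_nn_integral_insert_rev) (use insert.hyps m5 in auto)
  also have "\<dots> = (\<integral>\<^sup>+ y. (\<integral>\<^sup>+ x. f ((\<lambda>j\<in>I. c * x j)(i := c * y)) \<partial>(PiM I (\<lambda>_. lborel))) \<partial>lborel)"
  proof (intro nn_integral_cong arg_cong[where f = f])
    fix y x
    show "(\<lambda>j\<in>insert i I. c * (x(i := y)) j) = (\<lambda>j\<in>I. c * x j)(i := c * y)"
      using insert.hyps by (auto simp: fun_eq_iff restrict_def)
  qed
  finally have "ennreal (c ^ card (insert i I)) * integral\<^sup>N (PiM (insert i I) (\<lambda>_. lborel)) (\<lambda>x. f (\<lambda>j\<in>insert i I. c * x j))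
    = ennreal c * (ennreal (c ^ card I) * (\<integral>\<^sup>+ y. (\<integral>\<^sup>+ x. f ((\<lambda>j\<in>I. c * x j)(i := c * y)) \<partial>(PiM I (\<lambda>_. lborel))) \<partial>lborel))"
    using insert.hyps c by (simp add: ennreal_mult mult.assoc)
  also have "ennreal (c ^ card I) * (\<integral>\<^sup>+ y. (\<integral>\<^sup>+ x. f ((\<lambda>j\<in>I. c * x j)(i := c * y)) \<partial>(PiM I (\<lambda>_. lborel))) \<partial>lborel)
    = (\<integral>\<^sup>+ y. ennreal (c ^ card I) * (\<integral>\<^sup>+ x. f ((\<lambda>j\<in>I. c * x j)(i := c * y)) \<partial>(PiM I (\<lambda>_. lborel))) \<partial>lborel)"
    by (rule nn_integral_cmult[symmetric]) (use m4 in measurable)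
  also have "\<dots> = (\<integral>\<^sup>+ y. (\<integral>\<^sup>+ x. f (x(i := c * y)) \<partial>(PiM I (\<lambda>_. lborel))) \<partial>lborel)"
    by (intro nn_integral_cong insert.IH[OF m1])
  also have "ennreal c * (\<integral>\<^sup>+ y. (\<integral>\<^sup>+ x. f (x(i := c * y)) \<partial>(PiM I (\<lambda>_. lborel))) \<partial>lborel)
    = (\<integral>\<^sup>+ y. (\<integral>\<^sup>+ x. f (x(i := y)) \<partial>(PiM I (\<lambda>_. lborel))) \<partial>lborel)"
    using nn_integral_real_affine[OF m2, of c 0] c by simp
  also have "\<dots> = integral\<^sup>N (PiM (insert i I) (\<lambda>_. lborel)) f"
    by (rule product_nn_integral_insert_rev[symmetric]) (use insert.hyps insert.prems in auto)
  finally show ?case .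
qed

text \<open>
  Two of the standard coordinates are exchanged for the functionals \<open>x \<bullet> w\<close> and \<open>x \<bullet> u\<close> by one affine substitution
  each, and \<open>c\<close> is the product of the two Jacobians. The other coordinates are kept, so that the fibres carry a product
  measure, as in \<open>prekopa_leindler_PiM\<close>.
\<close>

lemma ex_adapted_coordinates:
  fixes u w :: "'a::euclidean_space"
  assumes u: "u \<noteq> 0" and ind: "\<And>k. w \<noteq> k *\<^sub>R u"
  obtains J :: "'a set" and X :: "real \<Rightarrow> real \<Rightarrow> ('a \<Rightarrow> real) \<Rightarrow> 'a" and c :: real
  where "finite J" "J \<subseteq> Basis" "card J + 2 = DIM('a)" "0 < c"
    "\<And>s t z. X s t z \<bullet> u = t" "\<And>s t z. X s t z \<bullet> w = s" "\<And>s t z j. j \<in> J \<Longrightarrow> X s t z \<bullet> j = z j"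
    "\<And>a b s t z s' t' z'. X (a * s + b * s') (a * t + b * t') (\<lambda>j\<in>J. a * z j + b * z' j) = a *\<^sub>R X s t z + b *\<^sub>R X s' t' z'"
    "(\<lambda>(s, t, z). X s t z) \<in> borel_measurable (lborel \<Otimes>\<^sub>M (lborel \<Otimes>\<^sub>M PiM J (\<lambda>_. lborel)))"
    "\<And>f. f \<in> borel_measurable borel \<Longrightarrow> (\<integral>\<^sup>+ x. f x \<partial>lborel) = ennreal c * (\<integral>\<^sup>+ s. \<integral>\<^sup>+ t. \<integral>\<^sup>+ z. f (X s t z) \<partial>(PiM J (\<lambda>_. lborel)) \<partial>lborel \<partial>lborel)"
proof -
  obtain b1 where b1: "b1 \<in> Basis" "u \<bullet> b1 \<noteq> 0" using u by (meson euclidean_all_zero_iff)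
  define k where "k = (w \<bullet> b1) / (u \<bullet> b1)"
  \<comment> \<open>Subtracting a multiple of \<open>u\<close> removes the coordinate \<open>b1\<close>, so the substitutions for \<open>b2\<close> and for \<open>b1\<close> can be made one
    after the other.\<close>
  define v where "v = w - k *\<^sub>R u"
  have "v \<noteq> 0" using ind[of k] by (simp add: v_def)
  then obtain b2 where b2: "b2 \<in> Basis" "v \<bullet> b2 \<noteq> 0" by (meson euclidean_all_zero_iff)
  have vb1: "v \<bullet> b1 = 0" using b1 by (simp add: v_def k_def inner_diff_left)
  have b12: "b1 \<noteq> b2" using vb1 b2 by auto
  define J where "J = Basis - {b1, b2}"
  have J: "finite J" "b1 \<notin> J" "b2 \<notin> J" "J \<subseteq> Basis" by (auto simp: J_def)
  have Basis_eq: "Basis = insert b1 (insert b2 J)" using b1 b2 by (auto simp: J_def)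
  define x2 where "x2 s t z = (s - k * t - (\<Sum>j\<in>J. z j * (v \<bullet> j))) / (v \<bullet> b2)" for s t :: real and z
  define x1 where "x1 t y z = (t - y * (u \<bullet> b2) - (\<Sum>j\<in>J. z j * (u \<bullet> j))) / (u \<bullet> b1)" for t y :: real and z
  define Y where "Y a b z = a *\<^sub>R b1 + b *\<^sub>R b2 + (\<Sum>j\<in>J. z j *\<^sub>R j)" for a b :: real and z :: "'a \<Rightarrow> real"
  define X where "X s t z = Y (x1 t (x2 s t z) z) (x2 s t z) z" for s t z
  have inner_Y: "Y a b z \<bullet> q = a * (q \<bullet> b1) + b * (q \<bullet> b2) + (\<Sum>j\<in>J. z j * (q \<bullet> j))" for a b z q
    by (simp add: Y_def inner_add_left inner_sum_left inner_commute[of q])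
  have Xu: "X s t z \<bullet> u = t" for s t z
    using b1 by (simp add: X_def inner_Y x1_def)
  have Xv: "X s t z \<bullet> v = s - k * t" for s t z
    using b2 vb1 by (simp add: X_def inner_Y x2_def)
  have Xw: "X s t z \<bullet> w = s" for s t z
    using Xv[of s t z] Xu[of s t z] by (simp add: v_def inner_diff_right)
  have Xj: "X s t z \<bullet> j = z j" if "j \<in> J" for s t z j
  proof -
    have "(\<Sum>i\<in>J. z i * (j \<bullet> i)) = (\<Sum>i\<in>J. if i = j then z i else 0)"
      using that J by (intro sum.cong) (auto simp: inner_Basis J(4)[THEN subsetD])
    also have "\<dots> = z j" using that J by simp
    moreover have "j \<bullet> b1 = 0" "j \<bullet> b2 = 0"
      using that b1(1) b2(1) J by (auto intro!: inner_not_same_Basis)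
    ultimately show ?thesis by (simp add: X_def inner_Y)
  qed
  have det: "x = y" if "x \<bullet> u = y \<bullet> u" "x \<bullet> w = y \<bullet> w" "\<And>j. j \<in> J \<Longrightarrow> x \<bullet> j = y \<bullet> j" for x y :: 'a
  proof -
    define d where "d = x - y"
    have d: "d \<bullet> u = 0" "d \<bullet> w = 0" "\<And>j. j \<in> J \<Longrightarrow> d \<bullet> j = 0" using that by (auto simp: d_def inner_diff_left)
    have dv: "d \<bullet> v = 0" using d by (simp add: v_def inner_diff_right)
    have rep: "d \<bullet> q = (d \<bullet> b1) * (q \<bullet> b1) + (d \<bullet> b2) * (q \<bullet> b2)" for q
    proof -
      have "d \<bullet> q = (\<Sum>b\<in>Basis. (d \<bullet> b) * (q \<bullet> b))" by (rule euclidean_inner)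
      also have "\<dots> = (d \<bullet> b1) * (q \<bullet> b1) + ((d \<bullet> b2) * (q \<bullet> b2) + (\<Sum>b\<in>J. (d \<bullet> b) * (q \<bullet> b)))"
        unfolding Basis_eq using J b12 by simp
      also have "(\<Sum>b\<in>J. (d \<bullet> b) * (q \<bullet> b)) = 0" using d by (intro sum.neutral) auto
      finally show ?thesis by simp
    qed
    have "d \<bullet> b2 = 0" using rep[of v] dv vb1 b2 by simp
    moreover have "d \<bullet> b1 = 0" using rep[of u] d \<open>d \<bullet> b2 = 0\<close> b1 by simp
    ultimately have "d \<bullet> q = 0" for q using rep[of q] by simp
    then have "d = 0" using inner_eq_zero_iff by blast
    then show ?thesis by (simp add: d_def)
  qed
  have lin: "X (a * s + b * s') (a * t + b * t') (\<lambda>j\<in>J. a * z j + b * z' j) = a *\<^sub>R X s t z + b *\<^sub>R X s' t' z'" for a b s t z s' t' z'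
    by (rule det) (auto simp: Xu Xw Xj inner_add_left)
  have meas: "(\<lambda>(s, t, z). X s t z) \<in> borel_measurable (lborel \<Otimes>\<^sub>M (lborel \<Otimes>\<^sub>M PiM J (\<lambda>_. lborel)))"
    unfolding X_def Y_def x1_def x2_def case_prod_beta by measurable
  define c where "c = (1 / \<bar>u \<bullet> b1\<bar>) * (1 / \<bar>v \<bullet> b2\<bar>)"
  have c: "0 < c" using b1 b2 by (simp add: c_def)
  interpret product_sigma_finite "\<lambda>_::'a. lborel :: real measure" ..
  interpret J: sigma_finite_measure "PiM J (\<lambda>_. lborel :: real measure)" by (rule sigma_finite) (rule J(1))
  interpret J2: sigma_finite_measure "PiM (insert b2 J) (\<lambda>_. lborel :: real measure)" by (rule sigma_finite) (use J in simp)
  interpret P: pair_sigma_finite "lborel :: real measure" "PiM J (\<lambda>_. lborel :: real measure)" ..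
  interpret P2: pair_sigma_finite "lborel :: real measure" "PiM (insert b2 J) (\<lambda>_. lborel :: real measure)" ..
  have aff: "(\<integral>\<^sup>+ y. g y \<partial>lborel) = ennreal (1 / \<bar>d\<bar>) * (\<integral>\<^sup>+ t. g ((t - e) / d) \<partial>lborel)"
    if [measurable]: "g \<in> borel_measurable borel" and d: "d \<noteq> 0" for g :: "real \<Rightarrow> ennreal" and d e
  proof -
    have "(\<integral>\<^sup>+ y. g y \<partial>lborel) = ennreal \<bar>1 / d\<bar> * (\<integral>\<^sup>+ t. g (- e / d + (1 / d) * t) \<partial>lborel)"
      using d by (intro nn_integral_real_affine) auto
    also have "(\<lambda>t. - e / d + (1 / d) * t) = (\<lambda>t. (t - e) / d)" using d by (auto simp: field_simps)
    finally show ?thesis by simp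
  qed
  have int: "(\<integral>\<^sup>+ x. f x \<partial>lborel) = ennreal c * (\<integral>\<^sup>+ s. \<integral>\<^sup>+ t. \<integral>\<^sup>+ z. f (X s t z) \<partial>(PiM J (\<lambda>_. lborel)) \<partial>lborel \<partial>lborel)"
    if [measurable]: "f \<in> borel_measurable borel" for f :: "'a \<Rightarrow> ennreal"
  proof -
    define F where "F = (\<lambda>x. f (\<Sum>b\<in>Basis. x b *\<^sub>R b))"
    have [measurable]: "F \<in> borel_measurable (PiM (insert b1 (insert b2 J)) (\<lambda>_. lborel))"
      unfolding F_def Basis_eq by measurable
    have FY: "F (z(b2 := y2, b1 := y1)) = f (Y y1 y2 z)" for z y1 y2
    proof -
      have "(\<Sum>b\<in>Basis. (z(b2 := y2, b1 := y1)) b *\<^sub>R b) = y1 *\<^sub>R b1 + (y2 *\<^sub>R b2 + (\<Sum>b\<in>J. (z(b2 := y2, b1 := y1)) b *\<^sub>R b))"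
        unfolding Basis_eq using J b12 by simp
      also have "(\<Sum>b\<in>J. (z(b2 := y2, b1 := y1)) b *\<^sub>R b) = (\<Sum>b\<in>J. z b *\<^sub>R b)"
        using J by (intro sum.cong) auto
      finally show ?thesis by (simp only: F_def Y_def add.assoc)
    qed
    have "(\<integral>\<^sup>+ x. f x \<partial>lborel) = integral\<^sup>N (PiM (insert b1 (insert b2 J)) (\<lambda>_. lborel)) F"
      by (subst lborel_eq) (simp add: nn_integral_distr F_def Basis_eq[symmetric])
    also have "\<dots> = (\<integral>\<^sup>+ x. \<integral>\<^sup>+ y. F (x(b1 := y)) \<partial>lborel \<partial>(PiM (insert b2 J) (\<lambda>_. lborel)))"
      by (rule product_nn_integral_insert) (use J b12 in auto)
    also have "\<dots> = (\<integral>\<^sup>+ x. ennreal (1 / \<bar>u \<bullet> b1\<bar>) * (\<integral>\<^sup>+ t. F (x(b1 := x1 t (x b2) x)) \<partial>lborel) \<partial>(PiM (insert b2 J) (\<lambda>_. lborel)))"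
    proof (rule nn_integral_cong)
      fix x assume "x \<in> space (PiM (insert b2 J) (\<lambda>_. lborel :: real measure))"
      then have "(\<lambda>y. F (x(b1 := y))) \<in> borel_measurable borel" by measurable
      from aff[OF this b1(2), of "x b2 * (u \<bullet> b2) + (\<Sum>j\<in>J. x j * (u \<bullet> j))"]
      show "(\<integral>\<^sup>+ y. F (x(b1 := y)) \<partial>lborel) = ennreal (1 / \<bar>u \<bullet> b1\<bar>) * (\<integral>\<^sup>+ t. F (x(b1 := x1 t (x b2) x)) \<partial>lborel)"
        by (simp add: x1_def diff_diff_eq)
    qed
    also have "\<dots> = ennreal (1 / \<bar>u \<bullet> b1\<bar>) * (\<integral>\<^sup>+ x. (\<integral>\<^sup>+ t. F (x(b1 := x1 t (x b2) x)) \<partial>lborel) \<partial>(PiM (insert b2 J) (\<lambda>_. lborel)))"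
      unfolding x1_def by (rule nn_integral_cmult) measurable
    also have "(\<integral>\<^sup>+ x. (\<integral>\<^sup>+ t. F (x(b1 := x1 t (x b2) x)) \<partial>lborel) \<partial>(PiM (insert b2 J) (\<lambda>_. lborel)))
        = (\<integral>\<^sup>+ t. (\<integral>\<^sup>+ x. F (x(b1 := x1 t (x b2) x)) \<partial>(PiM (insert b2 J) (\<lambda>_. lborel))) \<partial>lborel)"
      unfolding x1_def by (rule P2.Fubini') measurable
    also have "\<dots> = (\<integral>\<^sup>+ t. ennreal (1 / \<bar>v \<bullet> b2\<bar>) * (\<integral>\<^sup>+ s. \<integral>\<^sup>+ z. f (X s t z) \<partial>(PiM J (\<lambda>_. lborel)) \<partial>lborel) \<partial>lborel)"
    proof (rule nn_integral_cong)
      fix t :: real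
      have x1z: "x1 t y (z(b2 := y)) = x1 t y z" for y z
      proof -
        have "(\<Sum>j\<in>J. (z(b2 := y)) j * (u \<bullet> j)) = (\<Sum>j\<in>J. z j * (u \<bullet> j))"
          using J by (intro sum.cong) auto
        then show ?thesis by (simp only: x1_def)
      qed
      have [measurable]: "(\<lambda>(y, z). f (Y (x1 t y z) y z)) \<in> borel_measurable (lborel \<Otimes>\<^sub>M PiM J (\<lambda>_. lborel))"
        unfolding Y_def x1_def case_prod_beta by measurable
      have mX[measurable]: "(\<lambda>(s, z). f (X s t z)) \<in> borel_measurable (lborel \<Otimes>\<^sub>M PiM J (\<lambda>_. lborel))"
        unfolding X_def Y_def x1_def x2_def case_prod_beta by measurable
      have "(\<integral>\<^sup>+ x. F (x(b1 := x1 t (x b2) x)) \<partial>(PiM (insert b2 J) (\<lambda>_. lborel)))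
        = (\<integral>\<^sup>+ z. \<integral>\<^sup>+ y. F ((z(b2 := y))(b1 := x1 t ((z(b2 := y)) b2) (z(b2 := y)))) \<partial>lborel \<partial>(PiM J (\<lambda>_. lborel)))"
        by (rule product_nn_integral_insert) (use J in \<open>auto simp: x1_def\<close>, measurable)
      also have "\<dots> = (\<integral>\<^sup>+ z. \<integral>\<^sup>+ y. f (Y (x1 t y z) y z) \<partial>lborel \<partial>(PiM J (\<lambda>_. lborel)))"
        by (simp add: FY x1z Y_def fun_upd_same)
      also have "\<dots> = (\<integral>\<^sup>+ z. ennreal (1 / \<bar>v \<bullet> b2\<bar>) * (\<integral>\<^sup>+ s. f (X s t z) \<partial>lborel) \<partial>(PiM J (\<lambda>_. lborel)))"
      proof (rule nn_integral_cong)
        fix z :: "'a \<Rightarrow> real"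
        have "(\<lambda>y. f (Y (x1 t y z) y z)) \<in> borel_measurable borel"
          unfolding Y_def x1_def by measurable
        from aff[OF this b2(2), of "k * t + (\<Sum>j\<in>J. z j * (v \<bullet> j))"]
        show "(\<integral>\<^sup>+ y. f (Y (x1 t y z) y z) \<partial>lborel) = ennreal (1 / \<bar>v \<bullet> b2\<bar>) * (\<integral>\<^sup>+ s. f (X s t z) \<partial>lborel)"
          by (simp add: X_def x2_def diff_diff_eq)
      qed
      also have "\<dots> = ennreal (1 / \<bar>v \<bullet> b2\<bar>) * (\<integral>\<^sup>+ z. (\<integral>\<^sup>+ s. f (X s t z) \<partial>lborel) \<partial>(PiM J (\<lambda>_. lborel)))"
        by (rule nn_integral_cmult) (unfold X_def Y_def x1_def x2_def, measurable)
      also have "(\<integral>\<^sup>+ z. (\<integral>\<^sup>+ s. f (X s t z) \<partial>lborel) \<partial>(PiM J (\<lambda>_. lborel))) = (\<integral>\<^sup>+ s. \<integral>\<^sup>+ z. f (X s t z) \<partial>(PiM J (\<lambda>_. lborel)) \<partial>lborel)"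
        by (rule P.Fubini') (rule mX)
      finally show "(\<integral>\<^sup>+ x. F (x(b1 := x1 t (x b2) x)) \<partial>(PiM (insert b2 J) (\<lambda>_. lborel)))
         = ennreal (1 / \<bar>v \<bullet> b2\<bar>) * (\<integral>\<^sup>+ s. \<integral>\<^sup>+ z. f (X s t z) \<partial>(PiM J (\<lambda>_. lborel)) \<partial>lborel)" .
    qed
    also have "\<dots> = ennreal (1 / \<bar>v \<bullet> b2\<bar>) * (\<integral>\<^sup>+ t. (\<integral>\<^sup>+ s. \<integral>\<^sup>+ z. f (X s t z) \<partial>(PiM J (\<lambda>_. lborel)) \<partial>lborel) \<partial>lborel)"
      by (rule nn_integral_cmult) (unfold X_def Y_def x1_def x2_def, measurable)
    also have "(\<integral>\<^sup>+ t. (\<integral>\<^sup>+ s. \<integral>\<^sup>+ z. f (X s t z) \<partial>(PiM J (\<lambda>_. lborel)) \<partial>lborel) \<partial>lborel)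
       = (\<integral>\<^sup>+ s. \<integral>\<^sup>+ t. \<integral>\<^sup>+ z. f (X s t z) \<partial>(PiM J (\<lambda>_. lborel)) \<partial>lborel \<partial>lborel)"
      by (rule lborel_pair.Fubini'[symmetric]) (unfold X_def Y_def x1_def x2_def case_prod_beta, measurable)
    moreover have "ennreal c = ennreal (1 / \<bar>u \<bullet> b1\<bar>) * ennreal (1 / \<bar>v \<bullet> b2\<bar>)"
      unfolding c_def by (rule ennreal_mult) auto
    ultimately show ?thesis by (simp only: mult.assoc)
  qed
  have card: "card J + 2 = DIM('a)"
    unfolding Basis_eq using J b12 by simp
  show ?thesis by (rule that[OF J(1,4) card c Xu Xw Xj lin meas int]) auto
qed

section \<open>Cones weighted by a planar norm\<close>

lemma nn_integral_supported_on_axis: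
  fixes F :: "real \<times> real \<Rightarrow> ennreal"
  assumes [measurable]: "F \<in> borel_measurable borel" and z: "\<And>p. snd p \<noteq> 0 \<Longrightarrow> F p = 0"
  shows "(\<integral>\<^sup>+ p. F p \<partial>lborel) = 0"
proof -
  have "(\<integral>\<^sup>+ t. F (s, t) \<partial>lborel) = 0" for s
  proof -
    have "AE t in lborel. F (s, t) = 0"
      using AE_lborel_singleton[of "0::real"] by (rule eventually_mono) (simp add: z)
    then show ?thesis by (subst nn_integral_0_iff_AE) auto
  qed
  then show ?thesis by (simp add: nn_integral_lborel_pair)
qed

text \<open>
  Here the cone is cut off by the norm \<open>r\<close> of the projection to the plane of \<open>w\<close> and \<open>u\<close>, so that every integral is one
  over the half disks in that plane with the volume \<open>\<rho>\<close> of the fibre as density. The root \<open>\<psi>\<close> of order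
  \<open>m = DIM - 2\<close> of \<open>\<rho>\<close> is homogeneous because \<open>P\<close> is conic and superadditive because of the Prekopa-Leindler inequality,
  so \<open>planar_crossing_mass_ratio\<close> applies.
\<close>

lemma gauge_cone_mass_ratio:
  fixes P :: "'a::euclidean_space set" and u w :: 'a and C :: real
  defines "r \<equiv> \<lambda>x. norm (x \<bullet> w, x \<bullet> u)"
  assumes dim: "3 \<le> DIM('a)"
    and P: "closed P" "convex P" and conic: "\<And>x a. x \<in> P \<Longrightarrow> 0 < a \<Longrightarrow> a *\<^sub>R x \<in> P"
    and u: "u \<noteq> 0" and ind: "\<And>k. w \<noteq> k *\<^sub>R u"
    and bound: "\<And>x. x \<in> P \<Longrightarrow> norm x \<le> C * r x"
    and axis: "\<And>x. x \<in> P \<Longrightarrow> x \<bullet> u = 0 \<Longrightarrow> x \<noteq> 0 \<Longrightarrow> 0 < x \<bullet> w"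
    and pos: "0 < (\<integral>\<^sup>+ x. ennreal (r x) * indicator {x\<in>P. r x \<le> 1 \<and> 0 \<le> x \<bullet> u} x \<partial>lborel)"
    and mom: "(\<integral>\<^sup>+ x. ennreal \<bar>x \<bullet> u\<bar> * indicator {x\<in>P. r x \<le> 1 \<and> x \<bullet> u \<le> 0} x \<partial>lborel)
           \<le> (\<integral>\<^sup>+ x. ennreal \<bar>x \<bullet> u\<bar> * indicator {x\<in>P. r x \<le> 1 \<and> 0 \<le> x \<bullet> u} x \<partial>lborel)"
  shows "ennreal ((1 - 1 / real DIM('a)) ^ (DIM('a) - 1)) *
      ((\<integral>\<^sup>+ x. ennreal (r x) * indicator {x\<in>P. r x \<le> 1 \<and> 0 \<le> x \<bullet> u} x \<partial>lborel)
        + (\<integral>\<^sup>+ x. ennreal (r x) * indicator {x\<in>P. r x \<le> 1 \<and> x \<bullet> u \<le> 0} x \<partial>lborel))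
     \<le> (\<integral>\<^sup>+ x. ennreal (r x) * indicator {x\<in>P. r x \<le> 1 \<and> 0 \<le> x \<bullet> u} x \<partial>lborel)"
proof -
  obtain J :: "'a set" and X :: "real \<Rightarrow> real \<Rightarrow> ('a \<Rightarrow> real) \<Rightarrow> 'a" and c :: real
    where J: "finite J" "J \<subseteq> Basis" "card J + 2 = DIM('a)" and c: "0 < c"
    and Xu: "\<And>s t z. X s t z \<bullet> u = t" and Xw: "\<And>s t z. X s t z \<bullet> w = s" and Xj: "\<And>s t z j. j \<in> J \<Longrightarrow> X s t z \<bullet> j = z j"
    and lin: "\<And>a b s t z s' t' z'. X (a * s + b * s') (a * t + b * t') (\<lambda>j\<in>J. a * z j + b * z' j) = a *\<^sub>R X s t z + b *\<^sub>R X s' t' z'"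
    and mX: "(\<lambda>(s, t, z). X s t z) \<in> borel_measurable (lborel \<Otimes>\<^sub>M (lborel \<Otimes>\<^sub>M PiM J (\<lambda>_. lborel)))"
    and int: "\<And>f. f \<in> borel_measurable borel \<Longrightarrow> (\<integral>\<^sup>+ x. f x \<partial>lborel) = ennreal c * (\<integral>\<^sup>+ s. \<integral>\<^sup>+ t. \<integral>\<^sup>+ z. f (X s t z) \<partial>(PiM J (\<lambda>_. lborel)) \<partial>lborel \<partial>lborel)"
    by (rule ex_adapted_coordinates[OF u ind]) (rule that; assumption)
  define m where "m = card J"
  have m: "1 \<le> m" and dm: "DIM('a) = m + 2" using J(3) dim by (auto simp: m_def)
  have Jne: "J \<noteq> {}" using m by (auto simp: m_def)
  let ?M = "PiM J (\<lambda>_. lborel :: real measure)"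
  interpret product_sigma_finite "\<lambda>_::'a. lborel :: real measure" ..
  interpret J: sigma_finite_measure ?M by (rule sigma_finite) (rule J(1))
  have [measurable]: "P \<in> sets borel" using P(1) by simp
  have mXp[measurable]: "(\<lambda>q. X (fst (fst q)) (snd (fst q)) (snd q)) \<in> borel_measurable (borel \<Otimes>\<^sub>M ?M)"
  proof -
    have "(\<lambda>q. (fst (fst q), snd (fst q), snd q)) \<in> measurable ((borel :: (real \<times> real) measure) \<Otimes>\<^sub>M ?M) (lborel \<Otimes>\<^sub>M (lborel \<Otimes>\<^sub>M ?M))"
    proof -
      have a: "(\<lambda>q. fst (fst q)) \<in> borel_measurable ((borel :: (real \<times> real) measure) \<Otimes>\<^sub>M ?M)"
        by (rule measurable_compose[OF measurable_fst borel_measurable_fst_snd(1)])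
      have b: "(\<lambda>q. snd (fst q)) \<in> borel_measurable ((borel :: (real \<times> real) measure) \<Otimes>\<^sub>M ?M)"
        by (rule measurable_compose[OF measurable_fst borel_measurable_fst_snd(2)])
      show ?thesis
        using a b by (intro measurable_Pair measurable_snd) simp_all
    qed
    from measurable_compose[OF this mX] show ?thesis by simp
  qed
  have mXz[measurable]: "(\<lambda>z. X s t z) \<in> borel_measurable ?M" for s t
    using measurable_compose[OF measurable_Pair1' mXp, of "(s, t)"] by simp
  have mXind: "(\<lambda>z. indicator P (X s t z) :: ennreal) \<in> borel_measurable ?M" for s t
    by (rule measurable_compose[OF mXz]) simp
  define \<rho> where "\<rho> p = (\<integral>\<^sup>+ z. indicator P (X (fst p) (snd p) z) \<partial>?M)" for p
  have [measurable]: "\<rho> \<in> borel_measurable borel" unfolding \<rho>_def by measurable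
  have fibre_le: "\<rho> p \<le> ennreal ((2 * B) ^ m)" if B0: "0 \<le> B" and Bb: "\<And>z. X (fst p) (snd p) z \<in> P \<Longrightarrow> norm (X (fst p) (snd p) z) \<le> B" for p B
  proof -
    have "\<rho> p \<le> (\<integral>\<^sup>+ z. indicator (PiE J (\<lambda>_. {- B..B})) z \<partial>?M)"
      unfolding \<rho>_def
    proof (rule nn_integral_mono)
      fix z assume z: "z \<in> space ?M"
      have "z j \<in> {- B..B}" if X: "X (fst p) (snd p) z \<in> P" and j: "j \<in> J" for j
      proof -
        have "\<bar>X (fst p) (snd p) z \<bullet> j\<bar> \<le> norm (X (fst p) (snd p) z)"
          using j J(2) by (intro Basis_le_norm) auto
        then show ?thesis using Bb[OF X] Xj[OF j] by (auto simp: abs_le_iff)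
      qed
      then show "indicator P (X (fst p) (snd p) z) \<le> (indicator (PiE J (\<lambda>_. {- B..B})) z :: ennreal)"
        using z by (auto simp: indicator_def space_PiM PiE_def)
    qed
    also have "\<dots> = emeasure ?M (PiE J (\<lambda>_. {- B..B}))"
      by (rule nn_integral_indicator) (use J in \<open>auto intro!: sets_PiM_I_finite\<close>)
    also have "\<dots> = ennreal ((2 * B) ^ m)"
      using J B0 by (subst emeasure_PiM) (auto simp: m_def prod_constant ennreal_power)
    finally show ?thesis .
  qed
  have r_p: "norm (X (fst p) (snd p) z) \<le> \<bar>C\<bar> * norm p" if "X (fst p) (snd p) z \<in> P" for p z
  proof -
    have "norm (X (fst p) (snd p) z) \<le> C * norm p" using bound[OF that] by (simp add: r_def Xu Xw)
    also have "\<dots> \<le> \<bar>C\<bar> * norm p" by (intro mult_right_mono) auto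
    finally show ?thesis .
  qed
  have rho_fin: "\<rho> p < \<infinity>" for p
    by (rule le_less_trans[OF fibre_le[of "\<bar>C\<bar> * norm p" p]]) (use r_p[of p] in auto)
  define \<psi> where "\<psi> p = root m (enn2real (\<rho> p))" for p
  have psi_pow: "ennreal (\<psi> p ^ m) = \<rho> p" for p
    using m rho_fin[of p] by (simp add: \<psi>_def real_root_pow_pos2)
  have psi0: "0 \<le> \<psi> p" for p unfolding \<psi>_def by (intro real_root_ge_zero) simp
  have psi_eqI: "\<psi> p = y" if "0 \<le> y" "\<rho> p = ennreal (y ^ m)" for p y
    using that m by (simp add: \<psi>_def real_root_power_cancel)
  have psi_geI: "y \<le> \<psi> p" if "0 \<le> y" "ennreal (y ^ m) \<le> \<rho> p" for p y
  proof -
    have "ennreal (y ^ m) \<le> ennreal (\<psi> p ^ m)" using that by (simp add: psi_pow)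
    then have "y ^ m \<le> \<psi> p ^ m" using psi0 by (simp add: ennreal_le_iff)
    then show ?thesis using m that psi0 by (simp add: power_mono_iff)
  qed
  have rho_hom: "\<rho> (a *\<^sub>R p) = ennreal (a ^ m) * \<rho> p" if a: "0 < a" for a p
  proof -
    have "(\<lambda>z. indicator P (X (fst (a *\<^sub>R p)) (snd (a *\<^sub>R p)) z) :: ennreal) \<in> borel_measurable ?M"
      by (rule mXind)
    from nn_integral_PiM_scale[OF J(1) a this]
    have "\<rho> (a *\<^sub>R p) = ennreal (a ^ m) * (\<integral>\<^sup>+ z. indicator P (X (fst (a *\<^sub>R p)) (snd (a *\<^sub>R p)) (\<lambda>j\<in>J. a * z j)) \<partial>?M)"
      by (simp add: \<rho>_def m_def)
    also have "(\<integral>\<^sup>+ z. indicator P (X (fst (a *\<^sub>R p)) (snd (a *\<^sub>R p)) (\<lambda>j\<in>J. a * z j)) \<partial>?M) = \<rho> p"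
      unfolding \<rho>_def
    proof (rule nn_integral_cong)
      fix z
      have "X (fst (a *\<^sub>R p)) (snd (a *\<^sub>R p)) (\<lambda>j\<in>J. a * z j) = a *\<^sub>R X (fst p) (snd p) z"
        using lin[of a "fst p" 0 0 "snd p" 0 z z] by simp
      moreover have "a *\<^sub>R x \<in> P \<longleftrightarrow> x \<in> P" for x
        using conic[of x a] conic[of "a *\<^sub>R x" "1 / a"] a by auto
      ultimately show "(indicator P (X (fst (a *\<^sub>R p)) (snd (a *\<^sub>R p)) (\<lambda>j\<in>J. a * z j)) :: ennreal) = indicator P (X (fst p) (snd p) z)"
        by (simp add: indicator_def)
    qed
    finally show ?thesis .
  qed
  have psi_hom: "\<psi> (a *\<^sub>R p) = a * \<psi> p" if "0 < a" for a p
  proof (rule psi_eqI)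
    show "\<rho> (a *\<^sub>R p) = ennreal ((a * \<psi> p) ^ m)"
      unfolding rho_hom[OF that] psi_pow[symmetric, of p] power_mult_distrib
      using that psi0 by (intro ennreal_mult[symmetric]) auto
  qed (use that psi0 in simp)
  have psi_super: "\<psi> p + \<psi> q \<le> \<psi> (p + q)" if p: "0 < \<psi> p" and q: "0 < \<psi> q" for p q
  proof -
    define a where "a = \<psi> p"
    define b where "b = \<psi> q"
    have ab: "0 < a" "0 < b" using p q by (auto simp: a_def b_def)
    \<comment> \<open>Rescaled to \<open>p'\<close> and \<open>q'\<close>, both fibres have volume one. The fibre over the convex combination \<open>s\<close> then has volume at least one,
      and homogeneity turns this into superadditivity.\<close>
    define p' where "p' = (1 / a) *\<^sub>R p"
    define q' where "q' = (1 / b) *\<^sub>R q"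
    have unit: "\<rho> p' = 1" "\<rho> q' = 1"
    proof -
      have "\<psi> p' = 1" using psi_hom[of "1 / a" p] ab by (simp add: p'_def a_def)
      then show "\<rho> p' = 1" using psi_pow[of p'] by simp
      have "\<psi> q' = 1" using psi_hom[of "1 / b" q] ab by (simp add: q'_def b_def)
      then show "\<rho> q' = 1" using psi_pow[of q'] by simp
    qed
    define l where "l = a / (a + b)"
    have l: "0 < l" "l < 1" using ab by (auto simp: l_def)
    define s where "s = l *\<^sub>R p' + (1 - l) *\<^sub>R q'"
    have l': "1 - l = b / (a + b)" using ab by (simp add: l_def field_simps)
    have pq: "p + q = (a + b) *\<^sub>R s"
      using ab unfolding s_def l' p'_def q'_def by (simp add: scaleR_add_right l_def)
    have "ennreal (1 powr l * 1 powr (1 - l)) \<le> integral\<^sup>N ?M (\<lambda>z. indicator P (X (fst s) (snd s) z))"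
    proof (rule prekopa_leindler_PiM[OF J(1) l, where f = "\<lambda>z. indicator P (X (fst p') (snd p') z)" and g = "\<lambda>z. indicator P (X (fst q') (snd q') z)"])
      fix x y :: "'a \<Rightarrow> real" and \<alpha> \<beta> :: real
      assume al: "0 \<le> \<alpha>" "0 \<le> \<beta>" "ennreal \<alpha> \<le> indicator P (X (fst p') (snd p') x)" "ennreal \<beta> \<le> indicator P (X (fst q') (snd q') y)"
      show "ennreal (\<alpha> powr l * \<beta> powr (1 - l)) \<le> indicator P (X (fst s) (snd s) (\<lambda>i\<in>J. l * x i + (1 - l) * y i))"
      proof (cases "X (fst p') (snd p') x \<in> P \<and> X (fst q') (snd q') y \<in> P")
        case False
        then have "\<alpha> = 0 \<or> \<beta> = 0" using al by auto
        then show ?thesis by auto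
      next
        case True
        have "X (fst s) (snd s) (\<lambda>i\<in>J. l * x i + (1 - l) * y i) = l *\<^sub>R X (fst p') (snd p') x + (1 - l) *\<^sub>R X (fst q') (snd q') y"
          using lin[of l "fst p'" "1 - l" "fst q'" "snd p'" "snd q'" x y] by (simp add: s_def)
        also have "\<dots> \<in> P" using True l P(2) by (intro convexD) auto
        finally have inP: "X (fst s) (snd s) (\<lambda>i\<in>J. l * x i + (1 - l) * y i) \<in> P" .
        have "\<alpha> \<le> 1" "\<beta> \<le> 1" using al True by auto
        then have "\<alpha> powr l * \<beta> powr (1 - l) \<le> 1 * 1"
          using al l by (intro mult_mono powr_le1) auto
        then show ?thesis using inP by simp
      qed
    qed (use mXind unit in \<open>simp_all add: \<rho>_def\<close>)
    then have "1 \<le> \<rho> s" by (simp add: \<rho>_def)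
    then have "ennreal ((a + b) ^ m) * 1 \<le> ennreal ((a + b) ^ m) * \<rho> s" by (rule mult_left_mono) simp
    also have "\<dots> = \<rho> (p + q)" unfolding pq using ab by (intro rho_hom[symmetric]) simp
    finally show ?thesis using ab unfolding a_def[symmetric] b_def[symmetric] by (intro psi_geI) auto
  qed
  have psi_axis: "\<psi> (s, 0) = 0" if s: "s \<le> 0" for s
  proof -
    have "X s 0 z \<in> P \<Longrightarrow> X s 0 z = 0" for z
      using axis[of "X s 0 z"] s by (auto simp: Xu Xw)
    then have "\<rho> (s, 0) \<le> ennreal ((2 * 0) ^ m)" by (intro fibre_le) auto
    then have "\<rho> (s, 0) = 0" using m by (simp add: power_0_left)
    then show ?thesis using m by (intro psi_eqI) auto
  qed
  have transfer: "(\<integral>\<^sup>+ x. ennreal (F (x \<bullet> w, x \<bullet> u)) * indicator {x\<in>P. (x \<bullet> w, x \<bullet> u) \<in> A} x \<partial>lborel)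
      = ennreal c * (\<integral>\<^sup>+ p. ennreal (F p * \<psi> p ^ m) * indicator A p \<partial>lborel)"
    if [measurable]: "F \<in> borel_measurable borel" "A \<in> sets borel" and F0: "\<And>p. 0 \<le> F p" for F :: "real \<times> real \<Rightarrow> real" and A
  proof -
    have [measurable]: "(\<lambda>x::'a. (x \<bullet> w, x \<bullet> u)) \<in> borel_measurable borel" by measurable
    have "(\<integral>\<^sup>+ x. ennreal (F (x \<bullet> w, x \<bullet> u)) * indicator {x\<in>P. (x \<bullet> w, x \<bullet> u) \<in> A} x \<partial>lborel)
      = ennreal c * (\<integral>\<^sup>+ s. \<integral>\<^sup>+ t. \<integral>\<^sup>+ z. ennreal (F (s, t)) * indicator {x\<in>P. (x \<bullet> w, x \<bullet> u) \<in> A} (X s t z) \<partial>?M \<partial>lborel \<partial>lborel)"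
      by (subst int) (auto simp: Xu Xw)
    also have "(\<integral>\<^sup>+ s. \<integral>\<^sup>+ t. \<integral>\<^sup>+ z. ennreal (F (s, t)) * indicator {x\<in>P. (x \<bullet> w, x \<bullet> u) \<in> A} (X s t z) \<partial>?M \<partial>lborel \<partial>lborel)
      = (\<integral>\<^sup>+ s. \<integral>\<^sup>+ t. ennreal (F (s, t) * \<psi> (s, t) ^ m) * indicator A (s, t) \<partial>lborel \<partial>lborel)"
    proof (intro nn_integral_cong)
      fix s t :: real
      have "(\<integral>\<^sup>+ z. ennreal (F (s, t)) * indicator {x\<in>P. (x \<bullet> w, x \<bullet> u) \<in> A} (X s t z) \<partial>?M)
         = (\<integral>\<^sup>+ z. (ennreal (F (s, t)) * indicator A (s, t)) * indicator P (X s t z) \<partial>?M)"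
        by (intro nn_integral_cong) (auto simp: indicator_def Xu Xw)
      also have "\<dots> = (ennreal (F (s, t)) * indicator A (s, t)) * \<rho> (s, t)"
        unfolding \<rho>_def fst_conv snd_conv by (rule nn_integral_cmult[OF mXind])
      also have "\<dots> = ennreal (F (s, t) * \<psi> (s, t) ^ m) * indicator A (s, t)"
      proof -
        have "ennreal (F (s, t) * \<psi> (s, t) ^ m) = ennreal (F (s, t)) * ennreal (\<psi> (s, t) ^ m)"
          using F0 psi0 by (intro ennreal_mult) auto
        then show ?thesis unfolding psi_pow by (simp only: mult_ac)
      qed
      finally show "(\<integral>\<^sup>+ z. ennreal (F (s, t)) * indicator {x\<in>P. (x \<bullet> w, x \<bullet> u) \<in> A} (X s t z) \<partial>?M) = \<dots>" .
    qed
    also have "\<dots> = (\<integral>\<^sup>+ p. ennreal (F p * \<psi> p ^ m) * indicator A p \<partial>lborel)"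
      by (rule nn_integral_lborel_pair[symmetric]) (unfold \<psi>_def, measurable)
    finally show ?thesis .
  qed
  have mpsi[measurable]: "\<psi> \<in> borel_measurable borel" unfolding \<psi>_def by measurable
  have setU: "{x\<in>P. (x \<bullet> w, x \<bullet> u) \<in> upper_disk} = {x\<in>P. r x \<le> 1 \<and> 0 \<le> x \<bullet> u}"
    and setL: "{x\<in>P. (x \<bullet> w, x \<bullet> u) \<in> lower_disk} = {x\<in>P. r x \<le> 1 \<and> x \<bullet> u \<le> 0}"
    by (auto simp: upper_disk_def lower_disk_def r_def)
  define VU where "VU = (\<integral>\<^sup>+ p. ennreal (norm p * \<psi> p ^ m) * indicator upper_disk p \<partial>lborel)"
  define VL where "VL = (\<integral>\<^sup>+ p. ennreal (norm p * \<psi> p ^ m) * indicator lower_disk p \<partial>lborel)"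
  define Mup where "Mup = (\<integral>\<^sup>+ p. ennreal (\<bar>snd p\<bar> * \<psi> p ^ m) * indicator upper_disk p \<partial>lborel)"
  define Mlow where "Mlow = (\<integral>\<^sup>+ p. ennreal (\<bar>snd p\<bar> * \<psi> p ^ m) * indicator lower_disk p \<partial>lborel)"
  have tU: "(\<integral>\<^sup>+ x. ennreal (r x) * indicator {x\<in>P. r x \<le> 1 \<and> 0 \<le> x \<bullet> u} x \<partial>lborel) = ennreal c * VU"
    using transfer[of norm upper_disk] unfolding setU VU_def r_def by simp
  have tL: "(\<integral>\<^sup>+ x. ennreal (r x) * indicator {x\<in>P. r x \<le> 1 \<and> x \<bullet> u \<le> 0} x \<partial>lborel) = ennreal c * VL"
    using transfer[of norm lower_disk] unfolding setL VL_def r_def by simp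
  have tMup: "(\<integral>\<^sup>+ x. ennreal \<bar>x \<bullet> u\<bar> * indicator {x\<in>P. r x \<le> 1 \<and> 0 \<le> x \<bullet> u} x \<partial>lborel) = ennreal c * Mup"
    using transfer[of "\<lambda>p. \<bar>snd p\<bar>" upper_disk] unfolding setU Mup_def by simp
  have tMlow: "(\<integral>\<^sup>+ x. ennreal \<bar>x \<bullet> u\<bar> * indicator {x\<in>P. r x \<le> 1 \<and> x \<bullet> u \<le> 0} x \<partial>lborel) = ennreal c * Mlow"
    using transfer[of "\<lambda>p. \<bar>snd p\<bar>" lower_disk] unfolding setL Mlow_def by simp
  have const: "(1 - 1 / real DIM('a)) ^ (DIM('a) - 1) = ((real m + 1) / (real m + 2)) ^ (m + 1)"
    by (simp add: dm field_simps)
  have VU_pos: "0 < VU" using pos c unfolding tU by (simp add: ennreal_zero_less_mult_iff)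
  have M_le: "Mlow \<le> Mup" using mom c unfolding tMup tMlow by (simp add: ennreal_mult_le_mult_iff)
  have c1: "((real m + 1) / (real m + 2)) ^ (m + 1) \<le> 1" by (intro power_le_one) auto
  have "ennreal (((real m + 1) / (real m + 2)) ^ (m + 1)) * (VU + VL) \<le> VU"
  proof (cases "VL = 0")
    case True
    have "ennreal (((real m + 1) / (real m + 2)) ^ (m + 1)) * VU \<le> 1 * VU"
      using c1 by (intro mult_right_mono) auto
    then show ?thesis using True by simp
  next
    case False
    \<comment> \<open>With mass on both sides of the axis, \<open>\<psi>\<close> is positive at a point of either side, hence by superadditivity on the axis,
      where \<open>planar_crossing_mass_ratio\<close> needs it.\<close>
    have ex1: "\<exists>p. 0 < snd p \<and> 0 < \<psi> p"
    proof (rule ccontr)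
      assume "\<not> ?thesis"
      then have z: "\<psi> p = 0" if "0 < snd p" for p using psi0[of p] that by (metis order_le_less)
      have "VU = 0" unfolding VU_def using m
        by (intro nn_integral_supported_on_axis) (auto simp: upper_disk_def indicator_def z power_0_left)
      then show False using VU_pos by simp
    qed
    have ex2: "\<exists>p. snd p < 0 \<and> 0 < \<psi> p"
    proof (rule ccontr)
      assume "\<not> ?thesis"
      then have z: "\<psi> p = 0" if "snd p < 0" for p using psi0[of p] that by (metis order_le_less)
      have "VL = 0" unfolding VL_def using m
        by (intro nn_integral_supported_on_axis) (auto simp: lower_disk_def indicator_def z power_0_left)
      then show False using False by simp
    qed
    obtain p q where p: "0 < snd p" "0 < \<psi> p" and q: "snd q < 0" "0 < \<psi> q" using ex1 ex2 by auto
    define s where "s = (- snd q) *\<^sub>R p + snd p *\<^sub>R q"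
    have s: "s = (fst s, 0)" by (simp add: s_def prod_eq_iff)
    have h1: "\<psi> ((- snd q) *\<^sub>R p) = (- snd q) * \<psi> p" using q by (intro psi_hom) simp
    have h2: "\<psi> (snd p *\<^sub>R q) = snd p * \<psi> q" using p by (intro psi_hom) simp
    have h3: "0 < (- snd q) * \<psi> p" "0 < snd p * \<psi> q" using p q by (auto simp: mult_neg_pos)
    have "0 < \<psi> s" unfolding s_def using psi_super[of "(- snd q) *\<^sub>R p" "snd p *\<^sub>R q"] h3 unfolding h1 h2 by linarith
    then have fs: "0 < fst s" using psi_axis[of "fst s"] s by (metis less_irrefl not_le)
    have "\<psi> (fst s *\<^sub>R (1, 0)) = fst s * \<psi> (1, 0)" using fs by (rule psi_hom)
    moreover have "fst s *\<^sub>R (1, 0) = s" by (subst (2) s) simp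
    ultimately have psi10: "0 < \<psi> (1, 0)" using \<open>0 < \<psi> s\<close> fs by (simp add: zero_less_mult_iff)
    obtain B where B: "\<And>p. norm p \<le> 1 \<Longrightarrow> \<rho> p \<le> ennreal B"
    proof -
      have "\<rho> p \<le> ennreal ((2 * \<bar>C\<bar>) ^ m)" if "norm p \<le> 1" for p
      proof (rule fibre_le)
        fix z assume "X (fst p) (snd p) z \<in> P"
        from r_p[OF this] have "norm (X (fst p) (snd p) z) \<le> \<bar>C\<bar> * norm p" .
        also have "\<dots> \<le> \<bar>C\<bar> * 1" using that by (intro mult_left_mono) auto
        finally show "norm (X (fst p) (snd p) z) \<le> \<bar>C\<bar>" by simp
      qed simp
      then show ?thesis using that by blast
    qed
    have fin: "(\<integral>\<^sup>+ p. ennreal (norm p * \<psi> p ^ m) * indicator A p \<partial>lborel) < \<infinity>" if A: "A \<subseteq> cball 0 1" for A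
    proof -
      have "(\<integral>\<^sup>+ p. ennreal (norm p * \<psi> p ^ m) * indicator A p \<partial>lborel) \<le> (\<integral>\<^sup>+ p. ennreal B * indicator (cball 0 1) p \<partial>(lborel :: (real \<times> real) measure))"
      proof (rule nn_integral_mono)
        fix p :: "real \<times> real"
        show "ennreal (norm p * \<psi> p ^ m) * indicator A p \<le> ennreal B * indicator (cball 0 1) p"
        proof (cases "p \<in> A")
          case True
          then have np: "norm p \<le> 1" using A by auto
          have "ennreal (norm p * \<psi> p ^ m) \<le> ennreal (1 * \<psi> p ^ m)"
            using np psi0 by (intro ennreal_leI mult_right_mono) auto
          also have "\<dots> \<le> ennreal B" using B[OF np] by (simp add: psi_pow)
          finally show ?thesis using True np by simp
        qed simp
      qed
      also have "\<dots> = ennreal B * emeasure lborel (cball (0::real \<times> real) 1)" by (rule nn_integral_cmult_indicator) simp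
      also have "\<dots> < \<infinity>" using emeasure_bounded_finite[of "cball (0::real \<times> real) 1"] by (simp add: ennreal_mult_less_top)
      finally show ?thesis .
    qed
    show ?thesis unfolding VU_def VL_def
      using VU_pos M_le unfolding VU_def Mlow_def Mup_def
      by (intro planar_crossing_mass_ratio[OF m mpsi psi0 psi_hom psi_super psi10 psi_axis fin fin])
        (auto simp: upper_disk_def lower_disk_def)
  qed
  then have "ennreal c * (ennreal (((real m + 1) / (real m + 2)) ^ (m + 1)) * (VU + VL)) \<le> ennreal c * VU"
    by (rule mult_left_mono) simp
  then show ?thesis unfolding tU tL const by (simp add: distrib_left mult.left_commute)
qed

section \<open>Localization by halving hyperplanes\<close>

lemma AE_inner_neq_0:
  fixes a :: "'a::euclidean_space"
  assumes "a \<noteq> 0" shows "AE x in lborel. x \<bullet> a \<noteq> 0"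
proof -
  have "negligible {x. a \<bullet> x = 0}" using assms by (intro negligible_hyperplane) auto
  moreover have c: "closed {x. a \<bullet> x = 0}" by (rule closed_hyperplane)
  ultimately have "{x. a \<bullet> x = 0} \<in> null_sets lborel"
    by (simp add: negligible_iff_null_sets null_sets_completion_iff)
  from AE_not_in[OF this] show ?thesis by (simp add: inner_commute)
qed

text \<open>
  The integral over the halfspace with normal \<open>a \<theta>\<close> is continuous in \<open>\<theta>\<close>, and the halfspaces for \<open>\<theta>\<close> and
  \<open>\<theta> + pi\<close> are complementary up to a null set. So it takes values on both sides of one half of the total, or equals it.
\<close>

lemma halving_cut:
  fixes G :: "'a::euclidean_space \<Rightarrow> real" and a1 a2 :: 'a
  defines "a \<equiv> \<lambda>\<theta>. cos \<theta> *\<^sub>R a1 + sin \<theta> *\<^sub>R a2"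
  assumes int: "integrable lborel G" and ne: "\<And>\<theta>. a \<theta> \<noteq> 0"
  shows "\<exists>\<theta>. (LINT x|lborel. indicator {x. 0 \<le> x \<bullet> a \<theta>} x * G x) = (LINT x|lborel. G x) / 2
           \<and> (LINT x|lborel. indicator {x. 0 \<le> x \<bullet> a (\<theta> + pi)} x * G x) = (LINT x|lborel. G x) / 2"
proof -
  define \<Phi> where "\<Phi> \<theta> = (LINT x|lborel. indicator {x. 0 \<le> x \<bullet> a \<theta>} x * G x)" for \<theta>
  have [measurable]: "G \<in> borel_measurable lborel" using int by (rule borel_measurable_integrable)
  have meas[measurable]: "(\<lambda>x. indicator {x. 0 \<le> x \<bullet> a \<theta>} x * G x) \<in> borel_measurable lborel" for \<theta> by measurable
  have intH: "integrable lborel (\<lambda>x. indicator {x. 0 \<le> x \<bullet> a \<theta>} x * G x)" for \<theta>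
    by (rule Bochner_Integration.integrable_bound[OF int]) (auto simp: indicator_def)
  have "isCont \<Phi> \<theta>" for \<theta>
  proof (rule continuous_at_sequentiallyI)
    fix t :: "nat \<Rightarrow> real" assume t: "t \<longlonglongrightarrow> \<theta>"
    show "(\<lambda>n. \<Phi> (t n)) \<longlonglongrightarrow> \<Phi> \<theta>"
      unfolding \<Phi>_def
    proof (rule integral_dominated_convergence[where w = "\<lambda>x. \<bar>G x\<bar>"])
      show "AE x in lborel. (\<lambda>n. indicator {x. 0 \<le> x \<bullet> a (t n)} x * G x) \<longlonglongrightarrow> indicator {x. 0 \<le> x \<bullet> a \<theta>} x * G x"
        using AE_inner_neq_0[OF ne[of \<theta>]]
      proof (rule eventually_mono)
        fix x assume x: "x \<bullet> a \<theta> \<noteq> 0"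
        have lim: "(\<lambda>n. x \<bullet> a (t n)) \<longlonglongrightarrow> x \<bullet> a \<theta>"
          unfolding a_def by (intro tendsto_intros t)
        have "\<forall>\<^sub>F n in sequentially. (0 \<le> x \<bullet> a (t n)) = (0 \<le> x \<bullet> a \<theta>)"
        proof (cases "0 < x \<bullet> a \<theta>")
          case True
          then show ?thesis using order_tendstoD(1)[OF lim, of 0] by (auto elim: eventually_mono)
        next
          case False
          then have "x \<bullet> a \<theta> < 0" using x by simp
          then show ?thesis using order_tendstoD(2)[OF lim, of 0] by (auto elim: eventually_mono)
        qed
        then have "\<forall>\<^sub>F n in sequentially. indicator {x. 0 \<le> x \<bullet> a (t n)} x * G x = indicator {x. 0 \<le> x \<bullet> a \<theta>} x * G x"
          by (rule eventually_mono) (simp add: indicator_def)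
        then show "(\<lambda>n. indicator {x. 0 \<le> x \<bullet> a (t n)} x * G x) \<longlonglongrightarrow> indicator {x. 0 \<le> x \<bullet> a \<theta>} x * G x"
          by (rule tendsto_eventually)
      qed
    qed (use int in \<open>auto simp: indicator_def\<close>)
  qed
  then have cont: "continuous_on {0..pi} \<Phi>" by (simp add: continuous_at_imp_continuous_on)
  have api: "a (\<theta> + pi) = - a \<theta>" for \<theta> by (simp add: a_def)
  have compl: "\<Phi> \<theta> + \<Phi> (\<theta> + pi) = (LINT x|lborel. G x)" for \<theta>
  proof -
    have "\<Phi> \<theta> + \<Phi> (\<theta> + pi) = (LINT x|lborel. indicator {x. 0 \<le> x \<bullet> a \<theta>} x * G x + indicator {x. 0 \<le> x \<bullet> a (\<theta> + pi)} x * G x)"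
      unfolding \<Phi>_def by (rule Bochner_Integration.integral_add[OF intH intH, symmetric])
    also have "\<dots> = (LINT x|lborel. G x)"
    proof (rule integral_cong_AE)
      show "AE x in lborel. indicator {x. 0 \<le> x \<bullet> a \<theta>} x * G x + indicator {x. 0 \<le> x \<bullet> a (\<theta> + pi)} x * G x = G x"
        using AE_inner_neq_0[OF ne[of \<theta>]] by (rule eventually_mono) (auto simp: indicator_def api)
    qed measurable
    finally show ?thesis .
  qed
  have "\<exists>\<theta>. \<Phi> \<theta> = (LINT x|lborel. G x) / 2"
  proof (cases "\<Phi> 0 \<le> (LINT x|lborel. G x) / 2")
    case True
    moreover have "(LINT x|lborel. G x) / 2 \<le> \<Phi> pi" using True compl[of 0] by simp
    ultimately show ?thesis using IVT'[OF _ _ pi_ge_zero cont] by blast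
  next
    case False
    then have "\<Phi> pi \<le> (LINT x|lborel. G x) / 2" using compl[of 0] by simp
    moreover have "(LINT x|lborel. G x) / 2 \<le> \<Phi> 0" using False by simp
    ultimately show ?thesis using IVT2'[OF _ _ pi_ge_zero cont] by blast
  qed
  then obtain \<theta> where \<theta>: "\<Phi> \<theta> = (LINT x|lborel. G x) / 2" by auto
  moreover have "\<Phi> (\<theta> + pi) = (LINT x|lborel. G x) / 2" using compl[of \<theta>] \<theta> by simp
  ultimately show ?thesis by (auto simp: \<Phi>_def)
qed

lemma localization_step:
  fixes G1 G2 :: "'a::euclidean_space \<Rightarrow> real" and a1 a2 :: 'a
  defines "a \<equiv> \<lambda>\<theta>. cos \<theta> *\<^sub>R a1 + sin \<theta> *\<^sub>R a2"
  assumes int: "integrable lborel G1" "integrable lborel G2" and ne: "\<And>\<theta>. a \<theta> \<noteq> 0"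
    and "0 \<le> (LINT x|lborel. G1 x)" "0 < (LINT x|lborel. G2 x)"
  shows "\<exists>\<theta>. 0 \<le> (LINT x|lborel. indicator {x. 0 \<le> x \<bullet> a \<theta>} x * G1 x)
           \<and> 0 < (LINT x|lborel. indicator {x. 0 \<le> x \<bullet> a \<theta>} x * G2 x)"
proof -
  obtain \<theta> where \<theta>: "(LINT x|lborel. indicator {x. 0 \<le> x \<bullet> a \<theta>} x * G1 x) = (LINT x|lborel. G1 x) / 2"
     "(LINT x|lborel. indicator {x. 0 \<le> x \<bullet> a (\<theta> + pi)} x * G1 x) = (LINT x|lborel. G1 x) / 2"
    using halving_cut[OF int(1), of a1 a2] ne unfolding a_def by blast
  have [measurable]: "G2 \<in> borel_measurable lborel" using int(2) by (rule borel_measurable_integrable)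
  have intH: "integrable lborel (\<lambda>x. indicator {x. 0 \<le> x \<bullet> b} x * G2 x)" for b
    by (rule Bochner_Integration.integrable_bound[OF int(2)]) (auto simp: indicator_def)
  have api: "a (\<theta> + pi) = - a \<theta>" for \<theta> by (simp add: a_def)
  have "(LINT x|lborel. indicator {x. 0 \<le> x \<bullet> a \<theta>} x * G2 x) + (LINT x|lborel. indicator {x. 0 \<le> x \<bullet> a (\<theta> + pi)} x * G2 x)
      = (LINT x|lborel. indicator {x. 0 \<le> x \<bullet> a \<theta>} x * G2 x + indicator {x. 0 \<le> x \<bullet> a (\<theta> + pi)} x * G2 x)"
    by (rule Bochner_Integration.integral_add[OF intH intH, symmetric])
  also have "\<dots> = (LINT x|lborel. G2 x)"
  proof (rule integral_cong_AE)
    show "AE x in lborel. indicator {x. 0 \<le> x \<bullet> a \<theta>} x * G2 x + indicator {x. 0 \<le> x \<bullet> a (\<theta> + pi)} x * G2 x = G2 x"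
      using AE_inner_neq_0[OF ne[of \<theta>]] by (rule eventually_mono) (auto simp: indicator_def api)
  qed measurable
  finally have "0 < (LINT x|lborel. indicator {x. 0 \<le> x \<bullet> a \<theta>} x * G2 x) \<or> 0 < (LINT x|lborel. indicator {x. 0 \<le> x \<bullet> a (\<theta> + pi)} x * G2 x)"
    using assms(6) by linarith
  then show ?thesis
  proof
    assume "0 < (LINT x|lborel. indicator {x. 0 \<le> x \<bullet> a \<theta>} x * G2 x)"
    then show ?thesis using \<theta>(1) assms(5) by (intro exI[of _ \<theta>]) simp
  next
    assume "0 < (LINT x|lborel. indicator {x. 0 \<le> x \<bullet> a (\<theta> + pi)} x * G2 x)"
    then show ?thesis using \<theta>(2) assms(5) by (intro exI[of _ "\<theta> + pi"]) simp
  qed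
qed

lemma linear_functional_eq_inner:
  fixes f :: "'a::euclidean_space \<Rightarrow> real"
  assumes "linear f" shows "\<exists>a. \<forall>x. f x = x \<bullet> a"
  using adjoint_works[OF assms, of _ 1] by (intro exI[of _ "adjoint f 1"]) simp

text \<open>
  Without the errors, three nonnegative numbers \<open>C\<close>, \<open>S\<close> and \<open>- C - S\<close> with sum zero would all vanish, against
  \<open>C\<^sup>2 + S\<^sup>2 = 1\<close>.
\<close>

lemma perturbed_triangle_separates:
  fixes C S e1 e2 e3 :: real
  assumes "C\<^sup>2 + S\<^sup>2 = 1" "\<bar>e1\<bar> \<le> 1/8" "\<bar>e2\<bar> \<le> 1/8" "\<bar>e3\<bar> \<le> 1/8"
    "0 \<le> C + e1" "0 \<le> S + e2" "0 \<le> - C - S + e3"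
  shows False
proof -
  have "\<bar>C\<bar> \<le> 1/2" "\<bar>S\<bar> \<le> 1/2" using assms by linarith+
  then have "C\<^sup>2 \<le> (1/2)\<^sup>2" "S\<^sup>2 \<le> (1/2)\<^sup>2" by (simp_all add: power2_le_iff_abs_le)
  then show False using assms(1) by (simp add: power2_eq_square)
qed

text \<open>
  For linearly independent points there are \<open>a1\<close> and \<open>a2\<close> such that the pairs of inner products with them are
  \<open>(1, 0)\<close>, \<open>(0, 1)\<close> and \<open>(-1, -1)\<close>. These are the vertices of a triangle around the origin, so every direction is negative at one of
  them, and this persists for a pair \<open>e n\<close> close to \<open>(a1, a2)\<close>.
\<close>

lemma dense_cuts_flatten:
  fixes e :: "nat \<Rightarrow> 'a::euclidean_space \<times> 'a"
  assumes dense: "closure (range e) = UNIV"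
    and ind: "independent {p1, p2, p3}" "p1 \<noteq> p2" "p1 \<noteq> p3" "p2 \<noteq> p3"
  shows "\<exists>n. \<forall>\<theta>. \<exists>p\<in>{p1, p2, p3}. p \<bullet> (cos \<theta> *\<^sub>R fst (e n) + sin \<theta> *\<^sub>R snd (e n)) < 0"
proof -
  have ex: "\<exists>a. p1 \<bullet> a = c1 \<and> p2 \<bullet> a = c2 \<and> p3 \<bullet> a = c3" for c1 c2 c3 :: real
  proof -
    obtain f where f: "linear f" "\<forall>x\<in>{p1, p2, p3}. f x = (if x = p1 then c1 else if x = p2 then c2 else c3)"
      using linear_independent_extend[OF ind(1), of "\<lambda>x. if x = p1 then c1 else if x = p2 then c2 else c3"] by auto
    obtain a where "\<forall>x. f x = x \<bullet> a" using linear_functional_eq_inner[OF f(1)] by auto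
    then have "p1 \<bullet> a = c1 \<and> p2 \<bullet> a = c2 \<and> p3 \<bullet> a = c3" using f(2) ind by auto
    then show ?thesis by blast
  qed
  obtain a1 where a1: "p1 \<bullet> a1 = 1" "p2 \<bullet> a1 = 0" "p3 \<bullet> a1 = - 1" using ex by blast
  obtain a2 where a2: "p1 \<bullet> a2 = 0" "p2 \<bullet> a2 = 1" "p3 \<bullet> a2 = - 1" using ex by blast
  define M where "M = 1 + norm p1 + norm p2 + norm p3"
  have M: "0 < M" "norm p1 \<le> M" "norm p2 \<le> M" "norm p3 \<le> M"
    unfolding M_def using norm_ge_zero[of p1] norm_ge_zero[of p2] norm_ge_zero[of p3] by linarith+
  have "(a1, a2) \<in> closure (range e)" using dense by simp
  then obtain n where n: "dist (e n) (a1, a2) < 1 / (16 * M)"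
  proof -
    assume "\<And>n. dist (e n) (a1, a2) < 1 / (16 * M) \<Longrightarrow> thesis"
    moreover have "0 < 1 / (16 * M)" using M(1) by simp
    ultimately show thesis using \<open>(a1, a2) \<in> closure (range e)\<close> unfolding closure_approachable by blast
  qed
  define d1 where "d1 = fst (e n) - a1"
  define d2 where "d2 = snd (e n) - a2"
  have d: "norm d1 \<le> 1 / (16 * M)" "norm d2 \<le> 1 / (16 * M)"
    using n dist_fst_le[of "e n" "(a1, a2)"] dist_snd_le[of "e n" "(a1, a2)"] by (auto simp: d1_def d2_def dist_norm)
  have err: "\<bar>cos \<theta> * (p \<bullet> d1) + sin \<theta> * (p \<bullet> d2)\<bar> \<le> 1/8" if "norm p \<le> M" for p \<theta>
  proof -
    have b: "\<bar>p \<bullet> d\<bar> \<le> 1/16" if "norm d \<le> 1 / (16 * M)" for d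
    proof -
      have "\<bar>p \<bullet> d\<bar> \<le> norm p * norm d" by (rule Cauchy_Schwarz_ineq2)
      also have "\<dots> \<le> M * (1 / (16 * M))" using that \<open>norm p \<le> M\<close> M by (intro mult_mono) auto
      finally show ?thesis using M by simp
    qed
    have "\<bar>cos \<theta> * (p \<bullet> d1)\<bar> \<le> 1 * (1/16)" "\<bar>sin \<theta> * (p \<bullet> d2)\<bar> \<le> 1 * (1/16)"
      unfolding abs_mult using b[OF d(1)] b[OF d(2)] by (intro mult_mono; simp)+
    then show ?thesis by linarith
  qed
  show ?thesis
  proof (intro exI[of _ n] allI, rule ccontr)
    fix \<theta>
    assume "\<not> (\<exists>p\<in>{p1, p2, p3}. p \<bullet> (cos \<theta> *\<^sub>R fst (e n) + sin \<theta> *\<^sub>R snd (e n)) < 0)"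
    then have *: "0 \<le> p \<bullet> (cos \<theta> *\<^sub>R fst (e n) + sin \<theta> *\<^sub>R snd (e n))" if "p \<in> {p1, p2, p3}" for p
      using that by (meson not_le)
    have e: "fst (e n) = a1 + d1" "snd (e n) = a2 + d2" by (auto simp: d1_def d2_def)
    have "0 \<le> cos \<theta> + (cos \<theta> * (p1 \<bullet> d1) + sin \<theta> * (p1 \<bullet> d2))"
      "0 \<le> sin \<theta> + (cos \<theta> * (p2 \<bullet> d1) + sin \<theta> * (p2 \<bullet> d2))"
      "0 \<le> - cos \<theta> - sin \<theta> + (cos \<theta> * (p3 \<bullet> d1) + sin \<theta> * (p3 \<bullet> d2))"
      using *[of p1] *[of p2] *[of p3] unfolding e by (auto simp: inner_add_right a1 a2 algebra_simps)
    then show False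
      by (rule perturbed_triangle_separates[OF sin_cos_squared_add2 err[OF M(2)] err[OF M(3)] err[OF M(4)]])
  qed
qed

text \<open>
  Cut \<open>n\<close> uses a normal in the span of the \<open>n\<close>-th pair of a dense sequence. Three independent points surviving all cuts
  would contradict \<open>dense_cuts_flatten\<close>, hence what survives spans at most a plane.
\<close>

lemma localization:
  fixes G1 G2 :: "'a::euclidean_space \<Rightarrow> real"
  assumes int: "integrable lborel G1" "integrable lborel G2"
    and "0 \<le> (LINT x|lborel. G1 x)" "0 < (LINT x|lborel. G2 x)"
  obtains a :: "nat \<Rightarrow> 'a"
  where "\<And>n. 0 \<le> (LINT x|lborel. indicator {x. \<forall>k<n. 0 \<le> x \<bullet> a k} x * G1 x)"
    "\<And>n. 0 < (LINT x|lborel. indicator {x. \<forall>k<n. 0 \<le> x \<bullet> a k} x * G2 x)"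
    "\<And>p1 p2 p3. (\<And>k. 0 \<le> p1 \<bullet> a k \<and> 0 \<le> p2 \<bullet> a k \<and> 0 \<le> p3 \<bullet> a k) \<Longrightarrow> p1 \<noteq> p2 \<Longrightarrow> p1 \<noteq> p3 \<Longrightarrow> p2 \<noteq> p3 \<Longrightarrow> dependent {p1, p2, p3}"
proof -
  obtain D :: "('a \<times> 'a) set" where D: "countable D" "closure D = UNIV"
  proof -
    obtain D :: "('a \<times> 'a) set" where "countable D" "D \<subseteq> UNIV" "UNIV \<subseteq> closure D" by (rule separable)
    then show thesis by (intro that[of D]) (simp_all add: top.extremum_unique)
  qed
  have "D \<noteq> {}" using D(2) by auto
  define e where "e = from_nat_into D"
  have e: "closure (range e) = UNIV" using D \<open>D \<noteq> {}\<close> by (simp add: e_def range_from_nat_into)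
  define comb where "comb n \<theta> = cos \<theta> *\<^sub>R fst (e n) + sin \<theta> *\<^sub>R snd (e n)" for n \<theta>
  have meas: "G1 \<in> borel_measurable lborel" "G2 \<in> borel_measurable lborel" using int by (auto dest: borel_measurable_integrable)
  note [measurable] = meas
  define ok where "ok H \<longleftrightarrow> H \<in> sets borel \<and> 0 \<le> (LINT x|lborel. indicator H x * G1 x) \<and> 0 < (LINT x|lborel. indicator H x * G2 x)" for H :: "'a set"
  \<comment> \<open>A dependent pair, for which the normal might vanish, is skipped by the trivial cut with normal zero.\<close>
  define step where "step n H H' \<longleftrightarrow> (\<exists>b. H' = H \<inter> {x. 0 \<le> x \<bullet> b} \<and> ((\<forall>\<theta>. comb n \<theta> \<noteq> 0) \<longrightarrow> (\<exists>\<theta>. b = comb n \<theta>)))" for n and H H' :: "'a set"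
  have "\<exists>S. \<forall>n. (ok (S n) \<and> (n = 0 \<longrightarrow> S n = UNIV)) \<and> step n (S n) (S (Suc n))"
  proof (rule dependent_nat_choice)
    show "\<exists>H. ok H \<and> ((0::nat) = 0 \<longrightarrow> H = UNIV)" using assms(3,4) by (intro exI[of _ UNIV]) (simp add: ok_def)
    fix H :: "'a set" and n :: nat
    assume "ok H \<and> (n = 0 \<longrightarrow> H = UNIV)"
    then have H: "H \<in> sets borel" "0 \<le> (LINT x|lborel. indicator H x * G1 x)" "0 < (LINT x|lborel. indicator H x * G2 x)"
      by (auto simp: ok_def)
    note [measurable] = H(1)
    show "\<exists>H'. (ok H' \<and> (Suc n = 0 \<longrightarrow> H' = UNIV)) \<and> step n H H'"
    proof (cases "\<forall>\<theta>. comb n \<theta> \<noteq> 0")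
      case False
      then have "step n H H" unfolding step_def by (intro exI[of _ 0]) auto
      then show ?thesis using H by (intro exI[of _ H]) (simp add: ok_def)
    next
      case True
      have i1: "integrable lborel (\<lambda>x. indicator H x * G1 x)"
        by (rule Bochner_Integration.integrable_bound[OF int(1)]) (auto simp: indicator_def)
      have i2: "integrable lborel (\<lambda>x. indicator H x * G2 x)"
        by (rule Bochner_Integration.integrable_bound[OF int(2)]) (auto simp: indicator_def)
      obtain \<theta> where \<theta>: "0 \<le> (LINT x|lborel. indicator {x. 0 \<le> x \<bullet> comb n \<theta>} x * (indicator H x * G1 x))"
          "0 < (LINT x|lborel. indicator {x. 0 \<le> x \<bullet> comb n \<theta>} x * (indicator H x * G2 x))"
        using localization_step[OF i1 i2, of "fst (e n)" "snd (e n)"] True H(2,3) unfolding comb_def by auto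
      have eq: "indicator {x. 0 \<le> x \<bullet> comb n \<theta>} x * (indicator H x * g) = indicator (H \<inter> {x. 0 \<le> x \<bullet> comb n \<theta>}) x * g" for x :: 'a and g :: real
        by (auto simp: indicator_def)
      have "ok (H \<inter> {x. 0 \<le> x \<bullet> comb n \<theta>})"
        using \<theta> unfolding eq ok_def by simp
      moreover have "step n H (H \<inter> {x. 0 \<le> x \<bullet> comb n \<theta>})" unfolding step_def by blast
      ultimately show ?thesis by blast
    qed
  qed
  then obtain S where S: "\<And>n. ok (S n)" "S 0 = UNIV" "\<And>n. step n (S n) (S (Suc n))" by blast
  obtain a where a: "\<And>n. S (Suc n) = S n \<inter> {x. 0 \<le> x \<bullet> a n} \<and> ((\<forall>\<theta>. comb n \<theta> \<noteq> 0) \<longrightarrow> (\<exists>\<theta>. a n = comb n \<theta>))"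
    using S(3) unfolding step_def by metis
  have Seq: "S n = {x. \<forall>k<n. 0 \<le> x \<bullet> a k}" for n
  proof (induction n)
    case (Suc n)
    have "S (Suc n) = S n \<inter> {x. 0 \<le> x \<bullet> a n}" using a by blast
    then show ?case unfolding Suc by (auto simp: less_Suc_eq)
  qed (simp add: S(2))
  show ?thesis
  proof (rule that[of a])
    show "0 \<le> (LINT x|lborel. indicator {x. \<forall>k<n. 0 \<le> x \<bullet> a k} x * G1 x)"
      "0 < (LINT x|lborel. indicator {x. \<forall>k<n. 0 \<le> x \<bullet> a k} x * G2 x)" for n
      using S(1)[of n] unfolding ok_def Seq by auto
    fix p1 p2 p3 :: 'a
    assume p: "\<And>k. 0 \<le> p1 \<bullet> a k \<and> 0 \<le> p2 \<bullet> a k \<and> 0 \<le> p3 \<bullet> a k" "p1 \<noteq> p2" "p1 \<noteq> p3" "p2 \<noteq> p3"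
    show "dependent {p1, p2, p3}"
    proof (rule ccontr)
      assume "independent {p1, p2, p3}"
      from dense_cuts_flatten[OF e this p(2-4)] obtain n
        where n: "\<And>\<theta>. \<exists>p\<in>{p1, p2, p3}. p \<bullet> comb n \<theta> < 0" unfolding comb_def by blast
      have "comb n \<theta> \<noteq> 0" for \<theta> using n[of \<theta>] by auto
      then obtain \<theta> where "a n = comb n \<theta>" using a by blast
      then show False using n[of \<theta>] p(1)[of n] by auto
    qed
  qed
qed

section \<open>Cones close to a plane\<close>

lemma nn_integral_lborel_scale:
  fixes f :: "'a::euclidean_space \<Rightarrow> ennreal"
  assumes [measurable]: "f \<in> borel_measurable borel" and b: "0 < b"
  shows "(\<integral>\<^sup>+ x. f x \<partial>lborel) = ennreal (b ^ DIM('a)) * (\<integral>\<^sup>+ x. f (b *\<^sub>R x) \<partial>lborel)"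
proof -
  have "(\<integral>\<^sup>+ x. f x \<partial>lborel) = (\<integral>\<^sup>+ x. f x \<partial>(density (distr lborel borel (\<lambda>x::'a. 0 + b *\<^sub>R x)) (\<lambda>_. ennreal (\<bar>b\<bar> ^ DIM('a)))))"
    using lborel_affine[of b "0::'a"] b by simp
  also have "\<dots> = ennreal (b ^ DIM('a)) * (\<integral>\<^sup>+ x. f (b *\<^sub>R x) \<partial>lborel)"
    using b by (subst nn_integral_density) (simp_all add: nn_integral_distr nn_integral_cmult)
  finally show ?thesis .
qed

text \<open>
  The region \<open>r1 \<le> 1\<close> lies in the region \<open>r2 \<le> b\<close>, which is \<open>b\<close> times the region \<open>r2 \<le> 1\<close>, and the integral of a function
  of degree one over the latter is multiplied by \<open>b ^ (DIM + 1)\<close>.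
\<close>

lemma conic_gauge_compare:
  fixes S :: "'a::euclidean_space set" and g r1 r2 :: "'a \<Rightarrow> real"
  assumes [measurable]: "S \<in> sets borel" "g \<in> borel_measurable borel" "r1 \<in> borel_measurable borel" "r2 \<in> borel_measurable borel"
    and conic: "\<And>x a. x \<in> S \<Longrightarrow> 0 < a \<Longrightarrow> a *\<^sub>R x \<in> S"
    and hom: "\<And>x a. 0 < a \<Longrightarrow> g (a *\<^sub>R x) = a * g x" "\<And>x a. 0 < a \<Longrightarrow> r2 (a *\<^sub>R x) = a * r2 x"
    and b: "0 < b" and le: "\<And>x. x \<in> S \<Longrightarrow> r2 x \<le> b * r1 x"
  shows "(\<integral>\<^sup>+ x. ennreal (g x) * indicator {x\<in>S. r1 x \<le> 1} x \<partial>lborel)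
     \<le> ennreal (b ^ (DIM('a) + 1)) * (\<integral>\<^sup>+ x. ennreal (g x) * indicator {x\<in>S. r2 x \<le> 1} x \<partial>lborel)"
proof -
  have "(\<integral>\<^sup>+ x. ennreal (g x) * indicator {x\<in>S. r1 x \<le> 1} x \<partial>lborel) \<le> (\<integral>\<^sup>+ x. ennreal (g x) * indicator {x\<in>S. r2 x \<le> b} x \<partial>lborel)"
  proof (intro nn_integral_mono mult_left_mono)
    fix x
    have "r2 x \<le> b" if "x \<in> S" "r1 x \<le> 1"
    proof -
      have "b * r1 x \<le> b * 1" using b that(2) by (intro mult_left_mono) auto
      then show ?thesis using le[OF that(1)] by simp
    qed
    then show "indicator {x\<in>S. r1 x \<le> 1} x \<le> (indicator {x\<in>S. r2 x \<le> b} x :: ennreal)"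
      by (auto simp: indicator_def)
  qed simp
  also have "\<dots> = ennreal (b ^ DIM('a)) * (\<integral>\<^sup>+ x. ennreal (g (b *\<^sub>R x)) * indicator {x\<in>S. r2 x \<le> b} (b *\<^sub>R x) \<partial>lborel)"
    using b by (intro nn_integral_lborel_scale) measurable
  also have "(\<integral>\<^sup>+ x. ennreal (g (b *\<^sub>R x)) * indicator {x\<in>S. r2 x \<le> b} (b *\<^sub>R x) \<partial>lborel)
      = (\<integral>\<^sup>+ x. ennreal b * (ennreal (g x) * indicator {x\<in>S. r2 x \<le> 1} x) \<partial>lborel)"
  proof (rule nn_integral_cong)
    fix x
    have "b *\<^sub>R x \<in> S \<longleftrightarrow> x \<in> S" using conic[of x b] conic[of "b *\<^sub>R x" "1 / b"] b by auto
    moreover have "r2 (b *\<^sub>R x) \<le> b \<longleftrightarrow> r2 x \<le> 1" using hom(2)[OF b, of x] b by simp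
    ultimately show "ennreal (g (b *\<^sub>R x)) * indicator {x\<in>S. r2 x \<le> b} (b *\<^sub>R x) = ennreal b * (ennreal (g x) * indicator {x\<in>S. r2 x \<le> 1} x)"
      using b hom(1)[OF b, of x] by (simp add: indicator_def ennreal_mult')
  qed
  also have "\<dots> = ennreal b * (\<integral>\<^sup>+ x. ennreal (g x) * indicator {x\<in>S. r2 x \<le> 1} x \<partial>lborel)"
    by (rule nn_integral_cmult) measurable
  finally show ?thesis using b by (simp add: ennreal_mult mult_ac)
qed

text \<open>
  Exchanging \<open>norm\<close> and \<open>r\<close> costs a factor \<open>b ^ (DIM + 1)\<close> in the region and another \<open>b\<close> in the weight. The hypothesis on
  the moments and the conclusion of \<open>gauge_cone_mass_ratio\<close> each undergo two such exchanges.
\<close>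

lemma near_planar_cone_mass_ratio:
  fixes Q :: "'a::euclidean_space set" and u w :: 'a and b :: real
  defines "r \<equiv> \<lambda>x. norm (x \<bullet> w, x \<bullet> u)"
  defines "up \<equiv> {x\<in>Q. 0 \<le> x \<bullet> u}" and "dn \<equiv> {x\<in>Q. x \<bullet> u \<le> 0}"
  defines "N \<equiv> \<lambda>S. (\<integral>\<^sup>+ x. ennreal (norm x) * indicator {x\<in>S. norm x \<le> 1} x \<partial>lborel)"
  defines "M \<equiv> \<lambda>S. (\<integral>\<^sup>+ x. ennreal \<bar>x \<bullet> u\<bar> * indicator {x\<in>S. norm x \<le> 1} x \<partial>lborel)"
  assumes dim: "3 \<le> DIM('a)"
    and Q: "closed Q" "convex Q" and conic: "\<And>x a. x \<in> Q \<Longrightarrow> 0 < a \<Longrightarrow> a *\<^sub>R x \<in> Q"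
    and u: "u \<noteq> 0" and ind: "\<And>k. w \<noteq> k *\<^sub>R u"
    and b: "1 \<le> b" and near: "\<And>x. x \<in> Q \<Longrightarrow> norm x \<le> b * r x \<and> r x \<le> b * norm x"
    and axis: "\<And>x. x \<in> Q \<Longrightarrow> x \<bullet> u = 0 \<Longrightarrow> x \<noteq> 0 \<Longrightarrow> 0 < x \<bullet> w"
    and pos: "0 < N up"
    and mom: "ennreal (b ^ (2 * (DIM('a) + 2))) * M dn \<le> M up"
  shows "ennreal ((1 - 1 / real DIM('a)) ^ (DIM('a) - 1)) * (N up + N dn) \<le> ennreal (b ^ (2 * (DIM('a) + 2))) * N up"
proof -
  define \<mu> where "\<mu> = b ^ (DIM('a) + 2)"
  have \<mu>: "1 \<le> \<mu>" using b unfolding \<mu>_def by (rule one_le_power)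
  have \<mu>2: "b ^ (2 * (DIM('a) + 2)) = \<mu> * \<mu>" by (simp add: \<mu>_def power_add[symmetric] mult_2)
  define N' where "N' S = (\<integral>\<^sup>+ x. ennreal (r x) * indicator {x\<in>S. r x \<le> 1} x \<partial>lborel)" for S
  define M' where "M' S = (\<integral>\<^sup>+ x. ennreal \<bar>x \<bullet> u\<bar> * indicator {x\<in>S. r x \<le> 1} x \<partial>lborel)" for S
  have [measurable]: "Q \<in> sets borel" using Q by simp
  have sets[measurable]: "up \<in> sets borel" "dn \<in> sets borel" unfolding up_def dn_def by measurable
  have rm[measurable]: "r \<in> borel_measurable borel" unfolding r_def by measurable
  have r_hom: "r (a *\<^sub>R x) = a * r x" if "0 < a" for a x
  proof -
    have "((a *\<^sub>R x) \<bullet> w, (a *\<^sub>R x) \<bullet> u) = a *\<^sub>R (x \<bullet> w, x \<bullet> u)" by simp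
    then show ?thesis using that unfolding r_def by (metis abs_of_pos norm_scaleR)
  qed
  have half: "S \<subseteq> Q \<and> S \<in> sets borel \<and> (\<forall>x a. x \<in> S \<longrightarrow> 0 < a \<longrightarrow> a *\<^sub>R x \<in> S)" if "S \<in> {up, dn}" for S
    using that conic by (auto simp: up_def dn_def mult_nonneg_nonneg mult_nonneg_nonpos)
  have M1: "M' S \<le> ennreal \<mu> * M S" and M2: "M S \<le> ennreal \<mu> * M' S"
    and N1: "N' S \<le> ennreal \<mu> * N S" and N2: "N S \<le> ennreal \<mu> * N' S" if S: "S \<in> {up, dn}" for S
  proof -
    have S1: "S \<subseteq> Q" "S \<in> sets borel" "\<And>x a. x \<in> S \<Longrightarrow> 0 < a \<Longrightarrow> a *\<^sub>R x \<in> S" using half[OF S] by auto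
    note [measurable] = S1(2)
    have b0: "0 < b" using b by simp
    have pw: "b ^ (DIM('a) + 1) \<le> \<mu>" unfolding \<mu>_def using b by (intro power_increasing) auto
    have pw2: "b ^ (DIM('a) + 1) * b = \<mu>" unfolding \<mu>_def by simp
    have G1: "(\<integral>\<^sup>+ x. ennreal (g x) * indicator {x\<in>S. r x \<le> 1} x \<partial>lborel)
       \<le> ennreal (b ^ (DIM('a) + 1)) * (\<integral>\<^sup>+ x. ennreal (g x) * indicator {x\<in>S. norm x \<le> 1} x \<partial>lborel)"
      if [measurable]: "g \<in> borel_measurable borel" and "\<And>x a. 0 < a \<Longrightarrow> g (a *\<^sub>R x) = a * g x" for g
      by (rule conic_gauge_compare) (use S1 that b0 near in auto)
    have G2: "(\<integral>\<^sup>+ x. ennreal (g x) * indicator {x\<in>S. norm x \<le> 1} x \<partial>lborel)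
       \<le> ennreal (b ^ (DIM('a) + 1)) * (\<integral>\<^sup>+ x. ennreal (g x) * indicator {x\<in>S. r x \<le> 1} x \<partial>lborel)"
      if [measurable]: "g \<in> borel_measurable borel" and "\<And>x a. 0 < a \<Longrightarrow> g (a *\<^sub>R x) = a * g x" for g
      by (rule conic_gauge_compare) (use S1 that b0 near r_hom in auto)
    have "M' S \<le> ennreal (b ^ (DIM('a) + 1)) * M S"
      unfolding M'_def M_def by (rule G1) (auto simp: abs_mult)
    also have "\<dots> \<le> ennreal \<mu> * M S" using pw by (intro mult_right_mono ennreal_leI) auto
    finally show "M' S \<le> ennreal \<mu> * M S" .
    have "M S \<le> ennreal (b ^ (DIM('a) + 1)) * M' S"
      unfolding M'_def M_def by (rule G2) (auto simp: abs_mult)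
    also have "\<dots> \<le> ennreal \<mu> * M' S" using pw by (intro mult_right_mono ennreal_leI) auto
    finally show "M S \<le> ennreal \<mu> * M' S" .
    have w: "(\<integral>\<^sup>+ x. ennreal (g x) * indicator A x \<partial>lborel) \<le> ennreal b * (\<integral>\<^sup>+ x. ennreal (h x) * indicator A x \<partial>lborel)"
      if [measurable]: "g \<in> borel_measurable borel" "h \<in> borel_measurable borel" "A \<in> sets borel" and gh: "\<And>x. x \<in> A \<Longrightarrow> g x \<le> b * h x \<and> 0 \<le> h x" for g h and A :: "'a set"
    proof -
      have "(\<integral>\<^sup>+ x. ennreal (g x) * indicator A x \<partial>lborel) \<le> (\<integral>\<^sup>+ x. ennreal b * (ennreal (h x) * indicator A x) \<partial>lborel)"
        using gh b0 by (intro nn_integral_mono) (auto simp: indicator_def ennreal_mult[symmetric] intro!: ennreal_leI)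
      also have "\<dots> = ennreal b * (\<integral>\<^sup>+ x. ennreal (h x) * indicator A x \<partial>lborel)" by (rule nn_integral_cmult) measurable
      finally show ?thesis .
    qed
    have "N' S \<le> ennreal (b ^ (DIM('a) + 1)) * (\<integral>\<^sup>+ x. ennreal (r x) * indicator {x\<in>S. norm x \<le> 1} x \<partial>lborel)"
      unfolding N'_def by (rule G1) (auto simp: r_hom)
    also have "\<dots> \<le> ennreal (b ^ (DIM('a) + 1)) * (ennreal b * N S)"
      unfolding N_def by (intro mult_left_mono w) (use S1 near in auto)
    also have "\<dots> = ennreal \<mu> * N S" using b0 by (simp add: pw2[symmetric] ennreal_mult mult.assoc)
    finally show "N' S \<le> ennreal \<mu> * N S" .
    have "N S \<le> ennreal (b ^ (DIM('a) + 1)) * (\<integral>\<^sup>+ x. ennreal (norm x) * indicator {x\<in>S. r x \<le> 1} x \<partial>lborel)"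
      unfolding N_def by (rule G2) auto
    also have "\<dots> \<le> ennreal (b ^ (DIM('a) + 1)) * (ennreal b * N' S)"
      unfolding N'_def by (intro mult_left_mono w) (use S1 near in \<open>auto simp: r_def\<close>)
    also have "\<dots> = ennreal \<mu> * N' S" using b0 by (simp add: pw2[symmetric] ennreal_mult mult.assoc)
    finally show "N S \<le> ennreal \<mu> * N' S" .
  qed
  have cancel: "x \<le> y" if "ennreal \<mu> * x \<le> ennreal \<mu> * y" for x y
    using that \<mu> by (simp add: ennreal_mult_le_mult_iff)
  have setU: "{x\<in>up. r x \<le> 1} = {x\<in>Q. r x \<le> 1 \<and> 0 \<le> x \<bullet> u}" and setD: "{x\<in>dn. r x \<le> 1} = {x\<in>Q. r x \<le> 1 \<and> x \<bullet> u \<le> 0}"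
    by (auto simp: up_def dn_def)
  have "ennreal \<mu> * M' dn \<le> ennreal \<mu> * (ennreal \<mu> * M dn)" by (intro mult_left_mono M1) auto
  also have "\<dots> \<le> M up" using mom \<mu> unfolding \<mu>2 by (simp add: ennreal_mult mult.assoc)
  also have "\<dots> \<le> ennreal \<mu> * M' up" by (rule M2) simp
  finally have mom': "M' dn \<le> M' up" by (rule cancel)
  have pos': "0 < N' up"
  proof (rule ccontr)
    assume "\<not> ?thesis"
    then have "N' up = 0" by simp
    then have "N up \<le> 0" using N2[of up] by simp
    then show False using pos by simp
  qed
  let ?c = "ennreal ((1 - 1 / real DIM('a)) ^ (DIM('a) - 1))"
  have ratio: "?c * (N' up + N' dn) \<le> N' up"
    unfolding N'_def setU setD
    unfolding r_def
  proof (rule gauge_cone_mass_ratio[OF dim Q conic u ind, where C = b])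
    show "0 < (\<integral>\<^sup>+ x. ennreal (norm (x \<bullet> w, x \<bullet> u)) * indicator {x\<in>Q. norm (x \<bullet> w, x \<bullet> u) \<le> 1 \<and> 0 \<le> x \<bullet> u} x \<partial>lborel)"
      using pos' unfolding N'_def setU unfolding r_def .
    show "(\<integral>\<^sup>+ x. ennreal \<bar>x \<bullet> u\<bar> * indicator {x\<in>Q. norm (x \<bullet> w, x \<bullet> u) \<le> 1 \<and> x \<bullet> u \<le> 0} x \<partial>lborel)
       \<le> (\<integral>\<^sup>+ x. ennreal \<bar>x \<bullet> u\<bar> * indicator {x\<in>Q. norm (x \<bullet> w, x \<bullet> u) \<le> 1 \<and> 0 \<le> x \<bullet> u} x \<partial>lborel)"
      using mom' unfolding M'_def setU setD unfolding r_def .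
  qed (use near axis in \<open>auto simp: r_def\<close>)
  have "?c * (N up + N dn) \<le> ?c * (ennreal \<mu> * N' up + ennreal \<mu> * N' dn)"
    by (intro mult_left_mono add_mono N2) auto
  also have "\<dots> = ennreal \<mu> * (?c * (N' up + N' dn))" by (simp only: distrib_left mult.left_commute)
  also have "\<dots> \<le> ennreal \<mu> * N' up" by (intro mult_left_mono ratio) auto
  also have "\<dots> \<le> ennreal \<mu> * (ennreal \<mu> * N up)" by (intro mult_left_mono N1) auto
  also have "\<dots> = ennreal (b ^ (2 * (DIM('a) + 2))) * N up"
    unfolding \<mu>2 using \<mu> by (simp add: ennreal_mult mult.assoc)
  finally show ?thesis .
qed

section \<open>Grunbaum's inequality for cones\<close>

text \<open>
  A set all of whose triples are dependent lies in a plane, here spanned by orthonormal vectors \<open>w\<close> and \<open>d\<close>, the first one orthogonal to \<open>u\<close>. On that plane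
  \<open>x \<bullet> d = x \<bullet> u / a\<close> with \<open>a = d \<bullet> u\<close>, so the norm is expressed by \<open>w\<close> and \<open>u\<close> alone.
\<close>

lemma ex_adapted_plane:
  fixes R :: "'a::euclidean_space set" and p u v :: 'a
  assumes dim: "3 \<le> DIM('a)" and p: "p \<in> R" "0 < p \<bullet> u"
    and flat: "\<And>x y z. x \<in> R \<Longrightarrow> y \<in> R \<Longrightarrow> z \<in> R \<Longrightarrow> x \<noteq> y \<Longrightarrow> x \<noteq> z \<Longrightarrow> y \<noteq> z \<Longrightarrow> dependent {x, y, z}"
    and pointed: "0 < \<kappa>" "\<And>x. x \<in> R \<Longrightarrow> \<kappa> * norm x \<le> x \<bullet> v"
  obtains w a where "norm w = 1" "w \<bullet> u = 0" "0 < a" "- w \<notin> R" "\<And>z. z \<in> R \<Longrightarrow> norm z = norm (z \<bullet> w, z \<bullet> u / a)"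
proof -
  have p0: "p \<noteq> 0" using p by auto
  have "\<exists>y. y \<notin> span {p} \<and> R \<subseteq> span {p, y}"
  proof (cases "R \<subseteq> span {p}")
    case True
    have "dim (span {p}) \<le> 1" using dim_le_card'[of "{p}"] by simp
    then have "span {p} \<noteq> UNIV" using dim by (intro notI) (simp add: dim_UNIV)
    then obtain y where "y \<notin> span {p}" by auto
    moreover have "span {p} \<subseteq> span {p, y}" by (intro span_mono) auto
    ultimately show ?thesis using True by blast
  next
    case False
    then obtain y where y: "y \<in> R" "y \<notin> span {p}" by auto
    have py: "p \<noteq> y" using y span_base[of p "{p}"] by auto
    have "independent {p, y}" using y p0 py by (metis independent_insert dependent_single insert_commute singletonD)
    then have "z \<in> span {p, y}" if z: "z \<in> R" for z
    proof (cases "z = p \<or> z = y")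
      case True then show ?thesis by (auto intro: span_base)
    next
      case F: False
      then have "dependent (insert z {p, y})" using flat[OF z p(1) y(1)] py by auto
      then show ?thesis using independent_insertI[OF _ \<open>independent {p, y}\<close>, of z] by blast
    qed
    then show ?thesis using y by blast
  qed
  then obtain y where y: "y \<notin> span {p}" "R \<subseteq> span {p, y}" by blast
  define w0 where "w0 = y - ((y \<bullet> u) / (p \<bullet> u)) *\<^sub>R p"
  have w0u: "w0 \<bullet> u = 0" using p by (simp add: w0_def inner_diff_left)
  have w00: "w0 \<noteq> 0"
  proof
    assume "w0 = 0"
    then have "y = ((y \<bullet> u) / (p \<bullet> u)) *\<^sub>R p" by (simp add: w0_def)
    moreover have "((y \<bullet> u) / (p \<bullet> u)) *\<^sub>R p \<in> span {p}" by (intro span_scale span_base) simp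
    ultimately show False using y(1) by metis
  qed
  define w1 where "w1 = (1 / norm w0) *\<^sub>R w0"
  \<comment> \<open>As \<open>R\<close> is pointed, it does not contain both \<open>w1\<close> and \<open>- w1\<close>; the sign is chosen such that \<open>- w\<close> is not in it.\<close>
  define w where "w = (if - w1 \<in> R then - w1 else w1)"
  have w1: "norm w1 = 1" "w1 \<bullet> u = 0" using w00 w0u by (auto simp: w1_def)
  have w: "norm w = 1" "w \<bullet> u = 0" using w1 by (auto simp: w_def)
  have wR: "- w \<notin> R"
  proof
    assume "- w \<in> R"
    then have "- w1 \<in> R" "w1 \<in> R" by (auto simp: w_def split: if_splits)
    then have "\<kappa> \<le> - (w1 \<bullet> v)" "\<kappa> \<le> w1 \<bullet> v" using pointed(2)[of w1] pointed(2)[of "- w1"] w1 by auto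
    then show False using pointed(1) by simp
  qed
  have ww: "w \<bullet> w = 1" using w(1) by (simp add: dot_square_norm)
  define d0 where "d0 = p - (p \<bullet> w) *\<^sub>R w"
  have d0u: "d0 \<bullet> u = p \<bullet> u" using w by (simp add: d0_def inner_diff_left)
  have d00: "d0 \<noteq> 0" using d0u p by auto
  have d0w: "d0 \<bullet> w = 0" using ww by (simp add: d0_def inner_diff_left)
  define d where "d = (1 / norm d0) *\<^sub>R d0"
  have d: "norm d = 1" "d \<bullet> w = 0" using d00 d0w by (auto simp: d_def)
  define a where "a = d \<bullet> u"
  have a: "0 < a" using d0u d00 p by (simp add: a_def d_def)
  have rep: "\<exists>s t. z = s *\<^sub>R w + t *\<^sub>R d" if z: "z \<in> R" for z
  proof -
    obtain c1 c2 where "z = c1 *\<^sub>R p + c2 *\<^sub>R y"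
    proof -
      have "z \<in> span {p, y}" using z y(2) by auto
      then obtain k where "z - k *\<^sub>R p \<in> span {y}" by (auto simp: span_breakdown_eq)
      then obtain k' where "z - k *\<^sub>R p = k' *\<^sub>R y" by (auto simp: span_singleton)
      then show ?thesis using that[of k k'] by (simp add: algebra_simps)
    qed
    moreover have "p = norm d0 *\<^sub>R d + (p \<bullet> w) *\<^sub>R w" using d00 by (simp add: d_def d0_def)
    moreover have "y = (if - w1 \<in> R then - norm w0 else norm w0) *\<^sub>R w + ((y \<bullet> u) / (p \<bullet> u)) *\<^sub>R p"
      using w00 by (simp add: w_def w1_def w0_def)
    moreover define k3 where "k3 = (if - w1 \<in> R then - norm w0 else norm w0)"
    moreover define k4 where "k4 = (y \<bullet> u) / (p \<bullet> u)"
    ultimately have z: "z = c1 *\<^sub>R p + c2 *\<^sub>R (k3 *\<^sub>R w + k4 *\<^sub>R p)" and pp: "p = norm d0 *\<^sub>R d + (p \<bullet> w) *\<^sub>R w" by auto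
    have "z = (c1 + c2 * k4) *\<^sub>R p + (c2 * k3) *\<^sub>R w" unfolding z by (simp add: algebra_simps)
    also have "\<dots> = (c1 + c2 * k4) *\<^sub>R (norm d0 *\<^sub>R d + (p \<bullet> w) *\<^sub>R w) + (c2 * k3) *\<^sub>R w" using pp by simp
    also have "\<dots> = ((c1 + c2 * k4) * (p \<bullet> w) + c2 * k3) *\<^sub>R w + ((c1 + c2 * k4) * norm d0) *\<^sub>R d" by (simp add: algebra_simps)
    finally show ?thesis by blast
  qed
  show ?thesis
  proof (rule that[OF w a wR])
    fix z assume "z \<in> R"
    then obtain s t where z: "z = s *\<^sub>R w + t *\<^sub>R d" using rep by blast
    have dd: "d \<bullet> d = 1" using d by (simp add: dot_square_norm)
    have wd: "w \<bullet> d = 0" using d by (simp add: inner_commute)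
    have "z \<bullet> w = s" "z \<bullet> u / a = t" using w ww d a by (auto simp: z inner_add_left a_def)
    moreover have "norm z = sqrt (s\<^sup>2 + t\<^sup>2)"
      unfolding norm_eq_sqrt_inner z by (simp add: inner_add_left inner_add_right ww dd wd d power2_eq_square)
    ultimately show "norm z = norm (z \<bullet> w, z \<bullet> u / a)" by (simp add: norm_Pair)
  qed
qed

lemma integrable_on_ball_bounded:
  fixes g :: "'a::euclidean_space \<Rightarrow> real"
  assumes [measurable]: "S \<in> sets borel" "g \<in> borel_measurable borel" and "\<And>x. norm x \<le> 1 \<Longrightarrow> \<bar>g x\<bar> \<le> C"
  shows "integrable lborel (\<lambda>x. indicator (S \<inter> cball 0 1) x * g x)"
proof (rule Bochner_Integration.integrable_bound)
  show "integrable lborel (\<lambda>x::'a. C * indicator (cball 0 1) x)"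
    using emeasure_bounded_finite[of "cball (0::'a) 1"] by (intro integrable_mult_right) (simp add: integrable_indicator_iff)
  show "AE x in lborel. norm (indicator (S \<inter> cball 0 1) x * g x) \<le> norm (C * indicator (cball 0 1) x)"
    using assms(3) by (intro AE_I2) (fastforce simp: indicator_def)
  show "(\<lambda>x. indicator (S \<inter> cball 0 1) x * g x) \<in> borel_measurable lborel"
    using assms(1,2) by (auto intro!: borel_measurable_times borel_measurable_indicator)
qed

lemma nn_integral_ball_eq_LINT:
  fixes S :: "'a::euclidean_space set" and h :: "'a \<Rightarrow> real"
  assumes [measurable]: "S \<in> sets borel" "h \<in> borel_measurable borel"
    and h: "\<And>x. x \<in> S \<Longrightarrow> 0 \<le> h x" "\<And>x. norm x \<le> 1 \<Longrightarrow> \<bar>h x\<bar> \<le> C"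
  shows "(\<integral>\<^sup>+ x. ennreal (h x) * indicator {x\<in>S. norm x \<le> 1} x \<partial>lborel) = ennreal (LINT x|lborel. indicator (S \<inter> cball 0 1) x * h x)"
proof -
  have i: "integrable lborel (\<lambda>x. indicator (S \<inter> cball 0 1) x * h x)"
    using h(2) by (intro integrable_on_ball_bounded) auto
  have "(\<integral>\<^sup>+ x. ennreal (h x) * indicator {x\<in>S. norm x \<le> 1} x \<partial>lborel) = (\<integral>\<^sup>+ x. ennreal (indicator (S \<inter> cball 0 1) x * h x) \<partial>lborel)"
    by (intro nn_integral_cong) (auto simp: indicator_def)
  also have "\<dots> = ennreal (LINT x|lborel. indicator (S \<inter> cball 0 1) x * h x)"
    using h(1) by (intro nn_integral_eq_integral[OF i] AE_I2) (auto simp: indicator_def)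
  finally show ?thesis .
qed

text \<open>
  A counterexample would, by \<open>localization\<close>, give counterexamples \<open>Q n\<close> that decrease to a set in a plane. By
  compactness some \<open>Q j\<close> is so close to the plane that \<open>near_planar_cone_mass_ratio\<close> excludes it. The tilt of \<open>u\<close>
  towards \<open>v\<close> and the constant \<open>c' < c\<close> leave room for the factor that is lost in passing to the plane.
\<close>

lemma cone_mass_ratio:
  fixes P :: "'a::euclidean_space set" and u v :: 'a
  assumes dim: "3 \<le> DIM('a)" and P: "closed P" "convex P" and conic: "\<And>x a. x \<in> P \<Longrightarrow> 0 \<le> a \<Longrightarrow> a *\<^sub>R x \<in> P"
    and pointed: "0 < \<kappa>" "\<And>x. x \<in> P \<Longrightarrow> \<kappa> * norm x \<le> x \<bullet> v"
    and mom: "0 \<le> (LINT x|lborel. indicator (P \<inter> cball 0 1) x * (x \<bullet> u))"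
  shows "(1 - 1 / real DIM('a)) ^ (DIM('a) - 1) * (LINT x|lborel. indicator (P \<inter> cball 0 1) x * norm x)
     \<le> (LINT x|lborel. indicator (P \<inter> {x. 0 \<le> x \<bullet> u} \<inter> cball 0 1) x * norm x)"
proof (rule ccontr)
  assume neg: "\<not> ?thesis"
  define c where "c = (1 - 1 / real DIM('a)) ^ (DIM('a) - 1)"
  have c0: "0 < c" using dim by (simp add: c_def)
  have [measurable]: "P \<in> sets borel" using P by simp
  define A where "A = (LINT x|lborel. indicator (P \<inter> cball 0 1) x * norm x)"
  define F where "F y = (LINT x|lborel. indicator (P \<inter> {x. 0 \<le> x \<bullet> y} \<inter> cball 0 1) x * norm x)" for y
  have F0: "0 \<le> F y" for y unfolding F_def by (intro integral_nonneg_AE) simp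
  have lt: "F u < c * A" using neg by (simp add: c_def F_def A_def)
  have intN: "integrable lborel (\<lambda>x. indicator (S \<inter> cball 0 1) x * norm x)" if "S \<in> sets borel" for S :: "'a set"
    using that by (intro integrable_on_ball_bounded[where C = 1]) auto
  have cs: "\<bar>x \<bullet> y\<bar> \<le> norm y" if "norm x \<le> 1" for x y :: 'a
  proof -
    have "\<bar>x \<bullet> y\<bar> \<le> norm x * norm y" by (rule Cauchy_Schwarz_ineq2)
    also have "\<dots> \<le> 1 * norm y" using that by (intro mult_right_mono) auto
    finally show ?thesis by simp
  qed
  have intI: "integrable lborel (\<lambda>x. indicator (S \<inter> cball 0 1) x * (x \<bullet> y))" if "S \<in> sets borel" for S :: "'a set" and y
    using that cs by (intro integrable_on_ball_bounded[where C = "norm y"]) auto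
  have mP: "P \<inter> {x. 0 \<le> x \<bullet> y} \<in> sets borel" for y by measurable
  have A0: "0 < A"
  proof -
    have "0 < c * A" using F0[of u] lt by simp
    then show ?thesis using c0 by (simp add: zero_less_mult_iff)
  qed
  \<comment> \<open>As \<open>\<eta>\<close> tends to zero the halfspaces converge on \<open>P\<close>, including their boundary, because \<open>x \<bullet> v \<ge> 0\<close> there.\<close>
  obtain \<eta> where \<eta>: "0 < \<eta>" "F (u + \<eta> *\<^sub>R v) < c * A"
  proof -
    have lim: "(\<lambda>n. F (u + (1 / real (Suc n)) *\<^sub>R v)) \<longlonglongrightarrow> F u"
      unfolding F_def
    proof (rule integral_dominated_convergence[where w = "\<lambda>x. indicator (P \<inter> cball 0 1) x * norm x"])
      show "AE x in lborel. (\<lambda>n. indicator (P \<inter> {x. 0 \<le> x \<bullet> (u + (1 / real (Suc n)) *\<^sub>R v)} \<inter> cball 0 1) x * norm x)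
          \<longlonglongrightarrow> indicator (P \<inter> {x. 0 \<le> x \<bullet> u} \<inter> cball 0 1) x * norm x"
      proof (intro AE_I2 tendsto_eventually)
        fix x :: 'a
        have "\<forall>\<^sub>F n in sequentially. x \<in> P \<longrightarrow> (0 \<le> x \<bullet> (u + (1 / real (Suc n)) *\<^sub>R v) \<longleftrightarrow> 0 \<le> x \<bullet> u)"
        proof (cases "x \<in> P \<and> x \<bullet> u < 0")
          case True
          have "(\<lambda>n. x \<bullet> (u + (1 / real (Suc n)) *\<^sub>R v)) \<longlonglongrightarrow> x \<bullet> (u + 0 *\<^sub>R v)"
            by (intro tendsto_intros LIMSEQ_inverse_real_of_nat[unfolded inverse_eq_divide])
          then have "\<forall>\<^sub>F n in sequentially. x \<bullet> (u + (1 / real (Suc n)) *\<^sub>R v) < 0"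
            using True by (intro order_tendstoD(2)) auto
          then show ?thesis by (rule eventually_mono) (use True in auto)
        next
          case False
          show ?thesis
          proof (intro always_eventually allI impI)
            fix n assume x: "x \<in> P"
            have "0 \<le> x \<bullet> v" using pointed(2)[OF x] pointed(1) by (meson mult_nonneg_nonneg norm_ge_zero order_less_imp_le order_trans)
            then have "0 \<le> (1 / real (Suc n)) * (x \<bullet> v)" by simp
            then show "0 \<le> x \<bullet> (u + (1 / real (Suc n)) *\<^sub>R v) \<longleftrightarrow> 0 \<le> x \<bullet> u"
              using False x unfolding inner_add_right inner_scaleR_right by linarith
          qed
        qed
        then show "\<forall>\<^sub>F n in sequentially. indicator (P \<inter> {x. 0 \<le> x \<bullet> (u + (1 / real (Suc n)) *\<^sub>R v)} \<inter> cball 0 1) x * norm x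
            = indicator (P \<inter> {x. 0 \<le> x \<bullet> u} \<inter> cball 0 1) x * norm x"
          by (rule eventually_mono) (auto simp: indicator_def)
      qed
      show "AE x in lborel. norm (indicator (P \<inter> {x. 0 \<le> x \<bullet> (u + (1 / real (Suc n)) *\<^sub>R v)} \<inter> cball 0 1) x * norm x)
          \<le> indicator (P \<inter> cball 0 1) x * norm x" for n
        by (intro AE_I2) (auto simp: indicator_def)
      show "(\<lambda>x. indicator (P \<inter> {x. 0 \<le> x \<bullet> u} \<inter> cball 0 1) x * norm x) \<in> borel_measurable lborel"
        by (rule borel_measurable_integrable[OF intN[OF mP]])
      show "(\<lambda>x. indicator (P \<inter> {x. 0 \<le> x \<bullet> (u + (1 / real (Suc n)) *\<^sub>R v)} \<inter> cball 0 1) x * norm x) \<in> borel_measurable lborel" for n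
        by (rule borel_measurable_integrable[OF intN[OF mP]])
      show "integrable lborel (\<lambda>x. indicator (P \<inter> cball 0 1) x * norm x)"
        by (rule intN) simp
    qed
    then have "\<forall>\<^sub>F n in sequentially. F (u + (1 / real (Suc n)) *\<^sub>R v) < c * A"
      using lt by (rule order_tendstoD(2))
    then obtain n where "F (u + (1 / real (Suc n)) *\<^sub>R v) < c * A" by (auto simp: eventually_sequentially)
    then show ?thesis using that[of "1 / real (Suc n)"] by simp
  qed
  define y where "y = u + \<eta> *\<^sub>R v"
  define \<epsilon> where "\<epsilon> = \<eta> * \<kappa>"
  have \<epsilon>: "0 < \<epsilon>" using \<eta> pointed by (simp add: \<epsilon>_def)
  define c' where "c' = (F y / A + c) / 2"
  have "F y / A < c" using \<eta>(2) A0 by (simp add: y_def field_simps)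
  then have c': "F y < c' * A" "c' < c" "0 < c'"
    using A0 c0 F0[of y] by (auto simp: c'_def field_simps add_nonneg_pos)
  \<comment> \<open>\<open>G1\<close> expresses the moment condition with room \<open>\<epsilon>\<close>, and \<open>G2\<close> the failure of the inequality with constant \<open>c'\<close>.\<close>
  define G1 where "G1 x = indicator (P \<inter> cball 0 1) x * (x \<bullet> y - \<epsilon> * norm x)" for x
  define G2 where "G2 x = indicator (P \<inter> cball 0 1) x * ((c' - indicator {x. 0 \<le> x \<bullet> y} x) * norm x)" for x
  have G1_alt: "G1 x = indicator (P \<inter> cball 0 1) x * (x \<bullet> y) - \<epsilon> * (indicator (P \<inter> cball 0 1) x * norm x)" for x
    by (simp add: G1_def algebra_simps)
  have G2_alt: "G2 x = c' * (indicator (P \<inter> cball 0 1) x * norm x) - indicator (P \<inter> {x. 0 \<le> x \<bullet> y} \<inter> cball 0 1) x * norm x" for x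
    by (auto simp: G2_def indicator_def algebra_simps)
  have iG1: "integrable lborel G1" unfolding G1_alt[abs_def] by (intro Bochner_Integration.integrable_diff integrable_mult_right intI intN) auto
  have iG2: "integrable lborel G2" unfolding G2_alt[abs_def] by (intro Bochner_Integration.integrable_diff integrable_mult_right intN) auto
  have posG1: "0 \<le> (LINT x|lborel. G1 x)"
  proof -
    have "0 \<le> (LINT x|lborel. indicator (P \<inter> cball 0 1) x * (x \<bullet> u))" by (rule mom)
    also have "\<dots> \<le> (LINT x|lborel. G1 x)"
    proof (rule integral_mono[OF intI iG1])
      fix x :: 'a
      have "\<epsilon> * norm x \<le> \<eta> * (x \<bullet> v)" if "x \<in> P"
        using mult_left_mono[OF pointed(2)[OF that], of \<eta>] \<eta> by (simp add: \<epsilon>_def mult.assoc)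
      then show "indicator (P \<inter> cball 0 1) x * (x \<bullet> u) \<le> G1 x"
        by (auto simp: G1_def indicator_def y_def inner_add_right)
    qed auto
    finally show ?thesis .
  qed
  have posG2: "0 < (LINT x|lborel. G2 x)"
  proof -
    have "(LINT x|lborel. G2 x) = c' * A - F y"
      unfolding G2_alt[abs_def] A_def F_def
      by (subst Bochner_Integration.integral_diff) (auto intro!: integrable_mult_right intN)
    then show ?thesis using c' by simp
  qed
  obtain a :: "nat \<Rightarrow> 'a" where
    a1: "\<And>n. 0 \<le> (LINT x|lborel. indicator {x. \<forall>k<n. 0 \<le> x \<bullet> a k} x * G1 x)" and
    a2: "\<And>n. 0 < (LINT x|lborel. indicator {x. \<forall>k<n. 0 \<le> x \<bullet> a k} x * G2 x)" and
    a3: "\<And>p1 p2 p3. (\<And>k. 0 \<le> p1 \<bullet> a k \<and> 0 \<le> p2 \<bullet> a k \<and> 0 \<le> p3 \<bullet> a k) \<Longrightarrow> p1 \<noteq> p2 \<Longrightarrow> p1 \<noteq> p3 \<Longrightarrow> p2 \<noteq> p3 \<Longrightarrow> dependent {p1, p2, p3}"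
  proof (rule localization[OF iG1 iG2 posG1 posG2], goal_cases)
    case (1 a)
    show thesis
      by (rule 1(1)[of a]; (rule 1(2) | rule 1(3) | (rule 1(4); blast)))
  qed
  define Q where "Q n = P \<inter> (\<Inter>k<n. {x. 0 \<le> a k \<bullet> x})" for n
  have Qmem: "x \<in> Q n \<longleftrightarrow> x \<in> P \<and> (\<forall>k<n. 0 \<le> x \<bullet> a k)" for x n by (auto simp: Q_def inner_commute)
  have Qcl: "closed (Q n)" for n unfolding Q_def using P by (intro closed_Int closed_INT) (auto simp: closed_halfspace_ge)
  have Qcv: "convex (Q n)" for n unfolding Q_def using P by (intro convex_Int convex_INT) (auto simp: convex_halfspace_ge)
  have Qco: "s *\<^sub>R x \<in> Q n" if "x \<in> Q n" "0 \<le> s" for s x n using that conic by (auto simp: Qmem)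
  have Qmeas[measurable]: "Q n \<in> sets borel" for n using Qcl by simp
  have indQ: "indicator {x. \<forall>k<n. 0 \<le> x \<bullet> a k} x * (indicator (P \<inter> cball 0 1) x * g) = indicator (Q n \<inter> cball 0 1) x * g" for n x and g :: real
    by (auto simp: indicator_def Qmem)
  \<comment> \<open>A closed condition that can be met by a unit vector in each \<open>Q n\<close> can be met in all of them at once.\<close>
  have limpt: "\<exists>x. (\<forall>n. x \<in> Q n) \<and> norm x = 1 \<and> T x"
    if T: "closed {x. T x}" and ne: "\<And>n. \<exists>x\<in>Q n. norm x = 1 \<and> T x" for T
  proof -
    define Z where "Z n = Q n \<inter> sphere 0 1 \<inter> {x. T x}" for n
    have "compact (Z n)" for n unfolding Z_def using Qcl T by (intro compact_Int_closed closed_Int_compact) auto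
    moreover have "Z n \<noteq> {}" for n using ne[of n] by (auto simp: Z_def)
    moreover have "Z n \<subseteq> Z k" if "k \<le> n" for k n using that by (auto simp: Z_def Qmem)
    ultimately have "\<Inter> (range Z) \<noteq> {}" by (rule compact_nest)
    then obtain x where "\<And>n. x \<in> Z n" by blast
    then show ?thesis by (auto simp: Z_def)
  qed
  have unit: "(1 / norm x) *\<^sub>R x \<in> Q n \<and> norm ((1 / norm x) *\<^sub>R x) = 1" if "x \<in> Q n" "x \<noteq> 0" for x n
    using that Qco[of x n "1 / norm x"] by simp
  define N where "N S = (LINT x|lborel. indicator (S \<inter> cball 0 1) x * norm x)" for S :: "'a set"
  define M where "M S = (LINT x|lborel. indicator (S \<inter> cball 0 1) x * \<bar>x \<bullet> y\<bar>)" for S :: "'a set"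
  have f1: "\<epsilon> * N (Q n) \<le> (LINT x|lborel. indicator (Q n \<inter> cball 0 1) x * (x \<bullet> y))" for n
  proof -
    have "0 \<le> (LINT x|lborel. indicator (Q n \<inter> cball 0 1) x * (x \<bullet> y - \<epsilon> * norm x))"
      using a1[of n] unfolding G1_def indQ .
    also have "\<dots> = (LINT x|lborel. indicator (Q n \<inter> cball 0 1) x * (x \<bullet> y) - \<epsilon> * (indicator (Q n \<inter> cball 0 1) x * norm x))"
      by (intro Bochner_Integration.integral_cong) (auto simp: algebra_simps)
    also have "\<dots> = (LINT x|lborel. indicator (Q n \<inter> cball 0 1) x * (x \<bullet> y)) - \<epsilon> * N (Q n)"
      unfolding N_def by (subst Bochner_Integration.integral_diff) (auto intro!: integrable_mult_right intN intI)
    finally show ?thesis by simp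
  qed
  have f2: "N (Q n \<inter> {x. 0 \<le> x \<bullet> y}) < c' * N (Q n)" for n
  proof -
    have "0 < (LINT x|lborel. indicator (Q n \<inter> cball 0 1) x * ((c' - indicator {x. 0 \<le> x \<bullet> y} x) * norm x))"
      using a2[of n] unfolding G2_def indQ .
    also have "\<dots> = (LINT x|lborel. c' * (indicator (Q n \<inter> cball 0 1) x * norm x) - indicator (Q n \<inter> {x. 0 \<le> x \<bullet> y} \<inter> cball 0 1) x * norm x)"
      by (intro Bochner_Integration.integral_cong) (auto simp: algebra_simps indicator_def)
    also have "\<dots> = c' * N (Q n) - N (Q n \<inter> {x. 0 \<le> x \<bullet> y})"
      unfolding N_def by (subst Bochner_Integration.integral_diff) (auto intro!: integrable_mult_right intN)
    finally show ?thesis by simp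
  qed
  have N0: "0 \<le> N S" for S unfolding N_def by (intro integral_nonneg_AE) simp
  have Npos: "0 < N (Q n)" for n
  proof -
    have "0 < c' * N (Q n)" using f2[of n] N0[of "Q n \<inter> {x. 0 \<le> x \<bullet> y}"] by linarith
    then show ?thesis using c' by (simp add: zero_less_mult_iff)
  qed
  \<comment> \<open>The limit set contains a point with \<open>p \<bullet> y > 0\<close>, so \<open>y\<close> does not vanish on the limiting plane.\<close>
  have "\<exists>x\<in>Q n. norm x = 1 \<and> \<epsilon> \<le> x \<bullet> y" for n
  proof (rule ccontr)
    assume no: "\<not> ?thesis"
    have neg: "x \<bullet> y < \<epsilon> * norm x" if x: "x \<in> Q n" "x \<noteq> 0" for x
    proof -
      have "((1 / norm x) *\<^sub>R x) \<bullet> y < \<epsilon>" using no unit[OF x] by (meson not_le)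
      then show ?thesis using x by (simp add: field_simps)
    qed
    define h where "h x = indicator (Q n \<inter> cball 0 1) x * (\<epsilon> * norm x - x \<bullet> y)" for x
    have h_alt: "h x = \<epsilon> * (indicator (Q n \<inter> cball 0 1) x * norm x) - indicator (Q n \<inter> cball 0 1) x * (x \<bullet> y)" for x
      by (simp add: h_def algebra_simps)
    have ih: "integrable lborel h" unfolding h_alt[abs_def] by (intro Bochner_Integration.integrable_diff integrable_mult_right intI intN) auto
    have h0: "0 \<le> h x" for x using neg[of x] by (cases "x = 0") (auto simp: h_def indicator_def)
    have "(LINT x|lborel. h x) = \<epsilon> * N (Q n) - (LINT x|lborel. indicator (Q n \<inter> cball 0 1) x * (x \<bullet> y))"
      unfolding h_alt[abs_def] N_def by (subst Bochner_Integration.integral_diff) (auto intro!: integrable_mult_right intN intI)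
    then have "(LINT x|lborel. h x) \<le> 0" using f1[of n] by simp
    moreover have "0 \<le> (LINT x|lborel. h x)" using h0 by (intro integral_nonneg_AE) simp
    ultimately have "(LINT x|lborel. h x) = 0" by simp
    then have "AE x in lborel. h x = 0" using integral_nonneg_eq_0_iff_AE[OF ih] h0 by simp
    then have "AE x in lborel. indicator (Q n \<inter> cball 0 1) x * norm x = 0"
    proof (rule eventually_mono)
      fix x assume "h x = 0"
      then show "indicator (Q n \<inter> cball 0 1) x * norm x = 0" using neg[of x] by (cases "x = 0") (auto simp: h_def indicator_def)
    qed
    then have "N (Q n) = 0" unfolding N_def by (rule integral_eq_zero_AE)
    then show False using Npos[of n] by simp
  qed
  then obtain p where p: "\<And>n. p \<in> Q n" "norm p = 1" "\<epsilon> \<le> p \<bullet> y"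
    using limpt[of "\<lambda>x. \<epsilon> \<le> x \<bullet> y"] closed_halfspace_ge[of \<epsilon> y] by (auto simp: inner_commute)
  define R where "R = (\<Inter>n. Q n)"
  have RP: "x \<in> P" if "x \<in> R" for x using that by (auto simp: R_def Qmem)
  have Ra: "0 \<le> x \<bullet> a k" if "x \<in> R" for x k using that by (auto simp: R_def Qmem)
  obtain w s where w: "norm w = 1" "w \<bullet> y = 0" and s: "0 < s" and wR: "- w \<notin> R"
    and Rnorm: "\<And>z. z \<in> R \<Longrightarrow> norm z = norm (z \<bullet> w, z \<bullet> y / s)"
  proof (rule ex_adapted_plane[OF dim, of p R y \<kappa> v])
    show "p \<in> R" using p by (simp add: R_def)
    show "0 < p \<bullet> y" using p \<epsilon> by simp
    show "dependent {x, x', x''}" if "x \<in> R" "x' \<in> R" "x'' \<in> R" "x \<noteq> x'" "x \<noteq> x''" "x' \<noteq> x''" for x x' x''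
      using that Ra by (intro a3) auto
  qed (use pointed RP that in auto)
  define z where "z = (1 / s) *\<^sub>R y"
  have y0: "y \<noteq> 0" using p \<epsilon> by auto
  have z: "z \<noteq> 0" "\<And>x. x \<bullet> z = x \<bullet> y / s" using y0 s by (auto simp: z_def)
  define r where "r x = norm (x \<bullet> w, x \<bullet> z)" for x
  have r_hom: "r (k *\<^sub>R x) = k * r x" if "0 \<le> k" for k x
  proof -
    have "((k *\<^sub>R x) \<bullet> w, (k *\<^sub>R x) \<bullet> z) = k *\<^sub>R (x \<bullet> w, x \<bullet> z)" by simp
    then show ?thesis using that unfolding r_def by (metis abs_of_nonneg norm_scaleR)
  qed
  \<comment> \<open>\<open>\<mu>\<close> is the loss that both the constant and the moment condition can bear, and \<open>b\<close> spreads it over the exponent in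
    \<open>near_planar_cone_mass_ratio\<close>.\<close>
  define \<mu> where "\<mu> = min (c / c') (1 + \<epsilon> / norm y)"
  have \<mu>: "1 < \<mu>" using c' \<epsilon> y0 by (simp add: \<mu>_def)
  define k where "k = 2 * (DIM('a) + 2)"
  define b where "b = root k \<mu>"
  have k: "0 < k" by (simp add: k_def)
  have b: "1 < b" "b ^ k = \<mu>" using \<mu> k by (auto simp: b_def real_root_gt_1_iff)
  \<comment> \<open>On the limit set \<open>r x = norm x\<close>, so this holds up to the factor \<open>b\<close> from some \<open>j\<close> on.\<close>
  have "\<exists>j. \<forall>x\<in>Q j. norm x = 1 \<longrightarrow> \<not> (b * r x \<le> 1 \<or> b \<le> r x)"
  proof (rule ccontr)
    assume "\<not> ?thesis"
    then have "\<exists>x. (\<forall>n. x \<in> Q n) \<and> norm x = 1 \<and> (b * r x \<le> 1 \<or> b \<le> r x)"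
      by (intro limpt) (auto simp: r_def intro!: closed_Collect_disj closed_Collect_le continuous_intros)
    then obtain x where x: "x \<in> R" "norm x = 1" "b * r x \<le> 1 \<or> b \<le> r x" by (auto simp: R_def)
    have "r x = 1" using Rnorm[OF x(1)] x(2) by (simp add: r_def z)
    then show False using x(3) b by simp
  qed
  then obtain j1 where j1: "\<And>x. x \<in> Q j1 \<Longrightarrow> norm x = 1 \<Longrightarrow> 1 < b * r x \<and> r x < b" by (metis not_le)
  have "\<exists>j. \<forall>x\<in>Q j. norm x = 1 \<longrightarrow> \<not> (x \<bullet> y = 0 \<and> x \<bullet> w \<le> 0)"
  proof (rule ccontr)
    assume "\<not> ?thesis"
    then have "\<exists>x. (\<forall>n. x \<in> Q n) \<and> norm x = 1 \<and> (x \<bullet> y = 0 \<and> x \<bullet> w \<le> 0)"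
      by (intro limpt) (auto intro!: closed_Collect_conj closed_Collect_le closed_Collect_eq continuous_intros)
    then obtain x where x: "x \<in> R" "norm x = 1" "x \<bullet> y = 0" "x \<bullet> w \<le> 0" by (auto simp: R_def)
    have "\<bar>x \<bullet> w\<bar> = 1" using Rnorm[OF x(1)] x(2,3) by (simp add: norm_Pair)
    then have xw: "x \<bullet> w = - 1" using x(4) by simp
    have "(norm (x + w))\<^sup>2 = 0"
      unfolding power2_norm_eq_inner inner_add_left inner_add_right
      using xw x(2) w(1) by (simp add: dot_square_norm inner_commute[of w x])
    then have "x = - w" by (simp add: eq_neg_iff_add_eq_0)
    then show False using x(1) wR by simp
  qed
  then obtain j2 where j2: "\<And>x. x \<in> Q j2 \<Longrightarrow> norm x = 1 \<Longrightarrow> \<not> (x \<bullet> y = 0 \<and> x \<bullet> w \<le> 0)" by metis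
  define j where "j = max j1 j2"
  have Qj: "x \<in> Q j1" "x \<in> Q j2" if "x \<in> Q j" for x using that by (auto simp: Qmem j_def)
  have near: "norm x \<le> b * r x \<and> r x \<le> b * norm x" if x: "x \<in> Q j" for x
  proof (cases "x = 0")
    case True then show ?thesis by (simp add: r_def)
  next
    case False
    define x' where "x' = (1 / norm x) *\<^sub>R x"
    have "x' \<in> Q j1" "norm x' = 1" using unit[OF Qj(1)[OF x] False] by (auto simp: x'_def)
    from j1[OF this] have "1 < b * r x'" "r x' < b" by auto
    moreover have "r x' = r x / norm x" using r_hom[of "1 / norm x" x] by (simp add: x'_def)
    ultimately show ?thesis using False by (simp add: field_simps)
  qed
  have axis: "0 < x \<bullet> w" if x: "x \<in> Q j" "x \<bullet> z = 0" "x \<noteq> 0" for x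
  proof (rule ccontr)
    assume "\<not> ?thesis"
    moreover have "x \<bullet> y = 0" using x(2) s by (simp add: z)
    moreover note j2[of "(1 / norm x) *\<^sub>R x"] unit[OF Qj(2)[OF x(1)] x(3)]
    ultimately show False using x(3) by (auto simp: divide_nonpos_pos)
  qed
  define up where "up = Q j \<inter> {x. 0 \<le> x \<bullet> y}"
  define dn where "dn = Q j \<inter> {x. x \<bullet> y \<le> 0}"
  have [measurable]: "up \<in> sets borel" "dn \<in> sets borel" unfolding up_def dn_def by measurable
  have upz: "{x\<in>Q j. 0 \<le> x \<bullet> z} = up" and dnz: "{x\<in>Q j. x \<bullet> z \<le> 0} = dn"
    using s by (auto simp: up_def dn_def z zero_le_divide_iff divide_le_0_iff)
  have intM: "integrable lborel (\<lambda>x. indicator (S \<inter> cball 0 1) x * \<bar>x \<bullet> y\<bar>)" if "S \<in> sets borel" for S :: "'a set"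
    using that cs by (intro integrable_on_ball_bounded[where C = "norm y"]) auto
  have M0: "0 \<le> M S" for S unfolding M_def by (intro integral_nonneg_AE) simp
  have nnN: "(\<integral>\<^sup>+ x. ennreal (norm x) * indicator {x\<in>S. norm x \<le> 1} x \<partial>lborel) = ennreal (N S)" if "S \<in> sets borel" for S :: "'a set"
    unfolding N_def using that by (intro nn_integral_ball_eq_LINT[where C = 1]) auto
  have nnM: "(\<integral>\<^sup>+ x. ennreal \<bar>x \<bullet> z\<bar> * indicator {x\<in>S. norm x \<le> 1} x \<partial>lborel) = ennreal (M S / s)" if [measurable]: "S \<in> sets borel" for S :: "'a set"
  proof -
    have "(\<integral>\<^sup>+ x. ennreal \<bar>x \<bullet> z\<bar> * indicator {x\<in>S. norm x \<le> 1} x \<partial>lborel) = (\<integral>\<^sup>+ x. ennreal ((1 / s) * (indicator (S \<inter> cball 0 1) x * \<bar>x \<bullet> y\<bar>)) \<partial>lborel)"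
      using s by (intro nn_integral_cong) (auto simp: indicator_def z abs_divide)
    also have "\<dots> = ennreal (LINT x|lborel. (1 / s) * (indicator (S \<inter> cball 0 1) x * \<bar>x \<bullet> y\<bar>))"
      using s by (intro nn_integral_eq_integral integrable_mult_right intM that) auto
    also have "(LINT x|lborel. (1 / s) * (indicator (S \<inter> cball 0 1) x * \<bar>x \<bullet> y\<bar>)) = M S / s"
      unfolding M_def by simp
    finally show ?thesis .
  qed
  have MleN: "M S \<le> norm y * N S" if [measurable]: "S \<in> sets borel" for S
  proof -
    have "M S \<le> (LINT x|lborel. norm y * (indicator (S \<inter> cball 0 1) x * norm x))"
      unfolding M_def
    proof (rule integral_mono[OF intM[OF that] integrable_mult_right[OF intN[OF that]]])
      fix x show "indicator (S \<inter> cball 0 1) x * \<bar>x \<bullet> y\<bar> \<le> norm y * (indicator (S \<inter> cball 0 1) x * norm x)"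
        using Cauchy_Schwarz_ineq2[of x y] by (auto simp: indicator_def mult.commute)
    qed
    then show ?thesis unfolding N_def by simp
  qed
  have split: "\<epsilon> * N (Q j) \<le> M up - M dn"
  proof -
    have "M up - M dn = (LINT x|lborel. indicator (up \<inter> cball 0 1) x * \<bar>x \<bullet> y\<bar> - indicator (dn \<inter> cball 0 1) x * \<bar>x \<bullet> y\<bar>)"
      unfolding M_def by (rule Bochner_Integration.integral_diff[symmetric]) (auto intro!: intM)
    also have "\<dots> = (LINT x|lborel. indicator (Q j \<inter> cball 0 1) x * (x \<bullet> y))"
      by (intro Bochner_Integration.integral_cong) (auto simp: up_def dn_def indicator_def)
    finally show ?thesis using f1[of j] by simp
  qed
  have Nsplit: "N (Q j) \<le> N up + N dn"
  proof -
    have "N (Q j) \<le> (LINT x|lborel. indicator (up \<inter> cball 0 1) x * norm x + indicator (dn \<inter> cball 0 1) x * norm x)"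
      unfolding N_def by (intro integral_mono Bochner_Integration.integrable_add intN) (auto simp: up_def dn_def indicator_def)
    also have "\<dots> = N up + N dn" unfolding N_def by (rule Bochner_Integration.integral_add) (auto intro!: intN)
    finally show ?thesis .
  qed
  have Ndn: "N dn \<le> N (Q j)"
    unfolding N_def by (intro integral_mono intN) (auto simp: dn_def indicator_def)
  have "\<mu> * M dn \<le> (1 + \<epsilon> / norm y) * M dn" unfolding \<mu>_def using M0 by (intro mult_right_mono) auto
  also have "\<dots> = M dn + \<epsilon> * (M dn / norm y)" by (simp add: algebra_simps)
  also have "\<dots> \<le> M dn + \<epsilon> * N dn" using MleN[of dn] y0 \<epsilon> by (intro add_left_mono mult_left_mono) (auto simp: field_simps)
  also have "\<dots> \<le> M dn + \<epsilon> * N (Q j)" using Ndn \<epsilon> by (intro add_left_mono mult_left_mono) auto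
  also have "\<dots> \<le> M up" using split by simp
  finally have mom': "\<mu> * M dn \<le> M up" .
  have "0 < \<epsilon> * N (Q j)" using \<epsilon> Npos by simp
  then have "0 < norm y * N up" using split M0[of dn] MleN[of up] by simp
  then have Nup: "0 < N up" using y0 by (simp add: zero_less_mult_iff)
  have wz: "w \<noteq> t *\<^sub>R z" for t
  proof
    assume "w = t *\<^sub>R z"
    then have "w \<bullet> w = t * (w \<bullet> z)" by (metis inner_scaleR_right)
    then show False using w by (simp add: z dot_square_norm)
  qed
  have "ennreal c * (ennreal (N up) + ennreal (N dn)) \<le> ennreal (b ^ k) * ennreal (N up)"
  proof -
    have "ennreal (b ^ k) * ennreal (M dn / s) \<le> ennreal (M up / s)"
    proof -
      have "\<mu> * (M dn / s) \<le> M up / s" using divide_right_mono[OF mom', of s] s by simp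
      then show ?thesis
        unfolding b(2) using s \<mu> M0[of dn] by (subst ennreal_mult[symmetric]) (auto intro!: ennreal_leI)
    qed
    then show ?thesis
      using near_planar_cone_mass_ratio[OF dim Qcl Qcv _ z(1) wz, of j b] Qco[of _ j] b(1) near axis Nup
      unfolding upz dnz r_def c_def k_def by (simp add: nnN nnM)
  qed
  then have "c * (N up + N dn) \<le> \<mu> * N up"
    using c0 \<mu> N0[of up] N0[of dn] unfolding b(2) by (simp add: ennreal_mult[symmetric] ennreal_plus[symmetric] del: ennreal_plus)
  moreover have "c * N (Q j) \<le> c * (N up + N dn)" using Nsplit c0 by (intro mult_left_mono) auto
  ultimately have "c * N (Q j) \<le> \<mu> * N up" by linarith
  also have "\<dots> < \<mu> * (c' * N (Q j))" using f2[of j] \<mu> by (simp add: up_def)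
  also have "\<dots> \<le> (c / c') * (c' * N (Q j))" using c' Npos[of j] by (intro mult_right_mono) (auto simp: \<mu>_def)
  also have "\<dots> = c * N (Q j)" using c' by simp
  finally show False by simp
qed

section \<open>Cones and the spherical measure\<close>

lemma emeasure_conic_ball:
  fixes S :: "'a::euclidean_space set"
  assumes [measurable]: "S \<in> sets borel" and conic: "\<And>x a. x \<in> S \<Longrightarrow> 0 < a \<Longrightarrow> a *\<^sub>R x \<in> S" and s: "0 < s"
  shows "emeasure lborel (S \<inter> cball 0 s) = ennreal (s ^ DIM('a)) * emeasure lborel (S \<inter> cball 0 1)"
proof -
  have "emeasure lborel (S \<inter> cball 0 s) = (\<integral>\<^sup>+ x. indicator (S \<inter> cball 0 s) x \<partial>lborel)" by simp
  also have "\<dots> = ennreal (s ^ DIM('a)) * (\<integral>\<^sup>+ x. indicator (S \<inter> cball 0 s) (s *\<^sub>R x) \<partial>lborel)"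
    using s by (intro nn_integral_lborel_scale) (auto intro!: borel_measurable_indicator)
  also have "(\<integral>\<^sup>+ x. indicator (S \<inter> cball 0 s) (s *\<^sub>R x) \<partial>lborel) = (\<integral>\<^sup>+ x. indicator (S \<inter> cball 0 1) x \<partial>(lborel :: 'a measure))"
  proof (rule nn_integral_cong)
    fix x :: 'a
    have "s *\<^sub>R x \<in> S \<longleftrightarrow> x \<in> S" using conic[of x s] conic[of "s *\<^sub>R x" "1 / s"] s by auto
    then show "(indicator (S \<inter> cball 0 s) (s *\<^sub>R x) :: ennreal) = indicator (S \<inter> cball 0 1) x"
      using s by (simp add: indicator_def)
  qed
  finally show ?thesis by simp
qed

text \<open>
  The part of \<open>S\<close> with \<open>s < norm x \<le> 1\<close> has \<open>1 - s ^ n\<close> times the volume \<open>V\<close> of \<open>S \<inter> cball 0 1\<close>, and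
  integrating over the levels \<open>s\<close> gives \<open>n / (n + 1) * V\<close>.
\<close>

lemma conic_norm_integral:
  fixes S :: "'a::euclidean_space set"
  assumes [measurable]: "S \<in> sets borel" and conic: "\<And>x a. x \<in> S \<Longrightarrow> 0 < a \<Longrightarrow> a *\<^sub>R x \<in> S"
  shows "real (DIM('a) + 1) * (LINT x|lborel. indicator (S \<inter> cball 0 1) x * norm x) = real DIM('a) * measure lborel (S \<inter> cball 0 1)"
proof -
  define V where "V = measure lborel (S \<inter> cball 0 1)"
  have fin: "emeasure lborel (S \<inter> cball 0 1) < \<infinity>"
    by (intro emeasure_bounded_finite bounded_Int) auto
  have V: "emeasure lborel (S \<inter> cball 0 1) = ennreal V" "0 \<le> V"
    using fin by (auto simp: V_def emeasure_eq_ennreal_measure)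
  define f where "f x = indicator (S \<inter> cball 0 1) x * norm x" for x
  have fm[measurable]: "f \<in> borel_measurable borel"
    unfolding f_def[abs_def] by (intro borel_measurable_times borel_measurable_indicator) auto
  have f01: "0 \<le> f x" "f x \<le> 1" for x by (auto simp: f_def indicator_def)
  have int: "integrable lborel f" unfolding f_def[abs_def]
    by (rule integrable_on_ball_bounded[where C = 1]) auto
  obtain k where k: "DIM('a) = Suc k" using DIM_positive[where 'a = 'a] by (metis Suc_pred)
  have lev: "emeasure lborel {x. s < f x} + ennreal (s ^ DIM('a)) * ennreal V = ennreal V" if s: "0 < s" "s < 1" for s
  proof -
    have sub: "S \<inter> cball 0 s \<subseteq> S \<inter> cball 0 1" using s by auto
    have "{x. s < f x} = (S \<inter> cball 0 1) - (S \<inter> cball 0 s)" using s by (auto simp: f_def indicator_def split: if_splits)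
    then have "emeasure lborel {x. s < f x} + emeasure lborel (S \<inter> cball 0 s) = emeasure lborel ((S \<inter> cball 0 1 - S \<inter> cball 0 s) \<union> (S \<inter> cball 0 s))"
      by (subst plus_emeasure) auto
    also have "(S \<inter> cball 0 1 - S \<inter> cball 0 s) \<union> (S \<inter> cball 0 s) = S \<inter> cball 0 1" using sub by auto
    finally show ?thesis using emeasure_conic_ball[OF assms(1) conic s(1)] V by simp
  qed
  have "(\<integral>\<^sup>+ s. indicator {0<..<1} s * emeasure lborel {x. s < f x} \<partial>lborel) = (\<integral>\<^sup>+ x. ennreal (f x) \<partial>lborel)"
    using f01 by (subst layer_cake_unit) (auto simp: min_def intro!: nn_integral_cong antisym)
  also have "\<dots> = ennreal (LINT x|lborel. f x)"
    using f01 by (intro nn_integral_eq_integral int) auto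
  finally have 1: "(\<integral>\<^sup>+ s. indicator {0<..<1} s * emeasure lborel {x. s < f x} \<partial>lborel) = ennreal (LINT x|lborel. f x)" .
  have 2: "(\<integral>\<^sup>+ s. indicator {0<..<1} s * (ennreal (s ^ DIM('a)) * ennreal V) \<partial>lborel) = ennreal (1 / (real k + 2)) * ennreal V"
  proof -
    have "(\<integral>\<^sup>+ s. indicator {0<..<1} s * (ennreal (s ^ DIM('a)) * ennreal V) \<partial>lborel) = (\<integral>\<^sup>+ s. (ennreal (s ^ Suc k) * indicator {0<..1} s) * ennreal V \<partial>lborel)"
    proof (rule nn_integral_cong_AE)
      show "AE s in lborel. indicator {0<..<1} s * (ennreal (s ^ DIM('a)) * ennreal V) = (ennreal (s ^ Suc k) * indicator {0<..1} s) * ennreal V"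
        using AE_lborel_singleton[of "1::real"] by (rule eventually_mono) (auto simp: indicator_def k)
    qed
    also have "\<dots> = (\<integral>\<^sup>+ s. ennreal (s ^ Suc k) * indicator {0<..1} s \<partial>lborel) * ennreal V"
      by (rule nn_integral_multc) auto
    also have "(\<integral>\<^sup>+ s. ennreal (s ^ Suc k) * indicator {0<..1} s \<partial>lborel) = ennreal (1 / (real k + 2))"
      using nn_integral_power_Icc[of 1 k] by simp
    finally show ?thesis .
  qed
  have mlev: "(\<lambda>s. emeasure lborel {x. s < f x}) \<in> borel_measurable borel"
  proof -
    have "(\<lambda>s. emeasure lborel {x. s < f x}) = (\<lambda>s. \<integral>\<^sup>+ x. indicator {x. s < f x} x \<partial>lborel)" by (intro ext) simp
    moreover have "(\<lambda>s. \<integral>\<^sup>+ x. indicator {x. s < f x} x \<partial>(lborel::'a measure)) \<in> borel_measurable borel"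
      by (intro lborel.borel_measurable_nn_integral) (simp add: indicator_def case_prod_beta)
    ultimately show ?thesis by simp
  qed
  have "ennreal (LINT x|lborel. f x) + ennreal (1 / (real k + 2)) * ennreal V
     = (\<integral>\<^sup>+ s. indicator {0<..<1} s * emeasure lborel {x. s < f x} + indicator {0<..<1} s * (ennreal (s ^ DIM('a)) * ennreal V) \<partial>lborel)"
    unfolding 1[symmetric] 2[symmetric] using mlev by (intro nn_integral_add[symmetric]) auto
  also have "\<dots> = (\<integral>\<^sup>+ s. ennreal V * indicator {0<..<1::real} s \<partial>lborel)"
    by (intro nn_integral_cong) (auto simp: indicator_def lev)
  also have "\<dots> = ennreal V" by (subst nn_integral_cmult_indicator) auto
  finally have "(LINT x|lborel. f x) + 1 / (real k + 2) * V = V"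
    using V(2) integral_nonneg_AE[of f lborel] f01 by (simp add: ennreal_mult[symmetric] ennreal_plus[symmetric] del: ennreal_plus)
  then have "(LINT x|lborel. f x) * (real k + 2) = V * (real k + 1)" by (simp add: field_simps)
  then show ?thesis unfolding f_def V_def[symmetric] k by (simp add: algebra_simps)
qed

text \<open>
  The spherical measure is \<open>n\<close> times the volume of the sector; the weight \<open>norm x\<close> is preferred to the volume because it has
  the same degree as the moment \<open>x \<bullet> u\<close>.
\<close>

lemma sphere_measure_conic:
  fixes S :: "'a::euclidean_space set"
  assumes [measurable]: "S \<in> sets borel" and conic: "\<And>x a. x \<in> S \<Longrightarrow> 0 < a \<Longrightarrow> a *\<^sub>R x \<in> S"
  shows "measure sphere_measure (S \<inter> sphere 0 1) = real (DIM('a) + 1) * (LINT x|lborel. indicator (S \<inter> cball 0 1) x * norm x)"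
proof -
  have eq: "{t *\<^sub>R \<xi> | t \<xi>. 0 < t \<and> t \<le> 1 \<and> \<xi> \<in> S \<inter> sphere 0 1} = (S \<inter> cball 0 1) - {0}" (is "?L = ?R")
  proof
    show "?L \<subseteq> ?R" using conic by auto
    show "?R \<subseteq> ?L"
    proof
      fix x assume x: "x \<in> ?R"
      then have "x = norm x *\<^sub>R ((1 / norm x) *\<^sub>R x)" "0 < norm x" "norm x \<le> 1" "(1 / norm x) *\<^sub>R x \<in> S \<inter> sphere 0 1"
        using conic[of x "1 / norm x"] by auto
      then show "x \<in> ?L" by blast
    qed
  qed
  have "emeasure sphere_measure (S \<inter> sphere 0 1) = of_nat DIM('a) * emeasure lborel ((S \<inter> cball 0 1) - {0})"
    unfolding eq[symmetric] by (rule emeasure_sphere_measure) auto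
  also have "emeasure lborel ((S \<inter> cball 0 1) - {0}) = emeasure lborel (S \<inter> cball 0 1)"
  proof (rule emeasure_eq_AE)
    show "AE x in lborel. (x \<in> (S \<inter> cball 0 1) - {0}) = (x \<in> S \<inter> cball 0 1)"
      using AE_lborel_singleton[of "0::'a"] by (rule eventually_mono) auto
  qed auto
  finally have "measure sphere_measure (S \<inter> sphere 0 1) = real DIM('a) * measure lborel (S \<inter> cball 0 1)"
    by (simp add: measure_def enn2real_mult)
  then show ?thesis using conic_norm_integral[OF assms(1) conic] by simp
qed

lemma sector_eq_cone_ball:
  assumes "A = P \<inter> sphere 0 1" and conic: "\<And>x a. x \<in> P \<Longrightarrow> 0 \<le> a \<Longrightarrow> a *\<^sub>R x \<in> P" and ne: "A \<noteq> {}"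
  shows "sector A = P \<inter> cball 0 1"
proof
  show "sector A \<subseteq> P \<inter> cball 0 1" using assms by (auto simp: sector_def)
  show "P \<inter> cball 0 1 \<subseteq> sector A"
  proof
    fix x assume x: "x \<in> P \<inter> cball 0 1"
    show "x \<in> sector A"
    proof (cases "x = 0")
      case True
      obtain \<xi> where "\<xi> \<in> A" using ne by auto
      then show ?thesis unfolding sector_def using True by (auto intro!: exI[of _ 0] exI[of _ \<xi>])
    next
      case False
      then have "(1 / norm x) *\<^sub>R x \<in> A" using x conic[of x "1 / norm x"] assms(1) by auto
      moreover have "x = norm x *\<^sub>R ((1 / norm x) *\<^sub>R x)" using False by simp
      ultimately show ?thesis using x unfolding sector_def by (auto intro!: exI[of _ "norm x"] exI[of _ "(1 / norm x) *\<^sub>R x"])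
    qed
  qed
qed

lemma spherical_centroid_orthogonal_iff:
  fixes A :: "'a::euclidean_space set"
  assumes A: "convex_body (sector A)"
  shows "u \<bullet> spherical_centroid A = 0 \<longleftrightarrow> (LINT x|lborel. indicator (sector A) x * (x \<bullet> u)) = 0"
proof -
  let ?C = "sector A"
  have C: "compact ?C" "interior ?C \<noteq> {}" using A by (auto simp: convex_body_def)
  have [measurable]: "?C \<in> sets borel" using C(1) by (auto dest: compact_imp_closed)
  have "integrable lborel (\<lambda>x. indicator ?C x *\<^sub>R x)"
  proof -
    obtain B where B: "\<And>x. x \<in> ?C \<Longrightarrow> norm x \<le> B" using compact_imp_bounded[OF C(1)] by (auto simp: bounded_iff)
    show ?thesis
    proof (rule Bochner_Integration.integrable_bound)
      show "integrable lborel (\<lambda>x. B * indicator ?C x)"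
        using emeasure_compact_finite[OF C(1)] by (intro integrable_mult_right) (simp add: integrable_indicator_iff)
      show "AE x in lborel. norm (indicator ?C x *\<^sub>R x) \<le> norm (B * indicator ?C x)"
        using B by (intro AE_I2) (auto simp: indicator_def intro: order_trans[OF _ abs_ge_self])
    qed measurable
  qed
  then have "(LINT x|lborel. indicator ?C x *\<^sub>R x) \<bullet> u = (LINT x|lborel. (indicator ?C x *\<^sub>R x) \<bullet> u)"
    by (rule integral_inner_left[symmetric, rotated])
  then have i: "(LINT x:?C|lborel. x) \<bullet> u = (LINT x|lborel. indicator ?C x * (x \<bullet> u))"
    by (simp add: set_lebesgue_integral_def)
  have "measure lborel ?C \<noteq> 0"
  proof
    assume "measure lborel ?C = 0"
    moreover have "emeasure lborel ?C < \<infinity>" by (rule emeasure_compact_finite[OF C(1)])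
    ultimately have "emeasure lborel ?C = 0" by (simp add: emeasure_eq_ennreal_measure less_top)
    then have "?C \<in> null_sets lborel" by auto
    then have "negligible ?C" by (simp add: negligible_iff_null_sets null_sets_completionI)
    then have "negligible (interior ?C)" using interior_subset negligible_subset by blast
    then show False using C(2) open_not_negligible[OF open_interior] by blast
  qed
  moreover have "u \<bullet> spherical_centroid A = (1 / norm (centroid ?C)) * (u \<bullet> centroid ?C)"
    by (simp add: spherical_centroid_def divide_inverse)
  moreover have "u \<bullet> centroid ?C = (1 / measure lborel ?C) * ((LINT x:?C|lborel. x) \<bullet> u)"
    by (simp add: centroid_def inner_commute)
  ultimately show ?thesis unfolding i[symmetric] by (auto simp: centroid_def)
qed

text \<open>
  The conic hull of the sector is closed, since the body is compact and misses the origin, and pointed, since the body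
  lies in an open hemisphere. So \<open>cone_mass_ratio\<close> applies to it.
\<close>

theorem spherical_grunbaum:
  fixes A :: "'a::euclidean_space set"
  assumes dim: "3 \<le> DIM('a)" and A: "spherical_convex_body A" and u: "u \<bullet> spherical_centroid A = 0"
  shows "(1 - 1 / real DIM('a)) ^ (DIM('a) - 1) * measure sphere_measure A \<le> measure sphere_measure (A \<inter> halfspace u)"
proof -
  obtain v where v: "A \<subseteq> {x. x \<bullet> v > 0}" and sph: "A \<subseteq> sphere 0 1" and body: "convex_body (sector A)"
    using A by (auto simp: spherical_convex_body_def)
  let ?C = "sector A"
  have C: "compact ?C" "convex ?C" "interior ?C \<noteq> {}" using body by (auto simp: convex_body_def)
  have AC: "A = ?C \<inter> sphere 0 1"
  proof
    show "A \<subseteq> ?C \<inter> sphere 0 1"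
    proof
      fix x assume x: "x \<in> A"
      have "x \<in> ?C" unfolding sector_def using x by (intro CollectI exI[of _ 1] exI[of _ x]) simp
      then show "x \<in> ?C \<inter> sphere 0 1" using x sph by blast
    qed
    show "?C \<inter> sphere 0 1 \<subseteq> A" using sph by (auto simp: sector_def subset_iff)
  qed
  have cA: "compact A" using C(1) by (subst AC) (intro compact_Int_closed, auto)
  have ne: "A \<noteq> {}"
  proof
    assume "A = {}" then have "?C = {}" by (auto simp: sector_def)
    then show False using C(3) by simp
  qed
  define P where "P = conic hull ?C"
  have Pdef: "P = {a *\<^sub>R \<xi> | a \<xi>. 0 \<le> a \<and> \<xi> \<in> A}"
    unfolding P_def conic_hull_explicit
  proof (intro equalityI subsetI)
    fix x assume "x \<in> {c *\<^sub>R y |c y. 0 \<le> c \<and> y \<in> ?C}"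
    then obtain c t \<xi> where "x = c *\<^sub>R (t *\<^sub>R \<xi>)" "0 \<le> c" "0 \<le> t" "\<xi> \<in> A" by (auto simp: sector_def)
    then have "x = (c * t) *\<^sub>R \<xi>" "0 \<le> c * t" by auto
    then show "x \<in> {a *\<^sub>R \<xi> |a \<xi>. 0 \<le> a \<and> \<xi> \<in> A}" using \<open>\<xi> \<in> A\<close> by blast
  next
    fix x assume "x \<in> {a *\<^sub>R \<xi> |a \<xi>. 0 \<le> a \<and> \<xi> \<in> A}"
    then show "x \<in> {c *\<^sub>R y |c y. 0 \<le> c \<and> y \<in> ?C}" using AC by blast
  qed
  have conic: "a *\<^sub>R x \<in> P" if "x \<in> P" "0 \<le> a" for x a
  proof -
    have "\<exists>b \<xi>. x = b *\<^sub>R \<xi> \<and> 0 \<le> b \<and> \<xi> \<in> A" using that(1) unfolding Pdef by simp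
    then obtain b \<xi> where "x = b *\<^sub>R \<xi>" "0 \<le> b" "\<xi> \<in> A" by auto
    then have "a *\<^sub>R x = (a * b) *\<^sub>R \<xi>" "0 \<le> a * b" using that(2) by auto
    then show ?thesis unfolding Pdef using \<open>\<xi> \<in> A\<close> by blast
  qed
  have Pcv: "convex P" unfolding P_def using C(2) by (rule convex_conic_hull)
  have Pcl: "closed P"
  proof -
    have "P = conic hull A" unfolding Pdef conic_hull_explicit by blast
    moreover have "0 \<notin> A" using sph by auto
    ultimately show ?thesis using cA closed_conic_hull by blast
  qed
  have AP: "A = P \<inter> sphere 0 1"
  proof
    show "A \<subseteq> P \<inter> sphere 0 1"
    proof
      fix x assume x: "x \<in> A"
      have "x \<in> P" unfolding Pdef using x by (intro CollectI exI[of _ 1] exI[of _ x]) simp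
      then show "x \<in> P \<inter> sphere 0 1" using x sph by blast
    qed
    show "P \<inter> sphere 0 1 \<subseteq> A" using sph unfolding Pdef by (auto simp: subset_iff)
  qed
  have CP: "?C = P \<inter> cball 0 1" by (rule sector_eq_cone_ball[OF AP conic ne])
  obtain \<xi>0 where \<xi>0: "\<xi>0 \<in> A" "\<And>\<xi>. \<xi> \<in> A \<Longrightarrow> \<xi>0 \<bullet> v \<le> \<xi> \<bullet> v"
  proof -
    have "continuous_on A (\<lambda>x. x \<bullet> v)" by (intro continuous_intros)
    from continuous_attains_inf[OF cA ne this] that show ?thesis by auto
  qed
  have \<kappa>: "0 < \<xi>0 \<bullet> v" using v \<xi>0 by auto
  have pointed: "(\<xi>0 \<bullet> v) * norm x \<le> x \<bullet> v" if x: "x \<in> P" for x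
  proof -
    have "\<exists>a \<xi>. x = a *\<^sub>R \<xi> \<and> 0 \<le> a \<and> \<xi> \<in> A" using x unfolding Pdef by simp
    then obtain a \<xi> where a: "x = a *\<^sub>R \<xi>" "0 \<le> a" "\<xi> \<in> A" by auto
    have "norm \<xi> = 1" using a sph by auto
    then show ?thesis using mult_left_mono[OF \<xi>0(2)[OF a(3)] a(2)] a by (simp add: mult.commute)
  qed
  have [measurable]: "P \<in> sets borel" using Pcl by simp
  have mom: "0 \<le> (LINT x|lborel. indicator (P \<inter> cball 0 1) x * (x \<bullet> u))"
    using u spherical_centroid_orthogonal_iff[OF body, of u] unfolding CP by simp
  have "(1 - 1 / real DIM('a)) ^ (DIM('a) - 1) * (LINT x|lborel. indicator (P \<inter> cball 0 1) x * norm x)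
     \<le> (LINT x|lborel. indicator (P \<inter> {x. 0 \<le> x \<bullet> u} \<inter> cball 0 1) x * norm x)"
    by (rule cone_mass_ratio[OF dim Pcl Pcv conic \<kappa> pointed mom])
  then have "real (DIM('a) + 1) * ((1 - 1 / real DIM('a)) ^ (DIM('a) - 1) * (LINT x|lborel. indicator (P \<inter> cball 0 1) x * norm x))
     \<le> real (DIM('a) + 1) * (LINT x|lborel. indicator (P \<inter> {x. 0 \<le> x \<bullet> u} \<inter> cball 0 1) x * norm x)"
    by (rule mult_left_mono) simp
  moreover have "measure sphere_measure A = real (DIM('a) + 1) * (LINT x|lborel. indicator (P \<inter> cball 0 1) x * norm x)"
    unfolding AP by (rule sphere_measure_conic) (auto intro: conic)
  moreover have "measure sphere_measure (A \<inter> halfspace u) = real (DIM('a) + 1) * (LINT x|lborel. indicator (P \<inter> {x. 0 \<le> x \<bullet> u} \<inter> cball 0 1) x * norm x)"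
  proof -
    have "A \<inter> halfspace u = (P \<inter> {x. 0 \<le> x \<bullet> u}) \<inter> sphere 0 1" unfolding AP halfspace_def by auto
    then have "measure sphere_measure (A \<inter> halfspace u) = measure sphere_measure ((P \<inter> {x. 0 \<le> x \<bullet> u}) \<inter> sphere 0 1)"
      by (rule arg_cong)
    also have "\<dots> = real (DIM('a) + 1) * (LINT x|lborel. indicator (P \<inter> {x. 0 \<le> x \<bullet> u} \<inter> cball 0 1) x * norm x)"
    proof (rule sphere_measure_conic)
      show "P \<inter> {x. 0 \<le> x \<bullet> u} \<in> sets borel" by measurable
    next
      fix x :: 'a and a :: real assume "x \<in> P \<inter> {x. 0 \<le> x \<bullet> u}" "0 < a"
      then show "a *\<^sub>R x \<in> P \<inter> {x. 0 \<le> x \<bullet> u}" using conic[of x a] by simp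
    qed
    finally show ?thesis .
  qed
  ultimately show ?thesis by (simp add: mult.left_commute)
qed

section \<open>Thin cones over simplices\<close>

lemma nn_integral_PiM_translate:
  fixes f :: "('i \<Rightarrow> real) \<Rightarrow> ennreal"
  assumes I: "finite I" "i \<in> I" and [measurable]: "f \<in> borel_measurable (PiM I (\<lambda>_. lborel))"
  shows "integral\<^sup>N (PiM I (\<lambda>_. lborel)) (\<lambda>z. f (z(i := z i + d))) = integral\<^sup>N (PiM I (\<lambda>_. lborel)) f"
proof -
  interpret product_sigma_finite "\<lambda>_::'i. lborel :: real measure" ..
  define J where "J = I - {i}"
  have J: "finite J" "i \<notin> J" and IJ: "I = insert i J" using I by (auto simp: J_def)
  have [measurable]: "f \<in> borel_measurable (PiM (insert i J) (\<lambda>_. lborel))" using assms(3) unfolding IJ .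
  have "(\<lambda>z. z(i := z i + d)) \<in> PiM (insert i J) (\<lambda>_. lborel :: real measure) \<rightarrow>\<^sub>M PiM (insert i J) (\<lambda>_. lborel)"
    by (rule measurable_fun_upd[where J = "insert i J"]) (simp_all add: J)
  then have m1: "(\<lambda>z. f (z(i := z i + d))) \<in> borel_measurable (PiM (insert i J) (\<lambda>_. lborel))"
    by (rule measurable_compose) fact
  have "integral\<^sup>N (PiM (insert i J) (\<lambda>_. lborel)) (\<lambda>z. f (z(i := z i + d)))
     = (\<integral>\<^sup>+ x. \<integral>\<^sup>+ y. f (x(i := y + d)) \<partial>lborel \<partial>(PiM J (\<lambda>_. lborel)))"
    by (subst product_nn_integral_insert[OF J m1]) simp
  also have "\<dots> = (\<integral>\<^sup>+ x. \<integral>\<^sup>+ y. f (x(i := y)) \<partial>lborel \<partial>(PiM J (\<lambda>_. lborel)))"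
  proof (rule nn_integral_cong)
    fix x assume "x \<in> space (PiM J (\<lambda>_. lborel :: real measure))"
    then have "(\<lambda>y. f (x(i := y))) \<in> borel_measurable borel" by measurable
    from nn_integral_real_affine[OF this, of 1 d]
    show "(\<integral>\<^sup>+ y. f (x(i := y + d)) \<partial>lborel) = (\<integral>\<^sup>+ y. f (x(i := y)) \<partial>lborel)" by (simp add: add.commute)
  qed
  also have "\<dots> = integral\<^sup>N (PiM (insert i J) (\<lambda>_. lborel)) f"
    by (rule product_nn_integral_insert[symmetric]) (use J in auto)
  finally show ?thesis unfolding IJ .
qed

definition simplex_vol :: "'i set \<Rightarrow> real \<Rightarrow> ennreal" where
  "simplex_vol I \<tau> = (\<integral>\<^sup>+ z. indicator {z. (\<forall>i\<in>I. 0 \<le> z i) \<and> (\<Sum>i\<in>I. z i) \<le> \<tau>} z \<partial>(PiM I (\<lambda>_. lborel)))"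

lemma simplex_indicator_measurable:
  fixes I :: "'i set" and \<tau> :: real
  assumes "finite I"
  shows "(\<lambda>z. indicator {z. (\<forall>i\<in>I. 0 \<le> z i) \<and> (\<Sum>i\<in>I. z i) \<le> \<tau>} z :: ennreal) \<in> borel_measurable (PiM I (\<lambda>_. lborel))"
proof -
  have "Measurable.pred (PiM I (\<lambda>_. lborel)) (\<lambda>z. (\<forall>i\<in>I. (0::real) \<le> z i) \<and> (\<Sum>i\<in>I. z i) \<le> \<tau>)"
    using assms by (intro pred_intros_logic pred_intros_finite) measurable
  then show ?thesis by (simp add: indicator_def borel_measurable_indicator_iff[unfolded indicator_def])
qed

lemma simplex_vol_scale:
  assumes I: "finite I" and \<tau>: "0 < \<tau>"
  shows "simplex_vol I \<tau> = ennreal (\<tau> ^ card I) * simplex_vol I 1"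
proof -
  have "simplex_vol I \<tau> = ennreal (\<tau> ^ card I) * (\<integral>\<^sup>+ z. indicator {z. (\<forall>i\<in>I. 0 \<le> z i) \<and> (\<Sum>i\<in>I. z i) \<le> \<tau>} (\<lambda>i\<in>I. \<tau> * z i) \<partial>(PiM I (\<lambda>_. lborel)))"
    unfolding simplex_vol_def using nn_integral_PiM_scale[OF I \<tau> simplex_indicator_measurable[OF I]] by simp
  also have "(\<integral>\<^sup>+ z. indicator {z. (\<forall>i\<in>I. 0 \<le> z i) \<and> (\<Sum>i\<in>I. z i) \<le> \<tau>} (\<lambda>i\<in>I. \<tau> * z i) \<partial>(PiM I (\<lambda>_. lborel))) = simplex_vol I 1"
    unfolding simplex_vol_def
  proof (rule nn_integral_cong)
    fix z :: "'a \<Rightarrow> real"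
    have "(\<Sum>i\<in>I. \<tau> * z i) \<le> \<tau> \<longleftrightarrow> (\<Sum>i\<in>I. z i) \<le> 1"
      using \<tau> mult_le_cancel_left_pos[of \<tau> "\<Sum>i\<in>I. z i" 1] by (simp add: sum_distrib_left)
    then show "(indicator {z. (\<forall>i\<in>I. 0 \<le> z i) \<and> (\<Sum>i\<in>I. z i) \<le> \<tau>} (\<lambda>i\<in>I. \<tau> * z i) :: ennreal) = indicator {z. (\<forall>i\<in>I. 0 \<le> z i) \<and> (\<Sum>i\<in>I. z i) \<le> 1} z"
      using \<tau> by (simp add: indicator_def zero_le_mult_iff)
  qed
  finally show ?thesis .
qed

text \<open>
  Shifting the coordinate \<open>i\<close> by \<open>d\<close> maps the part of a corner simplex beyond the hyperplane \<open>z i = d\<close> to a smaller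
  corner simplex.
\<close>

lemma simplex_vol_cut:
  assumes I: "finite I" "i \<in> I" and d: "0 \<le> d"
  shows "(\<integral>\<^sup>+ z. indicator {z. (\<forall>j\<in>I. 0 \<le> z j) \<and> d \<le> z i \<and> (\<Sum>j\<in>I. z j) \<le> \<tau>} z \<partial>(PiM I (\<lambda>_. lborel))) = simplex_vol I (\<tau> - d)"
proof -
  let ?f = "\<lambda>z. indicator {z. (\<forall>j\<in>I. 0 \<le> z j) \<and> d \<le> z i \<and> (\<Sum>j\<in>I. z j) \<le> \<tau>} z :: ennreal"
  have "Measurable.pred (PiM I (\<lambda>_. lborel)) (\<lambda>z. (\<forall>j\<in>I. (0::real) \<le> z j) \<and> d \<le> z i \<and> (\<Sum>j\<in>I. z j) \<le> \<tau>)"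
    using I by (intro pred_intros_logic pred_intros_finite) measurable
  then have "?f \<in> borel_measurable (PiM I (\<lambda>_. lborel))"
    by (simp add: indicator_def borel_measurable_indicator_iff[unfolded indicator_def])
  from nn_integral_PiM_translate[OF I this, of d]
  have "integral\<^sup>N (PiM I (\<lambda>_. lborel)) ?f = (\<integral>\<^sup>+ z. ?f (z(i := z i + d)) \<partial>(PiM I (\<lambda>_. lborel)))" by simp
  also have "\<dots> = simplex_vol I (\<tau> - d)"
    unfolding simplex_vol_def
  proof (rule nn_integral_cong)
    fix z :: "'a \<Rightarrow> real"
    have "(\<Sum>j\<in>I. (z(i := z i + d)) j) = (\<Sum>j\<in>I. z j) + d"
    proof -
      have "(\<Sum>j\<in>I - {i}. (z(i := z i + d)) j) = (\<Sum>j\<in>I - {i}. z j)" by (intro sum.cong) auto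
      then show ?thesis using I by (simp add: sum.remove[of I i])
    qed
    moreover have "(\<forall>j\<in>I. 0 \<le> (z(i := z i + d)) j) \<and> d \<le> (z(i := z i + d)) i \<longleftrightarrow> (\<forall>j\<in>I. 0 \<le> z j)"
      using I d by auto
    ultimately show "?f (z(i := z i + d)) = indicator {z. (\<forall>i\<in>I. 0 \<le> z i) \<and> (\<Sum>i\<in>I. z i) \<le> \<tau> - d} z"
      by (auto simp: indicator_def simp del: fun_upd_apply)
  qed
  finally show ?thesis .
qed

text \<open>
  At height \<open>x \<bullet> e = 1\<close> this is a corner simplex of size \<open>\<epsilon>\<close>, so the cone becomes thin as \<open>\<epsilon>\<close> tends to zero. The
  sections of its part beyond a hyperplane \<open>x \<bullet> f = q * (x \<bullet> e)\<close> are translates of corner simplices.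
\<close>

definition corner_cone :: "real \<Rightarrow> 'a::euclidean_space \<Rightarrow> 'a set" where
  "corner_cone \<epsilon> e = {x. (\<forall>b\<in>Basis - {e}. 0 \<le> x \<bullet> b) \<and> (\<Sum>b\<in>Basis - {e}. x \<bullet> b) \<le> \<epsilon> * (x \<bullet> e)}"

lemma closed_corner_cone: "closed (corner_cone \<epsilon> e)"
proof -
  have "corner_cone \<epsilon> e = (\<Inter>b\<in>Basis - {e}. {x. 0 \<le> x \<bullet> b}) \<inter> {x. (\<Sum>b\<in>Basis - {e}. x \<bullet> b) \<le> \<epsilon> * (x \<bullet> e)}"
    by (auto simp: corner_cone_def)
  also have "closed \<dots>" by (intro closed_Int closed_INT ballI closed_Collect_le continuous_intros)
  finally show ?thesis .
qed

lemma corner_cone_measurable [measurable]: "corner_cone \<epsilon> e \<in> sets borel"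
  by (intro borel_closed closed_corner_cone)

lemma corner_cone_scale: "x \<in> corner_cone \<epsilon> e \<Longrightarrow> 0 \<le> a \<Longrightarrow> a *\<^sub>R x \<in> corner_cone \<epsilon> e"
  by (auto simp: corner_cone_def sum_distrib_left[symmetric] mult.left_commute[of \<epsilon> a] intro!: mult_left_mono)

lemma corner_cone_add: "x \<in> corner_cone \<epsilon> e \<Longrightarrow> y \<in> corner_cone \<epsilon> e \<Longrightarrow> x + y \<in> corner_cone \<epsilon> e"
  by (auto simp: corner_cone_def inner_add_left sum.distrib distrib_left)

lemma convex_corner_cone: "convex (corner_cone \<epsilon> e)"
  by (rule convexI) (intro corner_cone_add corner_cone_scale, auto)

lemma corner_cone_bounds:
  fixes e :: "'a::euclidean_space"
  assumes x: "x \<in> corner_cone \<epsilon> e" and e: "e \<in> Basis" and \<epsilon>: "0 < \<epsilon>"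
  shows "0 \<le> x \<bullet> e" "x \<bullet> e \<le> norm x" "norm x \<le> (1 + \<epsilon>) * (x \<bullet> e)" "b \<in> Basis - {e} \<Longrightarrow> x \<bullet> b \<le> \<epsilon> * (x \<bullet> e)"
proof -
  have s: "0 \<le> (\<Sum>b\<in>Basis - {e}. x \<bullet> b)" "(\<Sum>b\<in>Basis - {e}. x \<bullet> b) \<le> \<epsilon> * (x \<bullet> e)"
    using x by (auto simp: corner_cone_def intro: sum_nonneg)
  then have "0 \<le> \<epsilon> * (x \<bullet> e)" by linarith
  then show x0: "0 \<le> x \<bullet> e" using \<epsilon> by (simp add: zero_le_mult_iff)
  show "x \<bullet> e \<le> norm x" using Basis_le_norm[OF e, of x] by simp
  have "norm x \<le> (\<Sum>b\<in>Basis. \<bar>x \<bullet> b\<bar>)" by (rule norm_le_l1)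
  also have "\<dots> = \<bar>x \<bullet> e\<bar> + (\<Sum>b\<in>Basis - {e}. \<bar>x \<bullet> b\<bar>)" using e by (simp add: sum.remove)
  also have "(\<Sum>b\<in>Basis - {e}. \<bar>x \<bullet> b\<bar>) = (\<Sum>b\<in>Basis - {e}. x \<bullet> b)"
    using x by (intro sum.cong) (auto simp: corner_cone_def)
  also have "\<bar>x \<bullet> e\<bar> + (\<Sum>b\<in>Basis - {e}. x \<bullet> b) \<le> (1 + \<epsilon>) * (x \<bullet> e)" using x0 s by (simp add: algebra_simps)
  finally show "norm x \<le> (1 + \<epsilon>) * (x \<bullet> e)" by simp
  show "x \<bullet> b \<le> \<epsilon> * (x \<bullet> e)" if b: "b \<in> Basis - {e}"
  proof -
    have "x \<bullet> b \<le> (\<Sum>b\<in>Basis - {e}. x \<bullet> b)"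
      using b x by (intro member_le_sum) (auto simp: corner_cone_def)
    then show ?thesis using s by simp
  qed
qed

text \<open>
  At height \<open>y\<close> the slice is a simplex of size \<open>(\<epsilon> - q) * y\<close>.
\<close>

lemma corner_cone_cut_integral:
  fixes e f :: "'a::euclidean_space"
  assumes e: "e \<in> Basis" and f: "f \<in> Basis - {e}" and q: "0 \<le> q" "q < \<epsilon>"
  shows "(\<integral>\<^sup>+ x. ennreal (x \<bullet> e) * indicator {x\<in>corner_cone \<epsilon> e. x \<bullet> e \<le> 1 \<and> q * (x \<bullet> e) \<le> x \<bullet> f} x \<partial>lborel)
     = ennreal ((\<epsilon> - q) ^ (DIM('a) - 1)) * (simplex_vol (Basis - {e}) 1 * ennreal (1 / (real DIM('a) + 1)))"
proof -
  define I where "I = Basis - {e}"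
  have I: "finite I" "e \<notin> I" "f \<in> I" and BI: "Basis = insert e I" using e f by (auto simp: I_def)
  have cI: "DIM('a) = Suc (card I)" unfolding BI using I by simp
  have cI0: "card I \<noteq> 0" using I by auto
  interpret product_sigma_finite "\<lambda>_::'a. lborel :: real measure" ..
  let ?g = "\<lambda>x::'a. ennreal (x \<bullet> e) * indicator {x\<in>corner_cone \<epsilon> e. x \<bullet> e \<le> 1 \<and> q * (x \<bullet> e) \<le> x \<bullet> f} x"
  have gm[measurable]: "?g \<in> borel_measurable borel" by measurable
  define F where "F = (\<lambda>z::'a \<Rightarrow> real. ?g (\<Sum>b\<in>Basis. z b *\<^sub>R b))"
  have [measurable]: "F \<in> borel_measurable (PiM (insert e I) (\<lambda>_. lborel))"
    unfolding F_def BI by measurable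
  have Feq: "F (z(e := y)) = ennreal y * indicator {0<..1} y * indicator {z. (\<forall>j\<in>I. 0 \<le> z j) \<and> q * y \<le> z f \<and> (\<Sum>j\<in>I. z j) \<le> \<epsilon> * y} z" for z y
  proof -
    define x where "x = (\<Sum>b\<in>Basis. (z(e := y)) b *\<^sub>R b)"
    have xb: "x \<bullet> b = (z(e := y)) b" if "b \<in> Basis" for b
      unfolding x_def using that by (simp del: fun_upd_apply)
    have xe: "x \<bullet> e = y" using xb[OF e] by simp
    have xI: "x \<bullet> b = z b" if "b \<in> I" for b    proof -
      have "b \<in> Basis" "b \<noteq> e" using that I BI by auto
      then show ?thesis using xb[of b] by simp
    qed
    have sx: "(\<Sum>b\<in>I. x \<bullet> b) = (\<Sum>b\<in>I. z b)" using xI by (intro sum.cong) auto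
    have "F (z(e := y)) = ?g x" unfolding F_def x_def ..
    also have "\<dots> = ennreal y * indicator {0<..1} y * indicator {z. (\<forall>j\<in>I. 0 \<le> z j) \<and> q * y \<le> z f \<and> (\<Sum>j\<in>I. z j) \<le> \<epsilon> * y} z"
      using xI xI[OF I(3)] sx by (cases "0 < y") (auto simp: indicator_def corner_cone_def I_def[symmetric] xe ennreal_neg)
    finally show ?thesis .
  qed
  have "(\<integral>\<^sup>+ x. ?g x \<partial>lborel) = integral\<^sup>N (PiM (insert e I) (\<lambda>_. lborel)) F"
    by (subst lborel_eq) (simp add: nn_integral_distr F_def BI[symmetric])
  also have "\<dots> = (\<integral>\<^sup>+ y. \<integral>\<^sup>+ z. F (z(e := y)) \<partial>(PiM I (\<lambda>_. lborel)) \<partial>lborel)"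
    by (rule product_nn_integral_insert_rev) (use I in auto)
  also have "\<dots> = (\<integral>\<^sup>+ y. (ennreal (y ^ Suc (card I)) * indicator {0<..1} y) * (ennreal ((\<epsilon> - q) ^ card I) * simplex_vol I 1) \<partial>lborel)"
  proof (rule nn_integral_cong)
    fix y :: real
    have m: "(\<lambda>z. indicator {z. (\<forall>j\<in>I. 0 \<le> z j) \<and> q * y \<le> z f \<and> (\<Sum>j\<in>I. z j) \<le> \<epsilon> * y} z :: ennreal) \<in> borel_measurable (PiM I (\<lambda>_. lborel))"
    proof -
      have "Measurable.pred (PiM I (\<lambda>_. lborel)) (\<lambda>z. (\<forall>j\<in>I. (0::real) \<le> z j) \<and> q * y \<le> z f \<and> (\<Sum>j\<in>I. z j) \<le> \<epsilon> * y)"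
        using I by (intro pred_intros_logic pred_intros_finite) measurable
      then show ?thesis by (simp add: indicator_def borel_measurable_indicator_iff[unfolded indicator_def])
    qed
    have "(\<integral>\<^sup>+ z. F (z(e := y)) \<partial>(PiM I (\<lambda>_. lborel)))
      = ennreal y * indicator {0<..1} y * (\<integral>\<^sup>+ z. indicator {z. (\<forall>j\<in>I. 0 \<le> z j) \<and> q * y \<le> z f \<and> (\<Sum>j\<in>I. z j) \<le> \<epsilon> * y} z \<partial>(PiM I (\<lambda>_. lborel)))"
      unfolding Feq by (rule nn_integral_cmult[OF m])
    also have "\<dots> = (ennreal (y ^ Suc (card I)) * indicator {0<..1} y) * (ennreal ((\<epsilon> - q) ^ card I) * simplex_vol I 1)"
    proof (cases "0 < y")
      case True
      have "(\<integral>\<^sup>+ z. indicator {z. (\<forall>j\<in>I. 0 \<le> z j) \<and> q * y \<le> z f \<and> (\<Sum>j\<in>I. z j) \<le> \<epsilon> * y} z \<partial>(PiM I (\<lambda>_. lborel))) = simplex_vol I (\<epsilon> * y - q * y)"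
        using I q True by (intro simplex_vol_cut) auto
      also have "\<epsilon> * y - q * y = (\<epsilon> - q) * y" by (simp add: left_diff_distrib)
      also have "simplex_vol I \<dots> = ennreal (((\<epsilon> - q) * y) ^ card I) * simplex_vol I 1"
        using True q I by (intro simplex_vol_scale) auto
      also have "ennreal (((\<epsilon> - q) * y) ^ card I) = ennreal ((\<epsilon> - q) ^ card I) * ennreal (y ^ card I)"
        using True q by (simp add: power_mult_distrib ennreal_mult)
      finally show ?thesis using True by (simp add: ennreal_mult mult_ac)
    qed simp
    finally show "(\<integral>\<^sup>+ z. F (z(e := y)) \<partial>(PiM I (\<lambda>_. lborel))) = \<dots>" .
  qed
  also have "\<dots> = (\<integral>\<^sup>+ y. ennreal (y ^ Suc (card I)) * indicator {0<..1} y \<partial>lborel) * (ennreal ((\<epsilon> - q) ^ card I) * simplex_vol I 1)"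
    by (rule nn_integral_multc) auto
  also have "(\<integral>\<^sup>+ y. ennreal (y ^ Suc (card I)) * indicator {0<..1} y \<partial>lborel) = ennreal (1 / (real (card I) + 2))"
    using nn_integral_power_Icc[of 1 "card I"] by simp
  finally show ?thesis by (simp add: I_def[symmetric] cI mult_ac add.commute)
qed

text \<open>
  Writing \<open>x \<bullet> f\<close> as the integral over \<open>q\<close> of \<open>x \<bullet> e\<close> on the set where \<open>q * (x \<bullet> e) \<le> x \<bullet> f\<close> reduces this to
  \<open>corner_cone_cut_integral\<close>.
\<close>

lemma corner_cone_moment_integral:
  fixes e f :: "'a::euclidean_space"
  assumes dim: "2 \<le> DIM('a)" and e: "e \<in> Basis" and f: "f \<in> Basis - {e}" and \<epsilon>: "0 < \<epsilon>"
  shows "(\<integral>\<^sup>+ x. ennreal (x \<bullet> f) * indicator {x\<in>corner_cone \<epsilon> e. x \<bullet> e \<le> 1} x \<partial>lborel)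
     = ennreal (\<epsilon> ^ DIM('a) / real DIM('a)) * (simplex_vol (Basis - {e}) 1 * ennreal (1 / (real DIM('a) + 1)))"
proof -
  let ?G = "simplex_vol (Basis - {e}) 1 * ennreal (1 / (real DIM('a) + 1))"
  obtain k where k: "DIM('a) - 1 = Suc k" "DIM('a) = k + 2" using dim by (metis add_2_eq_Suc' diff_Suc_1 le_add_diff_inverse2)
  define T where "T q = {x\<in>corner_cone \<epsilon> e. x \<bullet> e \<le> 1 \<and> q * (x \<bullet> e) \<le> x \<bullet> f}" for q
  have mT: "(\<lambda>(q, x). indicator {0<..<\<epsilon>} q * (ennreal (x \<bullet> e) * indicator (T q) x)) \<in> borel_measurable (lborel \<Otimes>\<^sub>M lborel)"
    unfolding T_def by (simp add: case_prod_beta indicator_def) measurable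
  have "(\<integral>\<^sup>+ x. ennreal (x \<bullet> f) * indicator {x\<in>corner_cone \<epsilon> e. x \<bullet> e \<le> 1} x \<partial>lborel)
      = (\<integral>\<^sup>+ x. \<integral>\<^sup>+ q. indicator {0<..<\<epsilon>} q * (ennreal (x \<bullet> e) * indicator (T q) x) \<partial>lborel \<partial>lborel)"
  proof (rule nn_integral_cong)
    fix x :: 'a
    show "ennreal (x \<bullet> f) * indicator {x\<in>corner_cone \<epsilon> e. x \<bullet> e \<le> 1} x = (\<integral>\<^sup>+ q. indicator {0<..<\<epsilon>} q * (ennreal (x \<bullet> e) * indicator (T q) x) \<partial>lborel)"
    proof (cases "x \<in> corner_cone \<epsilon> e \<and> x \<bullet> e \<le> 1")
      case False
      then have "indicator (T q) x = (0::ennreal)" for q by (auto simp: T_def)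
      then show ?thesis using False by auto
    next
      case True
      then have xc: "x \<in> corner_cone \<epsilon> e" by simp
      have xf: "0 \<le> x \<bullet> f" "x \<bullet> f \<le> \<epsilon> * (x \<bullet> e)" using xc f corner_cone_bounds(4)[OF xc e \<epsilon> f] by (auto simp: corner_cone_def)
      show ?thesis
      proof (cases "x \<bullet> e = 0")
        case True then show ?thesis using xf by simp
      next
        case False
        then have xe: "0 < x \<bullet> e" using corner_cone_bounds(1)[OF xc e \<epsilon>] by simp
        define r where "r = (x \<bullet> f) / (x \<bullet> e)"
        have r: "0 \<le> r" "r \<le> \<epsilon>" using xf xe by (auto simp: r_def field_simps)
        have "(\<integral>\<^sup>+ q. indicator {0<..<\<epsilon>} q * (ennreal (x \<bullet> e) * indicator (T q) x) \<partial>lborel)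
            = (\<integral>\<^sup>+ q. ennreal (x \<bullet> e) * indicator {0<..r} q \<partial>lborel)"
        proof (rule nn_integral_cong_AE)
          have qe: "q \<le> \<epsilon>" if "q * (x \<bullet> e) \<le> x \<bullet> f" for q
            using order_trans[OF that xf(2)] xe by simp
          have "indicator {0<..<\<epsilon>} q * (ennreal (x \<bullet> e) * indicator (T q) x) = ennreal (x \<bullet> e) * indicator {0<..r} q" if "q \<noteq> \<epsilon>" for q
            using that True xe r qe[of q] by (auto simp: indicator_def T_def r_def field_simps)
          then show "AE q in lborel. indicator {0<..<\<epsilon>} q * (ennreal (x \<bullet> e) * indicator (T q) x) = ennreal (x \<bullet> e) * indicator {0<..r} q"
            using AE_lborel_singleton[of \<epsilon>] by (rule eventually_mono[rotated])
        qed
        also have "\<dots> = ennreal (x \<bullet> e) * ennreal r" using r by (subst nn_integral_cmult_indicator) auto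
        also have "\<dots> = ennreal (x \<bullet> f)" using xe r by (simp add: ennreal_mult[symmetric] r_def)
        finally show ?thesis using True by simp
      qed
    qed
  qed
  also have "\<dots> = (\<integral>\<^sup>+ q. \<integral>\<^sup>+ x. indicator {0<..<\<epsilon>} q * (ennreal (x \<bullet> e) * indicator (T q) x) \<partial>lborel \<partial>lborel)"
    by (rule lborel_pair.Fubini'[OF mT])
  also have "\<dots> = (\<integral>\<^sup>+ q. ennreal ((\<epsilon> - q) ^ Suc k) * indicator {0<..<\<epsilon>} q * ?G \<partial>lborel)"
  proof (rule nn_integral_cong)
    fix q :: real
    have "(\<integral>\<^sup>+ x. indicator {0<..<\<epsilon>} q * (ennreal (x \<bullet> e) * indicator (T q) x) \<partial>lborel) = indicator {0<..<\<epsilon>} q * (\<integral>\<^sup>+ x. ennreal (x \<bullet> e) * indicator (T q) x \<partial>lborel)"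
      unfolding T_def by (rule nn_integral_cmult) measurable
    also have "\<dots> = ennreal ((\<epsilon> - q) ^ Suc k) * indicator {0<..<\<epsilon>} q * ?G"
      unfolding T_def using corner_cone_cut_integral[OF e f, of q \<epsilon>, unfolded k(1)] by (cases "q \<in> {0<..<\<epsilon>}") auto
    finally show "(\<integral>\<^sup>+ x. indicator {0<..<\<epsilon>} q * (ennreal (x \<bullet> e) * indicator (T q) x) \<partial>lborel) = \<dots>" .
  qed
  also have "\<dots> = (\<integral>\<^sup>+ q. ennreal ((\<epsilon> - q) ^ Suc k) * indicator {0<..<\<epsilon>} q \<partial>lborel) * ?G"
    by (rule nn_integral_multc) measurable
  also have "(\<integral>\<^sup>+ q. ennreal ((\<epsilon> - q) ^ Suc k) * indicator {0<..<\<epsilon>} q \<partial>lborel) = (\<integral>\<^sup>+ s. ennreal (s ^ Suc k) * indicator {0<..<\<epsilon>} s \<partial>lborel)"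
    by (subst nn_integral_real_affine[of _ "- 1" \<epsilon>]) (auto intro!: nn_integral_cong simp: indicator_def)
  also have "\<dots> = (\<integral>\<^sup>+ s. ennreal (s ^ Suc k) * indicator {0<..\<epsilon>} s \<partial>lborel)"
  proof (rule nn_integral_cong_AE)
    show "AE s in lborel. ennreal (s ^ Suc k) * indicator {0<..<\<epsilon>} s = ennreal (s ^ Suc k) * indicator {0<..\<epsilon>} s"
      using AE_lborel_singleton[of \<epsilon>] by (rule eventually_mono) (auto simp: indicator_def)
  qed
  also have "\<dots> = ennreal (\<epsilon> ^ (k + 2) / (real k + 2))" using \<epsilon> by (intro nn_integral_power_Icc) simp
  finally show ?thesis by (simp add: k(2) add.commute)
qed

lemma corner_cone_interior:
  fixes e :: "'a::euclidean_space"
  assumes e: "e \<in> Basis" and \<epsilon>: "0 < \<epsilon>"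
  shows "interior (corner_cone \<epsilon> e \<inter> cball 0 1) \<noteq> {}"
proof -
  define I where "I = Basis - {e}"
  define U where "U = (\<Inter>b\<in>I. {x. 0 < x \<bullet> b}) \<inter> {x. (\<Sum>b\<in>I. x \<bullet> b) < \<epsilon> * (x \<bullet> e)} \<inter> ball 0 1"
  have oU: "open U" unfolding U_def I_def
    by (intro open_Int open_INT ballI open_Collect_less continuous_intros) auto
  have sU: "U \<subseteq> corner_cone \<epsilon> e \<inter> cball 0 1"
    by (auto simp: U_def I_def corner_cone_def intro: less_imp_le)
  define \<delta> where "\<delta> = min 1 \<epsilon> / (4 * real DIM('a))"
  have \<delta>: "0 < \<delta>" using \<epsilon> by (simp add: \<delta>_def)
  \<comment> \<open>All conditions are strict at this point: the small coordinates add up to at most a quarter of \<open>min 1 \<epsilon>\<close>.\<close>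
  define p where "p = (\<Sum>b\<in>Basis. (if b = e then 1/2 else \<delta>) *\<^sub>R b)"
  have pb: "p \<bullet> b = (if b = e then 1/2 else \<delta>)" if "b \<in> Basis" for b
    unfolding p_def using that by simp
  have s: "(\<Sum>b\<in>I. p \<bullet> b) = real (card I) * \<delta>"
  proof -
    have "(\<Sum>b\<in>I. p \<bullet> b) = (\<Sum>b\<in>I. \<delta>)" by (intro sum.cong) (auto simp: I_def pb)
    then show ?thesis by simp
  qed
  have "real (card I) * \<delta> \<le> real DIM('a) * \<delta>"
    using \<delta> by (intro mult_right_mono) (auto simp: I_def intro: card_mono)
  also have "\<dots> = min 1 \<epsilon> / 4" by (simp add: \<delta>_def)
  finally have s4: "(\<Sum>b\<in>I. p \<bullet> b) \<le> min 1 \<epsilon> / 4" using s by simp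
  have "norm p \<le> (\<Sum>b\<in>Basis. \<bar>p \<bullet> b\<bar>)" by (rule norm_le_l1)
  also have "\<dots> = (\<Sum>b\<in>Basis. p \<bullet> b)" using \<delta> by (intro sum.cong) (auto simp: pb)
  also have "\<dots> = 1/2 + (\<Sum>b\<in>I. p \<bullet> b)" using e by (simp add: I_def sum.remove pb)
  finally have np: "norm p < 1" using s4 by simp
  have "p \<in> U" using \<delta> s4 \<epsilon> np e by (auto simp: U_def I_def pb)
  then show ?thesis using interior_maximal[OF sU oU] by blast
qed

text \<open>
  Measured by \<open>x \<bullet> e\<close> instead of the norm, the moment of \<open>x \<bullet> f\<close> is \<open>\<epsilon> / n\<close> times that of \<open>x \<bullet> e\<close>, and the part
  beyond \<open>x \<bullet> f = (\<epsilon> / n) * (x \<bullet> e)\<close> has exactly the fraction \<open>(1 - 1 / n) ^ (n - 1)\<close> of the mass. Since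
  \<open>x \<bullet> e \<le> norm x \<le> (1 + \<epsilon>) * (x \<bullet> e)\<close> on the cone, the norm changes this by powers of \<open>1 + \<epsilon>\<close> only.
\<close>

lemma corner_cone_thin_ratio:
  fixes e f :: "'a::euclidean_space" and \<epsilon> :: real
  defines "P \<equiv> corner_cone \<epsilon> e" and "B \<equiv> (1 + \<epsilon>) ^ (DIM('a) + 1)"
  assumes dim: "2 \<le> DIM('a)" and e: "e \<in> Basis" and f: "f \<in> Basis - {e}" and \<epsilon>: "0 < \<epsilon>"
  obtains u where "norm u = 1" "(LINT x|lborel. indicator (P \<inter> cball 0 1) x * (x \<bullet> u)) = 0"
    "0 < (LINT x|lborel. indicator (P \<inter> cball 0 1) x * norm x)"
    "(LINT x|lborel. indicator (P \<inter> {x. 0 \<le> x \<bullet> u} \<inter> cball 0 1) x * norm x)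
      \<le> (1 + \<epsilon>) * B * (1 - 1 / (real DIM('a) * B)) ^ (DIM('a) - 1) * (LINT x|lborel. indicator (P \<inter> cball 0 1) x * norm x)"
proof -
  let ?n = "DIM('a)"
  let ?G = "simplex_vol (Basis - {e}) 1 * ennreal (1 / (real ?n + 1))"
  have B: "1 \<le> B" unfolding B_def using \<epsilon> by (intro one_le_power) simp
  have n0: "0 < real ?n" by simp
  have Pm[measurable]: "P \<in> sets borel" unfolding P_def by measurable
  have con: "a *\<^sub>R x \<in> P" if "x \<in> P" "0 < a" for x a
    using corner_cone_scale[of x \<epsilon> e a] that by (simp add: P_def)
  have xe: "0 \<le> x \<bullet> e" "x \<bullet> e \<le> norm x" "norm x \<le> (1 + \<epsilon>) * (x \<bullet> e)" "0 \<le> x \<bullet> f" if "x \<in> P" for x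
    using corner_cone_bounds(1-3)[OF that[unfolded P_def] e \<epsilon>] that f by (auto simp: P_def corner_cone_def)
  define X where "X = (LINT x|lborel. indicator (P \<inter> cball 0 1) x * (x \<bullet> e))"
  define T where "T = (LINT x|lborel. indicator (P \<inter> cball 0 1) x * (x \<bullet> f))"
  define D where "D = (LINT x|lborel. indicator (P \<inter> cball 0 1) x * norm x)"
  have cb: "\<bar>x \<bullet> b\<bar> \<le> 1" if "norm x \<le> 1" "b \<in> Basis" for x b :: 'a using Basis_le_norm[OF that(2), of x] that(1) by simp
  have iX: "integrable lborel (\<lambda>x. indicator (P \<inter> cball 0 1) x * (x \<bullet> e))"
    using cb e by (intro integrable_on_ball_bounded[where C = 1]) auto
  have iT: "integrable lborel (\<lambda>x. indicator (P \<inter> cball 0 1) x * (x \<bullet> f))"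
    using cb f by (intro integrable_on_ball_bounded[where C = 1]) auto
  have iD: "integrable lborel (\<lambda>x. indicator (P \<inter> cball 0 1) x * norm x)"
    by (intro integrable_on_ball_bounded[where C = 1]) auto
  have NX: "(\<integral>\<^sup>+ x. ennreal (x \<bullet> e) * indicator {x\<in>P. norm x \<le> 1} x \<partial>lborel) = ennreal X"
    unfolding X_def using xe(1) cb e by (intro nn_integral_ball_eq_LINT[where C = 1]) auto
  have NT: "(\<integral>\<^sup>+ x. ennreal (x \<bullet> f) * indicator {x\<in>P. norm x \<le> 1} x \<partial>lborel) = ennreal T"
    unfolding T_def using xe(4) cb f by (intro nn_integral_ball_eq_LINT[where C = 1]) auto
  have X0: "0 < X"
  proof -
    have nn: "0 \<le> indicator (P \<inter> cball 0 1) x * (x \<bullet> e)" for x using xe(1)[of x] by (auto simp: indicator_def)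
    then have "0 \<le> X" unfolding X_def by (intro integral_nonneg_AE AE_I2)
    moreover have "X \<noteq> 0"
    proof
      assume "X = 0"
      then have "AE x in lborel. indicator (P \<inter> cball 0 1) x * (x \<bullet> e) = 0"
        unfolding X_def using integral_nonneg_eq_0_iff_AE[OF iX] nn by simp
      moreover have "AE x in lborel. x \<noteq> (0::'a)" using AE_lborel_singleton[of "0::'a"] by simp
      ultimately have "AE x in lborel. x \<notin> interior (P \<inter> cball 0 1)"
      proof eventually_elim
        case (elim x)
        show ?case
        proof
          assume "x \<in> interior (P \<inter> cball 0 1)"
          then have x: "x \<in> P \<inter> cball 0 1" using interior_subset by blast
          then have "x \<bullet> e = 0" using elim(1) by (simp add: indicator_def)
          then show False using xe(3)[of x] x elim(2) by simp
        qed
      qed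
      then have "interior (P \<inter> cball 0 1) \<in> null_sets lborel"
        using AE_iff_null_sets[of "interior (P \<inter> cball 0 1)" lborel] by simp
      then have "negligible (interior (P \<inter> cball 0 1))" by (simp add: negligible_iff_null_sets null_sets_completionI)
      moreover have "\<not> negligible (interior (P \<inter> cball 0 1))"
        using corner_cone_interior[OF e \<epsilon>] unfolding P_def by (intro open_not_negligible open_interior)
      ultimately show False by contradiction
    qed
    ultimately show ?thesis by simp
  qed
  have XD: "X \<le> D" unfolding X_def D_def
    using xe(2) by (intro integral_mono[OF iX iD]) (auto simp: indicator_def)
  have J0: "(\<integral>\<^sup>+ x. ennreal (x \<bullet> e) * indicator {x\<in>P. x \<bullet> e \<le> 1} x \<partial>lborel) = ennreal (\<epsilon> ^ (?n - 1)) * ?G"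
  proof -
    have "{x \<in> corner_cone \<epsilon> e. x \<bullet> e \<le> 1 \<and> 0 * (x \<bullet> e) \<le> x \<bullet> f} = {x\<in>P. x \<bullet> e \<le> 1}" using xe(4) by (auto simp: P_def)
    then show ?thesis using corner_cone_cut_integral[OF e f, of 0 \<epsilon>] \<epsilon> by simp
  qed
  have XJ: "ennreal X \<le> ennreal (\<epsilon> ^ (?n - 1)) * ?G"
    using conic_gauge_compare[of P "\<lambda>x. x \<bullet> e" norm "\<lambda>x. x \<bullet> e" 1] con xe(2) unfolding NX J0 by simp
  have JX: "ennreal (\<epsilon> ^ (?n - 1)) * ?G \<le> ennreal B * ennreal X"
    using conic_gauge_compare[of P "\<lambda>x. x \<bullet> e" "\<lambda>x. x \<bullet> e" norm "1 + \<epsilon>"] con xe(3) \<epsilon> unfolding NX J0 B_def by simp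
  have JT: "ennreal (\<epsilon> ^ ?n / real ?n) * ?G \<le> ennreal B * ennreal T"
    using conic_gauge_compare[of P "\<lambda>x. x \<bullet> f" "\<lambda>x. x \<bullet> e" norm "1 + \<epsilon>"] con xe(3) \<epsilon>
      corner_cone_moment_integral[OF dim e f \<epsilon>, folded P_def] unfolding NT B_def by simp
  have "?G \<noteq> \<infinity>"
  proof
    assume G: "?G = \<infinity>"
    have "ennreal (\<epsilon> ^ (?n - 1)) * ?G = \<infinity>" unfolding G using \<epsilon> by (simp add: ennreal_mult_top)
    moreover have "ennreal B * ennreal X < \<infinity>" by (simp add: ennreal_mult_less_top)
    ultimately show False using JX by (simp add: leD)
  qed
  then obtain g where g: "?G = ennreal g" "0 \<le> g" by (cases ?G) auto
  have XJ': "X \<le> \<epsilon> ^ (?n - 1) * g" using XJ \<epsilon> g X0 by (simp add: ennreal_mult[symmetric])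
  have JX': "\<epsilon> ^ (?n - 1) * g \<le> B * X" using JX \<epsilon> g X0 B by (simp add: ennreal_mult[symmetric])
  have T0: "0 \<le> T" unfolding T_def using xe(4) by (intro integral_nonneg_AE AE_I2) (auto simp: indicator_def)
  have JT': "\<epsilon> ^ ?n / real ?n * g \<le> B * T" using JT \<epsilon> g T0 B by (simp add: ennreal_mult[symmetric])
  \<comment> \<open>The hyperplane \<open>x \<bullet> f = q * (x \<bullet> e)\<close> balances the moments in the unit ball; \<open>q1\<close> is a lower bound for \<open>q\<close> that is close
    to \<open>\<epsilon> / n\<close>.\<close>
  define q where "q = T / X"
  define q1 where "q1 = \<epsilon> / (real ?n * B)"
  have q10: "0 \<le> q1" using \<epsilon> B by (simp add: q1_def)
  have nB: "1 < real ?n * B" using dim B mult_mono[of 2 "real ?n" 1 B] by simp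
  have q1e: "q1 < \<epsilon>" using nB \<epsilon> by (simp add: q1_def divide_less_eq)
  have qq: "q1 \<le> q"
  proof -
    have en: "\<epsilon> ^ ?n = \<epsilon> * \<epsilon> ^ (?n - 1)" using dim by (simp add: power_eq_if)
    have "q1 * X \<le> q1 * (\<epsilon> ^ (?n - 1) * g)" using XJ' q10 by (rule mult_left_mono)
    also have "\<dots> = (\<epsilon> ^ ?n / real ?n * g) / B" unfolding en by (simp add: q1_def)
    also have "\<dots> \<le> T" using JT' B by (subst pos_divide_le_eq) (auto simp: mult.commute)
    finally show ?thesis using X0 by (simp add: q_def le_divide_eq)
  qed
  define u0 where "u0 = f - q *\<^sub>R e"
  have "u0 \<bullet> f = 1" using e f by (auto simp: u0_def inner_diff_left inner_Basis)
  then have u0: "0 < norm u0" by auto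
  define u where "u = u0 /\<^sub>R norm u0"
  have nu: "norm u = 1" using u0 by (simp add: u_def)
  have xu: "x \<bullet> u = (x \<bullet> f - q * (x \<bullet> e)) / norm u0" for x
    by (simp add: u_def u0_def inner_diff_right divide_inverse mult.commute)
  have mom: "(LINT x|lborel. indicator (P \<inter> cball 0 1) x * (x \<bullet> u)) = 0"
  proof -
    have "(LINT x|lborel. indicator (P \<inter> cball 0 1) x * (x \<bullet> u))
        = (LINT x|lborel. (indicator (P \<inter> cball 0 1) x * (x \<bullet> f) - q * (indicator (P \<inter> cball 0 1) x * (x \<bullet> e))) / norm u0)"
      by (intro Bochner_Integration.integral_cong refl) (simp add: xu algebra_simps diff_divide_distrib)
    also have "\<dots> = (T - q * X) / norm u0"
      unfolding T_def X_def using iT iX by simp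
    also have "\<dots> = 0" using X0 by (simp add: q_def)
    finally show ?thesis .
  qed
  let ?S = "P \<inter> {x. 0 \<le> x \<bullet> u}"
  define N where "N = (LINT x|lborel. indicator (?S \<inter> cball 0 1) x * norm x)"
  define S1 where "S1 = {x\<in>P. q1 * (x \<bullet> e) \<le> x \<bullet> f}"
  have [measurable]: "S1 \<in> sets borel" unfolding S1_def by measurable
  have SS: "?S \<subseteq> S1"
  proof
    fix x assume x: "x \<in> ?S"
    then have "q * (x \<bullet> e) \<le> x \<bullet> f" using u0 by (simp add: xu zero_le_divide_iff)
    moreover have "q1 * (x \<bullet> e) \<le> q * (x \<bullet> e)" using qq xe(1)[of x] x by (intro mult_right_mono) auto
    ultimately show "x \<in> S1" using x by (simp add: S1_def)
  qed
  have "ennreal N = (\<integral>\<^sup>+ x. ennreal (norm x) * indicator {x\<in>?S. norm x \<le> 1} x \<partial>lborel)"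
    unfolding N_def by (intro nn_integral_ball_eq_LINT[where C = 1, symmetric]) simp_all
  also have "\<dots> \<le> (\<integral>\<^sup>+ x. ennreal (1 + \<epsilon>) * (ennreal (x \<bullet> e) * indicator {x\<in>S1. norm x \<le> 1} x) \<partial>lborel)"
  proof (rule nn_integral_mono)
    fix x
    show "ennreal (norm x) * indicator {x\<in>?S. norm x \<le> 1} x \<le> ennreal (1 + \<epsilon>) * (ennreal (x \<bullet> e) * indicator {x\<in>S1. norm x \<le> 1} x)"
    proof (cases "x \<in> ?S \<and> norm x \<le> 1")
      case True
      then have "x \<in> S1" and xP: "x \<in> P" using SS by auto
      have "ennreal (norm x) \<le> ennreal ((1 + \<epsilon>) * (x \<bullet> e))" by (rule ennreal_leI[OF xe(3)[OF xP]])
      also have "\<dots> = ennreal (1 + \<epsilon>) * ennreal (x \<bullet> e)" using \<epsilon> xe(1)[OF xP] by (intro ennreal_mult) auto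
      finally have "ennreal (norm x) \<le> ennreal (1 + \<epsilon>) * ennreal (x \<bullet> e)" .
      with \<open>x \<in> S1\<close> show ?thesis using True by simp
    qed auto
  qed
  also have "\<dots> = ennreal (1 + \<epsilon>) * (\<integral>\<^sup>+ x. ennreal (x \<bullet> e) * indicator {x\<in>S1. norm x \<le> 1} x \<partial>lborel)"
    by (rule nn_integral_cmult) measurable
  also have "\<dots> \<le> ennreal (1 + \<epsilon>) * (\<integral>\<^sup>+ x. ennreal (x \<bullet> e) * indicator {x\<in>S1. x \<bullet> e \<le> 1} x \<partial>lborel)"
    by (intro mult_left_mono nn_integral_mono) (auto simp: indicator_def S1_def dest: xe(2))
  also have "(\<integral>\<^sup>+ x. ennreal (x \<bullet> e) * indicator {x\<in>S1. x \<bullet> e \<le> 1} x \<partial>lborel) = ennreal ((\<epsilon> - q1) ^ (?n - 1)) * ?G"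
  proof -
    have "{x \<in> corner_cone \<epsilon> e. x \<bullet> e \<le> 1 \<and> q1 * (x \<bullet> e) \<le> x \<bullet> f} = {x\<in>S1. x \<bullet> e \<le> 1}" by (auto simp: P_def S1_def)
    then show ?thesis using corner_cone_cut_integral[OF e f q10 q1e] by simp
  qed
  also have "ennreal (1 + \<epsilon>) * (ennreal ((\<epsilon> - q1) ^ (?n - 1)) * ?G) = ennreal ((1 + \<epsilon>) * ((\<epsilon> - q1) ^ (?n - 1) * g))"
    unfolding g(1) using \<epsilon> q1e g(2) by (simp add: ennreal_mult)
  finally have N1: "N \<le> (1 + \<epsilon>) * ((\<epsilon> - q1) ^ (?n - 1) * g)"
    using \<epsilon> q1e g(2) by (subst (asm) ennreal_le_iff) (auto intro!: mult_nonneg_nonneg)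
  let ?k = "1 - 1 / (real ?n * B)"
  have k0: "0 \<le> ?k" using nB by simp
  have "\<epsilon> - q1 = \<epsilon> * ?k" by (simp add: q1_def algebra_simps)
  then have "(\<epsilon> - q1) ^ (?n - 1) * g = ?k ^ (?n - 1) * (\<epsilon> ^ (?n - 1) * g)" by (simp add: power_mult_distrib)
  also have "\<dots> \<le> ?k ^ (?n - 1) * (B * D)"
    using B k0 by (intro mult_left_mono order_trans[OF JX'] XD) auto
  finally have "N \<le> (1 + \<epsilon>) * (?k ^ (?n - 1) * (B * D))"
    using \<epsilon> by (intro order_trans[OF N1] mult_left_mono) auto
  then have "N \<le> (1 + \<epsilon>) * B * ?k ^ (?n - 1) * D" by (simp add: mult_ac)
  then show ?thesis using that[OF nu mom] X0 XD unfolding N_def D_def by linarith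
qed

text \<open>
  The factor in \<open>corner_cone_thin_ratio\<close> tends to \<open>(1 - 1 / n) ^ (n - 1)\<close> as \<open>\<epsilon>\<close> tends to zero.
\<close>

theorem spherical_grunbaum_sharp:
  fixes c :: real
  assumes dim: "2 \<le> DIM('a::euclidean_space)" and c: "(1 - 1 / real DIM('a::euclidean_space)) ^ (DIM('a::euclidean_space) - 1) < c"
  obtains A :: "'a::euclidean_space set" and u where "spherical_convex_body A" "norm u = 1" "u \<bullet> spherical_centroid A = 0"
    "measure sphere_measure (A \<inter> halfspace u) < c * measure sphere_measure A"
proof -
  let ?n = "DIM('a)"
  let ?h = "\<lambda>\<epsilon>::real. (1 + \<epsilon>) * (1 + \<epsilon>) ^ (?n + 1) * (1 - 1 / (real ?n * (1 + \<epsilon>) ^ (?n + 1))) ^ (?n - 1)"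
  have "(?h \<longlongrightarrow> (1 - 1 / real ?n) ^ (?n - 1)) (at_right 0)"
    by (auto intro!: tendsto_eq_intros)
  then have "\<forall>\<^sub>F \<epsilon> in at_right 0. ?h \<epsilon> < c" using c by (rule order_tendstoD)
  then have "\<forall>\<^sub>F \<epsilon> in at_right 0. 0 < \<epsilon> \<and> ?h \<epsilon> < c"
    by (rule eventually_conj[OF eventually_at_right_less])
  from eventually_happens[OF this] obtain \<epsilon> where \<epsilon>: "0 < \<epsilon>" and h: "?h \<epsilon> < c" by auto
  obtain e :: 'a where e: "e \<in> Basis" using nonempty_Basis by blast
  have "Basis - {e} \<noteq> {}"
  proof
    assume "Basis - {e} = {}" then have "Basis = {e}" using e by blast
    then have "?n = card {e}" by simp
    then show False using dim by simp
  qed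
  then obtain f :: 'a where f: "f \<in> Basis - {e}" by blast
  define P where "P = corner_cone \<epsilon> e"
  obtain u where u: "norm u = 1" "(LINT x|lborel. indicator (P \<inter> cball 0 1) x * (x \<bullet> u)) = 0"
    "0 < (LINT x|lborel. indicator (P \<inter> cball 0 1) x * norm x)"
    "(LINT x|lborel. indicator (P \<inter> {x. 0 \<le> x \<bullet> u} \<inter> cball 0 1) x * norm x)
      \<le> ?h \<epsilon> * (LINT x|lborel. indicator (P \<inter> cball 0 1) x * norm x)"
    by (rule corner_cone_thin_ratio[OF dim e f \<epsilon>, folded P_def]) (rule that; assumption)
  have [measurable]: "P \<in> sets borel" unfolding P_def by measurable
  have conic: "a *\<^sub>R x \<in> P" if "x \<in> P" "0 \<le> a" for x a
    using corner_cone_scale that unfolding P_def by blast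
  define A where "A = P \<inter> sphere 0 1"
  have "e \<in> A" using e \<epsilon> by (auto simp: A_def P_def corner_cone_def inner_Basis intro!: sum_nonpos)
  then have ne: "A \<noteq> {}" by blast
  have sec: "sector A = P \<inter> cball 0 1" by (rule sector_eq_cone_ball[OF A_def conic ne])
  have body: "convex_body (sector A)"
    unfolding convex_body_def sec P_def
    using corner_cone_interior[OF e \<epsilon>] closed_corner_cone convex_corner_cone
    by (auto intro!: convex_Int closed_Int_compact)
  have "A \<subseteq> {x. x \<bullet> e > 0}"
  proof
    fix x assume x: "x \<in> A"
    then have "1 \<le> (1 + \<epsilon>) * (x \<bullet> e)" using corner_cone_bounds(3)[OF _ e \<epsilon>, of x] by (simp add: A_def P_def)
    then have "0 < (1 + \<epsilon>) * (x \<bullet> e)" by simp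
    then show "x \<in> {x. x \<bullet> e > 0}" using \<epsilon> by (simp add: zero_less_mult_iff)
  qed
  then have "spherical_convex_body A"
    unfolding spherical_convex_body_def using body e by (auto simp: A_def intro!: bexI[of _ e])
  moreover note \<open>norm u = 1\<close>
  moreover have "u \<bullet> spherical_centroid A = 0"
    using u(2) spherical_centroid_orthogonal_iff[OF body, of u] unfolding sec by simp
  moreover have "measure sphere_measure (A \<inter> halfspace u) < c * measure sphere_measure A"
  proof -
    have A1: "measure sphere_measure A = real (?n + 1) * (LINT x|lborel. indicator (P \<inter> cball 0 1) x * norm x)"
      unfolding A_def by (rule sphere_measure_conic) (auto intro: conic)
    have "A \<inter> halfspace u = (P \<inter> {x. 0 \<le> x \<bullet> u}) \<inter> sphere 0 1" by (auto simp: A_def halfspace_def)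
    then have "measure sphere_measure (A \<inter> halfspace u) = measure sphere_measure ((P \<inter> {x. 0 \<le> x \<bullet> u}) \<inter> sphere 0 1)"
      by (rule arg_cong)
    also have "\<dots> = real (?n + 1) * (LINT x|lborel. indicator (P \<inter> {x. 0 \<le> x \<bullet> u} \<inter> cball 0 1) x * norm x)"
    proof (rule sphere_measure_conic)
      show "P \<inter> {x. 0 \<le> x \<bullet> u} \<in> sets borel" by measurable
    next
      fix x :: 'a and a :: real assume "x \<in> P \<inter> {x. 0 \<le> x \<bullet> u}" "0 < a"
      then show "a *\<^sub>R x \<in> P \<inter> {x. 0 \<le> x \<bullet> u}" using conic[of x a] by simp
    qed
    also have "\<dots> \<le> real (?n + 1) * (?h \<epsilon> * (LINT x|lborel. indicator (P \<inter> cball 0 1) x * norm x))"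
      using u(4) by (intro mult_left_mono) auto
    also have "\<dots> < real (?n + 1) * (c * (LINT x|lborel. indicator (P \<inter> cball 0 1) x * norm x))"
      using mult_strict_right_mono[OF h u(3)] by (intro mult_strict_left_mono) auto
    also have "\<dots> = c * measure sphere_measure A" unfolding A1 by (simp add: mult.left_commute)
    finally show ?thesis .
  qed
  ultimately show ?thesis by (rule that)
qed

section \<open>The sharp inequality on the sphere\<close>

theorem theorem1p1:
  assumes "CARD('n::finite) \<ge> 3"
  shows "(\<forall>(K :: (real ^ 'n) set) \<theta>.
            spherical_convex_body K \<and> spherical_centroid K = \<theta> \<longrightarrow>
            (\<forall>u \<in> sphere 0 1. u \<bullet> \<theta> = 0 \<longrightarrow>
               measure sphere_measure (K \<inter> halfspace u)
                 \<ge> (1 - 1 / real CARD('n)) ^ (CARD('n) - 1) * measure sphere_measure K)) \<and>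
         \<not> (\<exists>c > (1 - 1 / real CARD('n)) ^ (CARD('n) - 1).
              \<forall>K :: (real ^ 'n) set. spherical_convex_body K \<longrightarrow>
                (\<forall>u \<in> sphere 0 1. u \<bullet> spherical_centroid K = 0 \<longrightarrow>
                   measure sphere_measure (K \<inter> halfspace u) \<ge> c * measure sphere_measure K))"
proof
  have d: "DIM(real ^ 'n) = CARD('n)" by simp
  show "\<forall>(K :: (real ^ 'n) set) \<theta>.
            spherical_convex_body K \<and> spherical_centroid K = \<theta> \<longrightarrow>
            (\<forall>u \<in> sphere 0 1. u \<bullet> \<theta> = 0 \<longrightarrow>
               measure sphere_measure (K \<inter> halfspace u)
                 \<ge> (1 - 1 / real CARD('n)) ^ (CARD('n) - 1) * measure sphere_measure K)"
  proof (intro allI impI ballI, elim conjE)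
    fix K :: "(real ^ 'n) set" and \<theta> u
    assume "spherical_convex_body K" "spherical_centroid K = \<theta>" "u \<bullet> \<theta> = 0"
    then show "(1 - 1 / real CARD('n)) ^ (CARD('n) - 1) * measure sphere_measure K \<le> measure sphere_measure (K \<inter> halfspace u)"
      using spherical_grunbaum[of K u, unfolded d, OF assms] by simp
  qed
  show "\<not> (\<exists>c > (1 - 1 / real CARD('n)) ^ (CARD('n) - 1).
              \<forall>K :: (real ^ 'n) set. spherical_convex_body K \<longrightarrow>
                (\<forall>u \<in> sphere 0 1. u \<bullet> spherical_centroid K = 0 \<longrightarrow>
                   measure sphere_measure (K \<inter> halfspace u) \<ge> c * measure sphere_measure K))"
  proof (intro notI, elim exE conjE)
    fix c :: real
    assume c: "(1 - 1 / real CARD('n)) ^ (CARD('n) - 1) < c"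
      and all: "\<forall>K :: (real ^ 'n) set. spherical_convex_body K \<longrightarrow>
                (\<forall>u \<in> sphere 0 1. u \<bullet> spherical_centroid K = 0 \<longrightarrow>
                   measure sphere_measure (K \<inter> halfspace u) \<ge> c * measure sphere_measure K)"
    have two: "2 \<le> CARD('n)" using assms by simp
    obtain A :: "(real ^ 'n) set" and u where Au: "spherical_convex_body A" "norm u = 1" "u \<bullet> spherical_centroid A = 0"
      "measure sphere_measure (A \<inter> halfspace u) < c * measure sphere_measure A"
      by (rule spherical_grunbaum_sharp[where 'a = "real ^ 'n", unfolded d, OF two c])
    then have "c * measure sphere_measure A \<le> measure sphere_measure (A \<inter> halfspace u)" using all by simp
    then show False using Au(4) by linarith
  qed
qed

end
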